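(* Let $\alpha > 0$, $\beta \in \mathbb{R}$, $k \in [0,1)$ and $f \in \mathcal{A}$. If $f$ satisfies $$1 + \frac{z f''(z)}{f'(z)} + (\alpha + i\beta - 1) \frac{z f'(z)}{f(z)} \in U(k)$$ for all $z \in \mathbb{D}$, then $f$ can be extended to a $k$-quasiconformal automorphism of $\mathbb{C}$.
   Context: $\mathbb{D} = \{z \in \mathbb{C} : |z| < 1\}$. $\mathcal{A}$ denotes the class of functions $f$ analytic on $\mathbb{D}$ with $f(0) = 0$ and $f'(0) = 1$. The quotient $zf'(z)/f(z)$ is understood to take the value $1$ at $z=0$ (removable singularity). For $0 \leq k < 1$, $$U(k) = \left\{ w \in \mathbb{C} : \left| \frac{w-1}{w+1} \right| \leq k \right\} = \left\{ w \in \mathbb{C} : \left| w - \frac{1+k^2}{1-k^2} \right| \leq \frac{2k}{1-k^2} \right\}.$$ A sense-preserving homeomorphism $F$ of a domain $G \subset \mathbb{C}$ is called $k$-quasiconformal, $k \in [0,1)$, if $F_z$ and $F_{\bar z}$, the partial derivatives in $z$ and $\bar z$ in the distributional sense, are locally integrable on $G$ and satisfy $|F_{\bar z}| \leq k |F_z|$ almost everywhere in $G$. A $k$-quasiconformal automorphism of $\mathbb{C}$ is a $k$-quasiconformal homeomorphism of $\mathbb{C}$ onto itself. *)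

theory Defs
  imports "HOL-Complex_Analysis.Complex_Analysis"
begin

definition class_A :: "(complex \<Rightarrow> complex) set" where
  "class_A = {f. f holomorphic_on ball 0 1 \<and> f 0 = 0 \<and> deriv f 0 = 1}"

(* The quotient z f'(z) / f(z), with its removable singularity at 0 filled in
   (the value is 1 for members of class_A). *)
definition log_deriv_quotient :: "(complex \<Rightarrow> complex) \<Rightarrow> complex \<Rightarrow> complex" where
  "log_deriv_quotient f z = (if z = 0 then 1 else z * deriv f z / f z)"

(* The condition w \<noteq> -1 is needed because x / 0 = 0 would otherwise put -1 into the set. *)
definition U_disk :: "real \<Rightarrow> complex set" where
  "U_disk k = {w. w \<noteq> -1 \<and> cmod ((w - 1) / (w + 1)) \<le> k}"

lemma U_disk_eq_cball:
  assumes "0 \<le> k" "k < 1"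
  shows "U_disk k = cball (of_real ((1 + k\<^sup>2) / (1 - k\<^sup>2))) (2 * k / (1 - k\<^sup>2))"
proof -
  define d where "d = 1 - k\<^sup>2"
  have d: "d > 0"
    unfolding d_def using assms by (simp add: abs_square_less_1)
  have k2: "k\<^sup>2 = 1 - d"
    by (simp add: d_def)
  have "w \<in> U_disk k \<longleftrightarrow> w \<in> cball (of_real ((1 + k\<^sup>2) / (1 - k\<^sup>2))) (2 * k / (1 - k\<^sup>2))" for w
  proof -
    obtain x y where w: "w = Complex x y"
      by (cases w)
    have "w \<in> U_disk k \<longleftrightarrow> cmod (w - 1) \<le> k * cmod (w + 1)"
    proof (cases "w = -1")
      case True
      then show ?thesis by (simp add: U_disk_def)
    next
      case False
      then have "cmod (w + 1) > 0"
        by (metis add_eq_0_iff2 zero_less_norm_iff)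
      then show ?thesis
        using False by (simp add: U_disk_def norm_divide field_simps)
    qed
    also have "\<dots> \<longleftrightarrow> (cmod (w - 1))\<^sup>2 \<le> (k * cmod (w + 1))\<^sup>2"
      using assms by (simp add: abs_le_square_iff[symmetric])
    also have "\<dots> \<longleftrightarrow> (x - 1)\<^sup>2 + y\<^sup>2 \<le> k\<^sup>2 * ((x + 1)\<^sup>2 + y\<^sup>2)"
      by (simp add: w power_mult_distrib cmod_power2)
    also have "\<dots> \<longleftrightarrow> d * ((x - 1)\<^sup>2 + y\<^sup>2) \<le> d * (k\<^sup>2 * ((x + 1)\<^sup>2 + y\<^sup>2))"
      using d by simp
    also have "\<dots> \<longleftrightarrow> (d * x - (1 + k\<^sup>2))\<^sup>2 + (d * y)\<^sup>2 \<le> (2 * k)\<^sup>2"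
      unfolding power_mult_distrib k2 by (simp add: power2_eq_square algebra_simps)
    also have "\<dots> \<longleftrightarrow> (d * cmod (w - of_real ((1 + k\<^sup>2) / d)))\<^sup>2 \<le> (2 * k)\<^sup>2"
    proof -
      have "d * x - (1 + k\<^sup>2) = d * (x - (1 + k\<^sup>2) / d)"
        using d by (simp add: field_simps)
      then show ?thesis
        by (simp only: w power_mult_distrib cmod_power2 distrib_left) simp
    qed
    also have "\<dots> \<longleftrightarrow> d * cmod (w - of_real ((1 + k\<^sup>2) / d)) \<le> 2 * k"
      using d assms by (intro power_mono_iff) auto
    also have "\<dots> \<longleftrightarrow> w \<in> cball (of_real ((1 + k\<^sup>2) / d)) (2 * k / d)"
      using d unfolding mem_cball dist_norm norm_minus_commute[of _ w]
      by (simp add: pos_le_divide_eq mult.commute norm_minus_commute del: of_real_divide)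
    finally show ?thesis
      by (simp add: d_def)
  qed
  then show ?thesis by blast
qed

definition partial_x :: "(complex \<Rightarrow> complex) \<Rightarrow> complex \<Rightarrow> complex" where
  "partial_x \<phi> z = frechet_derivative \<phi> (at z) 1"

definition partial_y :: "(complex \<Rightarrow> complex) \<Rightarrow> complex \<Rightarrow> complex" where
  "partial_y \<phi> z = frechet_derivative \<phi> (at z) \<i>"

definition wirtinger_z :: "(complex \<Rightarrow> complex) \<Rightarrow> complex \<Rightarrow> complex" where
  "wirtinger_z \<phi> z = (partial_x \<phi> z - \<i> * partial_y \<phi> z) / 2"

definition wirtinger_zbar :: "(complex \<Rightarrow> complex) \<Rightarrow> complex \<Rightarrow> complex" where
  "wirtinger_zbar \<phi> z = (partial_x \<phi> z + \<i> * partial_y \<phi> z) / 2"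

(* C^n and C^infinity in the real sense, i.e. on the plane as a real vector space. *)
primrec real_C :: "nat \<Rightarrow> (complex \<Rightarrow> complex) \<Rightarrow> bool" where
  "real_C 0 \<phi> \<longleftrightarrow> continuous_on UNIV \<phi>"
| "real_C (Suc n) \<phi> \<longleftrightarrow>
     (\<forall>z. \<phi> differentiable (at z)) \<and> real_C n (partial_x \<phi>) \<and> real_C n (partial_y \<phi>)"

definition test_functions :: "complex set \<Rightarrow> (complex \<Rightarrow> complex) set" where
  "test_functions G = {\<phi>. (\<forall>n. real_C n \<phi>) \<and>
     compact (closure {z. \<phi> z \<noteq> 0}) \<and> closure {z. \<phi> z \<noteq> 0} \<subseteq> G}"

definition locally_integrable_on :: "(complex \<Rightarrow> complex) \<Rightarrow> complex set \<Rightarrow> bool" where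
  "locally_integrable_on g G \<longleftrightarrow> (\<forall>K. compact K \<and> K \<subseteq> G \<longrightarrow> set_integrable lebesgue K g)"

definition distributional_z :: "complex set \<Rightarrow> (complex \<Rightarrow> complex) \<Rightarrow> (complex \<Rightarrow> complex) \<Rightarrow> bool" where
  "distributional_z G F g \<longleftrightarrow> (\<forall>\<phi>\<in>test_functions G.
     (LINT z:G|lebesgue. F z * wirtinger_z \<phi> z) = - (LINT z:G|lebesgue. g z * \<phi> z))"

definition distributional_zbar :: "complex set \<Rightarrow> (complex \<Rightarrow> complex) \<Rightarrow> (complex \<Rightarrow> complex) \<Rightarrow> bool" where
  "distributional_zbar G F g \<longleftrightarrow> (\<forall>\<phi>\<in>test_functions G.
     (LINT z:G|lebesgue. F z * wirtinger_zbar \<phi> z) = - (LINT z:G|lebesgue. g z * \<phi> z))"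

(* Local degree +1 at every point, expressed by winding numbers of images of
   positively oriented circles. *)
definition sense_preserving_on :: "complex set \<Rightarrow> (complex \<Rightarrow> complex) \<Rightarrow> bool" where
  "sense_preserving_on G F \<longleftrightarrow> (\<forall>z r. r > 0 \<and> cball z r \<subseteq> G \<longrightarrow>
     winding_number (F \<circ> circlepath z r) (F z) = 1)"

definition quasiconformal_on :: "real \<Rightarrow> complex set \<Rightarrow> (complex \<Rightarrow> complex) \<Rightarrow> bool" where
  "quasiconformal_on k G F \<longleftrightarrow>
     0 \<le> k \<and> k < 1 \<and> open G \<and> connected G \<and> G \<noteq> {} \<and>
     (\<exists>H. homeomorphism G (F ` G) F H) \<and> sense_preserving_on G F \<and>
     (\<exists>Fz Fzbar. locally_integrable_on Fz G \<and> locally_integrable_on Fzbar G \<and>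
        distributional_z G F Fz \<and> distributional_zbar G F Fzbar \<and>
        (AE z in lebesgue. z \<in> G \<longrightarrow> cmod (Fzbar z) \<le> k * cmod (Fz z)))"

definition quasiconformal_automorphism :: "real \<Rightarrow> (complex \<Rightarrow> complex) \<Rightarrow> bool" where
  "quasiconformal_automorphism k F \<longleftrightarrow> quasiconformal_on k UNIV F \<and> F ` UNIV = UNIV"

end

theory Submission
  imports Defs
begin

text \<open>
  Put \<open>\<gamma> = \<alpha> + \<i>\<beta>\<close> and write \<open>f(z) = z exp(l(z))\<close>. With \<open>P = \<gamma> z f'/f = \<gamma> (1 + z l')\<close> the
  expression in the hypothesis is \<open>q = P + z P'/P\<close>, and \<open>K = z (f\<^sup>\<gamma>)' = f\<^sup>\<gamma> P\<close> satisfies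
  \<open>z K' = q K\<close>. Consider the chain
  \<open>f\<^sub>t\<^sup>\<gamma> = f\<^sup>\<gamma> + (e\<^sup>t - 1) K\<close>, whose leading coefficient \<open>(1 + (e\<^sup>t - 1) \<gamma>)\<^bsup>1/\<gamma>\<^esup>\<close> is in general
  not real. It has
  \<open>z \<partial>\<^sub>z f\<^sub>t / \<partial>\<^sub>t f\<^sub>t = e\<^bsup>-t\<^esup> + (1 - e\<^bsup>-t\<^esup>) q\<close>, a convex combination of the points \<open>1\<close> and \<open>q\<close> of
  \<open>U(k)\<close>. As in Becker's theorem on Loewner chains, \<open>e\<^bsup>t + \<i>\<theta>\<^esup> \<mapsto> f\<^sub>t(e\<^bsup>\<i>\<theta>\<^esup>)\<close> is then the desired
  extension. For \<open>|z| > 1\<close> and \<open>\<zeta> = z/|z|\<close>, \<open>s = |z| - 1\<close> it reads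
  \<open>F(z) = \<zeta> exp (l(\<zeta>) + Ln (1 + s P(\<zeta>)) / \<gamma>)\<close>, and its complex dilatation has modulus
  \<open>|s (1 - q)| / |2 + s (1 + q)| \<le> k\<close>.

  No general theory of Loewner chains or of quasiconformal maps is used; the explicit formula is
  examined directly, in four steps.

  \<^item> Boundary regularity (\<open>U_disk_subordination\<close>). The equation \<open>P + z P'/P = q\<close> becomes linear in
  \<open>1/P\<close>, and the maximum principle shows that \<open>P\<close> takes values in \<open>U(k)\<close> too. Hence \<open>z l'\<close> and
  \<open>z P' = P (q - P)\<close> are bounded, \<open>l\<close> and \<open>P\<close> extend continuously to the closed disc, and
  \<open>Re (1 + s P) \<ge> 1\<close>, so that the formula for \<open>F\<close> makes sense with the principal logarithm.

  \<^item> Injectivity (\<open>affine_continuation_locally_injective\<close>, \<open>proper_locally_injective_bij\<close>). In the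
  coordinate \<open>Z = log z\<close> the map \<open>F\<^sup>\<gamma>\<close> is a holomorphic function \<open>\<Psi>\<close> on the left half-plane,
  continued affinely across the imaginary axis in the direction of \<open>\<Psi>'\<close>; as \<open>Re (\<Psi>''/\<Psi>') = Re q\<close> is
  bounded below by a positive constant, the rays do not meet locally. So \<open>F\<close> is locally injective.
  It is proper and takes the value \<open>0\<close> only once, whence the set of
  values taken exactly once is open, closed and nonempty.

  \<^item> Orientation (\<open>injective_sense_preserving\<close>). All circles can be deformed into one circle
  around \<open>0\<close> inside the disc, where \<open>z exp (\<tau> l(z))\<close>, \<open>0 \<le> \<tau> \<le> 1\<close>, is a homotopy from the identity to \<open>F\<close>.

  \<^item> Weak derivatives (\<open>extension_weak_derivatives\<close>). \<open>F\<close> is the limit, as \<open>\<rho> \<rightarrow> 1\<close>, of the maps built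
  from \<open>l(\<rho>z)\<close>, \<open>P(\<rho>z)\<close>, \<open>q(\<rho>z)\<close>, which are differentiable off the unit circle with derivatives that are
  bounded on bounded sets uniformly in \<open>\<rho>\<close>. These derivatives converge almost everywhere along a sequence,
  because the bounded function \<open>q\<close> has boundary values
  (\<open>bounded_holomorphic_boundary_values_AE\<close>), so dominated convergence applies.
\<close>

section \<open>The disc U(k) and a Briot-Bouquet differential equation\<close>

lemma U_disk_iff:
  assumes "0 \<le> k" "k < 1"
  shows "w \<in> U_disk k \<longleftrightarrow> cmod (w - 1) \<le> k * cmod (w + 1)"
proof (cases "w = -1")
  case True
  then show ?thesis by (simp add: U_disk_def)
next
  case False
  then have "cmod (w + 1) > 0"
    by (metis add_eq_0_iff2 zero_less_norm_iff)
  then show ?thesis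
    using False by (simp add: U_disk_def norm_divide field_simps)
qed

lemma U_disk_Re_pos:
  assumes k: "0 \<le> k" "k < 1" and w: "w \<in> U_disk k"
  shows "Re w \<ge> (1 - k) / (1 + k)"
proof -
  have "\<bar>Re (w - of_real ((1 + k\<^sup>2) / (1 - k\<^sup>2)))\<bar> \<le> 2 * k / (1 - k\<^sup>2)"
    using w abs_Re_le_cmod order_trans unfolding U_disk_eq_cball[OF k] mem_cball dist_norm norm_minus_commute[of _ w]
    by blast
  then have "Re w \<ge> (1 + k\<^sup>2) / (1 - k\<^sup>2) - 2 * k / (1 - k\<^sup>2)"
    by simp
  also have "(1 + k\<^sup>2) / (1 - k\<^sup>2) - 2 * k / (1 - k\<^sup>2) = (1 - k)\<^sup>2 / ((1 - k) * (1 + k))"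
    by (simp add: diff_divide_distrib[symmetric] power2_eq_square algebra_simps)
  also have "\<dots> = (1 - k) / (1 + k)"
    using k by (simp add: power2_eq_square)
  finally show ?thesis .
qed

text \<open>
  The inversion exchanges \<open>w - 1\<close> and \<open>w + 1\<close> up to factors of the same modulus.
\<close>
lemma U_disk_inverse:
  assumes k: "0 \<le> k" "k < 1" and w: "w \<in> U_disk k"
  shows "inverse w \<in> U_disk k"
proof -
  have "(1 - k) / (1 + k) > 0" using k by simp
  then have w0: "w \<noteq> 0" using U_disk_Re_pos[OF k w] by auto
  have "inverse w - 1 = (1 - w) / w" "inverse w + 1 = (w + 1) / w"
    using w0 by (simp_all add: field_simps)
  then have "cmod (inverse w - 1) = cmod (w - 1) / cmod w"
    "cmod (inverse w + 1) = cmod (w + 1) / cmod w"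
    by (simp_all add: norm_divide norm_minus_commute)
  then show ?thesis
    using w w0 unfolding U_disk_iff[OF k] by (simp add: divide_right_mono)
qed

lemma U_disk_closed: assumes "0 \<le> k" "k < 1" shows "closed (U_disk k)"
  using U_disk_eq_cball[OF assms] by simp

lemma U_disk_bounded: assumes "0 \<le> k" "k < 1" shows "bounded (U_disk k)"
  using U_disk_eq_cball[OF assms] by simp

text \<open>
  The points \<open>z0 exp (w t)\<close>, \<open>t \<ge> 0\<close>, stay in the disc on which \<open>z0\<close> maximises \<open>|h|\<close>, so the
  derivative of \<open>|h|\<^sup>2\<close> along this curve cannot be positive.
\<close>
lemma max_modulus_point_direction:
  assumes h: "h holomorphic_on ball 0 1" and z0: "cmod z0 \<le> \<rho>" and \<rho>: "\<rho> < 1"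
    and mx: "\<And>z. cmod z \<le> \<rho> \<Longrightarrow> cmod (h z) \<le> cmod (h z0)" and w: "Re w \<le> 0"
  shows "Re (w * (cnj (h z0) * (z0 * deriv h z0))) \<le> 0"
proof (rule ccontr)
  assume neg: "\<not> ?thesis"
  let ?g = "\<lambda>t::real. h (z0 * exp (w * of_real t))"
  have z01: "z0 \<in> ball 0 1" using z0 \<rho> by simp
  have dh: "(h has_field_derivative deriv h z0) (at z0)"
    using h z01 by (simp add: holomorphic_derivI)
  have e: "((\<lambda>t::real. z0 * exp (w * of_real t)) has_vector_derivative z0 * w) (at 0)"
  proof -
    have "((\<lambda>t. z0 * exp (w * t)) has_field_derivative z0 * w) (at (of_real 0))"
      by (rule derivative_eq_intros refl | simp)+
    then show ?thesis by (rule has_vector_derivative_real_field)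
  qed
  have dg: "(?g has_vector_derivative (z0 * w) * deriv h z0) (at 0)"
    using field_vector_diff_chain_at[OF e, of h "deriv h z0"] dh by (simp add: o_def)
  have "((\<lambda>t. (cmod (?g t))\<^sup>2) has_vector_derivative 2 * (?g 0 \<bullet> ((z0 * w) * deriv h z0))) (at 0)"
    using dg unfolding has_vector_derivative_def power2_norm_eq_inner
    by (auto intro!: derivative_eq_intros simp: inner_commute algebra_simps)
  then have d: "((\<lambda>t. (cmod (?g t))\<^sup>2) has_real_derivative 2 * (?g 0 \<bullet> ((z0 * w) * deriv h z0))) (at 0)"
    by (simp add: has_real_derivative_iff_has_vector_derivative)
  have "?g 0 \<bullet> ((z0 * w) * deriv h z0) = Re (w * (cnj (h z0) * (z0 * deriv h z0)))"
    by (simp add: inner_complex_def algebra_simps)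
  then have "2 * (?g 0 \<bullet> ((z0 * w) * deriv h z0)) > 0" using neg by simp
  from DERIV_pos_inc_right[OF d this] obtain e where e: "e > 0"
    "\<And>t. t > 0 \<Longrightarrow> t < e \<Longrightarrow> (cmod (?g 0))\<^sup>2 < (cmod (?g t))\<^sup>2" by auto
  have "(cmod (?g 0))\<^sup>2 < (cmod (?g (e/2)))\<^sup>2" by (rule e(2)) (use e(1) in auto)
  moreover have "cmod (z0 * exp (w * of_real (e/2))) \<le> \<rho>"
  proof -
    have "cmod (exp (w * of_real (e/2))) \<le> 1" using mult_nonpos_nonneg[of "Re w" "e/2"] w e(1) by simp
    then have "cmod (z0 * exp (w * of_real (e/2))) \<le> cmod z0 * 1"
      unfolding norm_mult by (rule mult_left_mono) simp
    then show ?thesis using z0 by simp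
  qed
  then have "cmod (?g (e/2)) \<le> cmod (?g 0)" using mx by simp
  ultimately show False by (simp add: power_mono not_le[symmetric])
qed

text \<open>
  A form of Jack's lemma: moving inwards and along the circle in both directions shows that
  \<open>z h'/h\<close> is real and nonnegative at a maximum point of \<open>|h|\<close>. The formulation with the conjugate
  avoids the division.
\<close>
lemma max_modulus_log_derivative:
  assumes h: "h holomorphic_on ball 0 1" and z0: "cmod z0 \<le> \<rho>" and \<rho>: "\<rho> < 1"
    and mx: "\<And>z. cmod z \<le> \<rho> \<Longrightarrow> cmod (h z) \<le> cmod (h z0)"
  obtains m where "m \<ge> 0" "cnj (h z0) * (z0 * deriv h z0) = complex_of_real m"
proof -
  let ?X = "cnj (h z0) * (z0 * deriv h z0)"
  note D = max_modulus_point_direction[OF h z0 \<rho> mx]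
  have "Re (-1 * ?X) \<le> 0" "Re (\<i> * ?X) \<le> 0" "Re (-\<i> * ?X) \<le> 0"
    by (rule D; simp)+
  then have "Re ?X \<ge> 0" "Im ?X = 0" by simp_all
  then show thesis using that[of "Re ?X"] by (simp add: complex_eq_iff)
qed

text \<open>
  The equation expresses \<open>v - Q\<close> as \<open>z Q' v\<close>. At a point where \<open>|Q - c|\<close> is maximal, \<open>z Q'\<close> is a nonnegative
  multiple of \<open>Q - c\<close>, so with \<open>Re v \<ge> 0\<close> the point \<open>v\<close> is at least as far from \<open>c\<close> as \<open>Q\<close>.
\<close>
lemma briot_bouquet_in_cball:
  assumes Q: "Q holomorphic_on ball 0 1"
    and ode: "\<And>z. z \<in> ball 0 1 \<Longrightarrow> Q z + z * deriv Q z * v z = v z"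
    and v: "\<And>z. z \<in> ball 0 1 \<Longrightarrow> v z \<in> cball c R \<and> Re (v z) \<ge> 0"
    and z: "z \<in> ball 0 1"
  shows "Q z \<in> cball c R"
proof (rule ccontr)
  assume contra: "Q z \<notin> cball c R"
  define \<rho> where "\<rho> = cmod z"
  have \<rho>: "\<rho> < 1" using z by (simp add: \<rho>_def)
  define h where "h = (\<lambda>z. Q z - c)"
  have h: "h holomorphic_on ball 0 1" unfolding h_def by (intro holomorphic_intros Q)
  have "continuous_on (cball 0 \<rho>) (\<lambda>z. cmod (h z))"
    using \<rho> by (intro continuous_intros holomorphic_on_imp_continuous_on holomorphic_on_subset[OF h]) auto
  moreover have "compact (cball (0::complex) \<rho>)" "z \<in> cball 0 \<rho>" by (simp_all add: \<rho>_def)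
  ultimately obtain z0 where z0: "z0 \<in> cball 0 \<rho>" "\<And>z. z \<in> cball 0 \<rho> \<Longrightarrow> cmod (h z) \<le> cmod (h z0)"
    using continuous_attains_sup[of "cball 0 \<rho>" "\<lambda>z. cmod (h z)"] by (metis empty_iff)
  have z01: "z0 \<in> ball 0 1" using z0 \<rho> by simp
  obtain m where m: "m \<ge> 0" "cnj (h z0) * (z0 * deriv h z0) = complex_of_real m"
    using max_modulus_log_derivative[OF h, of z0 \<rho>] z0 \<rho> by auto
  have dh: "deriv h z0 = deriv Q z0"
    unfolding h_def using holomorphic_derivI[OF Q open_ball z01]
    by (intro DERIV_imp_deriv) (auto intro!: derivative_eq_intros)
  have R: "cmod (h z0) > R" "R \<ge> 0"
  proof -
    have "cmod (h z) > R" using contra by (simp add: h_def dist_norm norm_minus_commute)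
    then show "cmod (h z0) > R" using z0(2)[of z] by (simp add: \<rho>_def)
    show "R \<ge> 0" using v[OF z] by (metis mem_cball zero_le_dist order_trans)
  qed
  have "cnj (h z0) * (v z0 - c) = cnj (h z0) * h z0 + of_real m * v z0"
  proof -
    have "v z0 - c = h z0 + z0 * deriv h z0 * v z0"
      using ode[OF z01] unfolding dh by (simp add: h_def)
    then have "cnj (h z0) * (v z0 - c) = cnj (h z0) * h z0 + (cnj (h z0) * (z0 * deriv h z0)) * v z0"
      by (metis distrib_left mult.assoc)
    then show ?thesis unfolding m(2) .
  qed
  also have "Re \<dots> = (cmod (h z0))\<^sup>2 + m * Re (v z0)"
    unfolding cmod_power2 by (simp add: power2_eq_square)
  finally have "Re (cnj (h z0) * (v z0 - c)) \<ge> (cmod (h z0))\<^sup>2"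
    using m v[OF z01] by simp
  moreover have "Re (cnj (h z0) * (v z0 - c)) \<le> cmod (h z0) * cmod (v z0 - c)"
    using complex_Re_le_cmod[of "cnj (h z0) * (v z0 - c)"] by (simp add: norm_mult)
  moreover have "cmod (v z0 - c) \<le> R" using v[OF z01] by (simp add: dist_norm norm_minus_commute)
  then have "cmod (h z0) * cmod (v z0 - c) \<le> cmod (h z0) * R" by (rule mult_left_mono) simp
  moreover have "cmod (h z0) * R < (cmod (h z0))\<^sup>2"
    unfolding power2_eq_square by (rule mult_strict_left_mono) (use R in linarith)+
  ultimately show False by linarith
qed

text \<open>
  For \<open>Q = 1/P\<close> the nonlinear equation \<open>P + z P'/P = q\<close> turns into the linear equation
  \<open>Q + z Q' v = v\<close> with \<open>v = 1/q\<close>. Since \<open>U(k)\<close> is a disc in the right half-plane that is invariant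
  under inversion, the previous lemma applies to \<open>Q\<close>.
\<close>
lemma U_disk_subordination:
  assumes k: "0 \<le> k" "k < 1"
    and P: "P holomorphic_on ball 0 1" and P0: "\<And>z. z \<in> ball 0 1 \<Longrightarrow> P z \<noteq> 0"
    and q: "\<And>z. z \<in> ball 0 1 \<Longrightarrow> P z + z * deriv P z / P z \<in> U_disk k"
    and z: "z \<in> ball 0 1"
  shows "P z \<in> U_disk k"
proof -
  define Q where "Q = (\<lambda>z. inverse (P z))"
  define v where "v = (\<lambda>z. inverse (P z + z * deriv P z / P z))"
  have pos: "(1 - k) / (1 + k) > 0" using k by simp
  have "Q z \<in> U_disk k"
    unfolding U_disk_eq_cball[OF k]
  proof (rule briot_bouquet_in_cball[OF _ _ _ z])
    show "Q holomorphic_on ball 0 1" unfolding Q_def by (intro holomorphic_intros P P0)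
    fix z :: complex assume z: "z \<in> ball 0 1"
    have q0: "P z + z * deriv P z / P z \<noteq> 0"
    proof
      assume "P z + z * deriv P z / P z = 0"
      then have "Re (P z + z * deriv P z / P z) = 0" by simp
      then show False using U_disk_Re_pos[OF k q[OF z]] pos by linarith
    qed
    have "deriv Q z = - deriv P z / (P z)\<^sup>2" unfolding Q_def
      using holomorphic_derivI[OF P open_ball z] P0[OF z]
      by (intro DERIV_imp_deriv) (auto intro!: derivative_eq_intros simp: power2_eq_square field_simps)
    then have "(Q z + z * deriv Q z * v z) * (P z + z * deriv P z / P z) = v z * (P z + z * deriv P z / P z)"
      using q0 P0[OF z] by (simp add: v_def Q_def field_simps power2_eq_square)
    then show "Q z + z * deriv Q z * v z = v z" using q0 by simp
    have "v z \<in> U_disk k" unfolding v_def by (rule U_disk_inverse[OF k q[OF z]])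
    then show "v z \<in> cball (of_real ((1 + k\<^sup>2) / (1 - k\<^sup>2))) (2 * k / (1 - k\<^sup>2)) \<and> 0 \<le> Re (v z)"
      using U_disk_Re_pos[OF k, of "v z"] pos unfolding U_disk_eq_cball[OF k, symmetric] by linarith
  qed
  then have "inverse (Q z) \<in> U_disk k" by (rule U_disk_inverse[OF k])
  then show ?thesis by (simp add: Q_def)
qed

text \<open>
  A bound for \<open>z g'\<close> controls \<open>g'\<close> near the boundary and compactness controls it near \<open>0\<close>; so \<open>g\<close> is
  Lipschitz.
\<close>
lemma bounded_radial_derivative_extension:
  assumes g: "g holomorphic_on ball 0 1"
    and B: "\<And>z. z \<in> ball 0 1 \<Longrightarrow> cmod (z * deriv g z) \<le> B"
  obtains g' where "continuous_on (cball 0 1) g'" "\<And>z. z \<in> ball 0 1 \<Longrightarrow> g' z = g z"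
proof -
  have "continuous_on (cball 0 (1/2)) (deriv g)"
    by (intro holomorphic_on_imp_continuous_on holomorphic_on_subset[OF holomorphic_deriv[OF g]]) auto
  then have "bounded (deriv g ` cball 0 (1/2))"
    by (intro compact_imp_bounded compact_continuous_image) auto
  then obtain C where "\<forall>x\<in>deriv g ` cball 0 (1/2). cmod x \<le> C"
    unfolding bounded_iff by blast
  then have C: "\<And>z. cmod z \<le> 1/2 \<Longrightarrow> cmod (deriv g z) \<le> C" by simp
  have D: "cmod (deriv g z) \<le> max C (2 * B)" if z: "z \<in> ball 0 1" for z
  proof (cases "cmod z \<le> 1/2")
    case True
    then show ?thesis using C by (simp add: le_max_iff_disj)
  next
    case False
    then have "cmod (deriv g z) * (1/2) \<le> cmod (deriv g z) * cmod z" by (intro mult_left_mono) auto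
    then show ?thesis using B[OF z] by (simp add: norm_mult algebra_simps le_max_iff_disj)
  qed
  have "uniformly_continuous_on (ball 0 1) g"
  proof -
    have "cmod (g x - g y) \<le> max C (2 * B) * cmod (x - y)" if "x \<in> ball 0 1" "y \<in> ball 0 1" for x y
      using field_differentiable_bound[of "ball 0 1" g "deriv g" "max C (2 * B)" x y]
        holomorphic_derivI[OF g open_ball] D that by auto
    moreover have "max C (2 * B) \<ge> 0" using order_trans[OF norm_ge_zero D[of 0]] by simp
    ultimately have "(max C (2 * B))-lipschitz_on (ball 0 1) g"
      by (intro lipschitz_onI) (auto simp: dist_norm)
    then show ?thesis by (rule lipschitz_on_uniformly_continuous)
  qed
  then obtain g' where "uniformly_continuous_on (closure (ball 0 1)) g'" "\<And>z. z \<in> ball 0 1 \<Longrightarrow> g z = g' z"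
    using uniformly_continuous_on_extension_on_closure by metis
  then show thesis using that[of g'] by (simp add: uniformly_continuous_imp_continuous)
qed

section \<open>Boundary values of bounded holomorphic functions\<close>

lemma has_integral_circle_power:
  fixes n m :: nat
  shows "((\<lambda>\<theta>. cis (real n * \<theta>) * cnj (cis (real m * \<theta>))) has_integral (if n = m then of_real (2 * pi) else 0)) {0..2*pi}"
proof (cases "n = m")
  case True
  have "((\<lambda>\<theta>::real. 1::complex) has_integral of_real (2*pi)) {0..2*pi}"
    using has_integral_const_real[of "1::complex" 0 "2*pi"] by (simp add: scaleR_conv_of_real)
  moreover have "cis (real m * \<theta>) * cnj (cis (real m * \<theta>)) = 1" for \<theta>
    by (simp only: complex_norm_square[symmetric] norm_cis) simp
  ultimately show ?thesis using True by simp
next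
  case False
  define a where "a = \<i> * (of_nat n - of_nat m)"
  have a0: "a \<noteq> 0" using False by (simp add: a_def)
  have "((\<lambda>\<theta>. exp (a * of_real \<theta>)) has_integral exp (a * of_real (2*pi)) / a - exp (a * of_real 0) / a) {0..2*pi}"
  proof (rule fundamental_theorem_of_calculus)
    fix x :: real
    have "((\<lambda>z. exp (a * z) / a) has_field_derivative exp (a * of_real x)) (at (of_real x))"
      using a0 by (auto intro!: derivative_eq_intros)
    then show "((\<lambda>x. exp (a * of_real x) / a) has_vector_derivative exp (a * of_real x)) (at x within {0..2 * pi})"
      by (rule has_vector_derivative_real_field)
  qed simp
  moreover have "exp (a * of_real (2*pi)) = 1"
    using exp_integer_2pi[of "of_nat n - of_nat m"] by (simp add: a_def mult.commute mult.left_commute)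
  moreover have "exp (a * of_real \<theta>) = cis (real n * \<theta>) * cnj (cis (real m * \<theta>))" for \<theta>
  proof -
    have "exp (a * of_real \<theta>) = cis (real n * \<theta> + - (real m * \<theta>))"
      by (simp add: cis_conv_exp a_def algebra_simps)
    also have "\<dots> = cis (real n * \<theta>) * cnj (cis (real m * \<theta>))"
      by (simp only: cis_cnj cis_mult[symmetric])
    finally show ?thesis .
  qed
  ultimately show ?thesis using False by simp
qed

lemma parseval_finite:
  fixes c :: "nat \<Rightarrow> complex"
  shows "((\<lambda>\<theta>. (cmod (\<Sum>n<N. c n * cis (real n * \<theta>)))\<^sup>2) has_integral 2 * pi * (\<Sum>n<N. (cmod (c n))\<^sup>2)) {0..2*pi}"
proof -
  have "((\<lambda>\<theta>. \<Sum>n<N. \<Sum>m<N. (c n * cnj (c m)) * (cis (real n * \<theta>) * cnj (cis (real m * \<theta>)))) has_integral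
      (\<Sum>n<N. \<Sum>m<N. (c n * cnj (c m)) * (if n = m then of_real (2 * pi) else 0))) {0..2*pi}"
    by (intro has_integral_sum has_integral_mult_right has_integral_circle_power) auto
  moreover have "(\<Sum>n<N. \<Sum>m<N. (c n * cnj (c m)) * (cis (real n * \<theta>) * cnj (cis (real m * \<theta>))))
      = of_real ((cmod (\<Sum>n<N. c n * cis (real n * \<theta>)))\<^sup>2)" for \<theta>
    unfolding complex_norm_square by (simp add: sum_product algebra_simps)
  moreover have "(\<Sum>n<N. \<Sum>m<N. (c n * cnj (c m)) * (if n = m then of_real (2 * pi) else 0))
      = of_real (2 * pi * (\<Sum>n<N. (cmod (c n))\<^sup>2))"
    by (simp add: if_distrib[of "\<lambda>x. _ * x"] sum.delta' complex_norm_square[symmetric] sum_distrib_left mult.commute cong: if_cong)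
  ultimately have "((\<lambda>\<theta>. complex_of_real ((cmod (\<Sum>n<N. c n * cis (real n * \<theta>)))\<^sup>2)) has_integral
      of_real (2 * pi * (\<Sum>n<N. (cmod (c n))\<^sup>2))) {0..2*pi}"
    by simp
  from has_integral_Re[OF this] show ?thesis by simp
qed

text \<open>
  The partial sums converge uniformly, so the finite Parseval identity passes to the limit.
\<close>
lemma parseval_absolutely_summable:
  fixes c :: "nat \<Rightarrow> complex"
  assumes c: "summable (\<lambda>n. cmod (c n))" and g: "\<And>\<theta>. (\<lambda>n. c n * cis (real n * \<theta>)) sums g \<theta>"
  shows "(\<lambda>n. (cmod (c n))\<^sup>2) sums (integral {0..2*pi} (\<lambda>\<theta>. (cmod (g \<theta>))\<^sup>2) / (2 * pi))"
proof -
  let ?S = "\<lambda>N \<theta>. \<Sum>n<N. c n * cis (real n * \<theta>)"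
  have S: "uniform_limit {0..2*pi} ?S g sequentially"
  proof -
    have "uniform_limit {0..2*pi} ?S (\<lambda>\<theta>. \<Sum>n. c n * cis (real n * \<theta>)) sequentially"
      by (rule Weierstrass_m_test[OF _ c]) (simp add: norm_mult)
    moreover have "(\<lambda>\<theta>. \<Sum>n. c n * cis (real n * \<theta>)) = g" by (rule ext) (metis g sums_unique)
    ultimately show ?thesis by simp
  qed
  have bdd: "cmod (?S N \<theta>) \<le> suminf (\<lambda>n. cmod (c n))" for N \<theta>
  proof -
    have "cmod (?S N \<theta>) \<le> (\<Sum>n<N. cmod (c n))" by (rule norm_sum[THEN order_trans]) (simp add: norm_mult)
    also have "\<dots> \<le> suminf (\<lambda>n. cmod (c n))" by (intro sum_le_suminf c) auto
    finally show ?thesis .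
  qed
  have Slim: "(\<lambda>N. ?S N \<theta>) \<longlonglongrightarrow> g \<theta>" for \<theta> using g[of \<theta>] by (simp add: sums_def)
  have "(\<lambda>N. integral {0..2*pi} (\<lambda>\<theta>. (cmod (?S N \<theta>))\<^sup>2)) \<longlonglongrightarrow> integral {0..2*pi} (\<lambda>\<theta>. (cmod (g \<theta>))\<^sup>2)"
  proof (rule dominated_convergence(2)[where h = "\<lambda>_. (suminf (\<lambda>n. cmod (c n)))\<^sup>2"])
    show "(\<lambda>\<theta>. (cmod (?S N \<theta>))\<^sup>2) integrable_on {0..2*pi}" for N
      using parseval_finite by blast
    show "norm ((cmod (?S N \<theta>))\<^sup>2) \<le> (suminf (\<lambda>n. cmod (c n)))\<^sup>2" for N \<theta>
      using power_mono[OF bdd[of \<theta> N] norm_ge_zero, of 2] by simp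
    show "(\<lambda>N. (cmod (?S N \<theta>))\<^sup>2) \<longlonglongrightarrow> (cmod (g \<theta>))\<^sup>2" for \<theta>
      by (rule tendsto_power[OF tendsto_norm[OF Slim]])
  qed auto
  moreover have "integral {0..2*pi} (\<lambda>\<theta>. (cmod (?S N \<theta>))\<^sup>2) = 2 * pi * (\<Sum>n<N. (cmod (c n))\<^sup>2)" for N
    using parseval_finite by (rule integral_unique)
  ultimately have "(\<lambda>N. (2 * pi * (\<Sum>n<N. (cmod (c n))\<^sup>2)) / (2 * pi)) \<longlonglongrightarrow> integral {0..2*pi} (\<lambda>\<theta>. (cmod (g \<theta>))\<^sup>2) / (2 * pi)"
    by (intro tendsto_divide tendsto_const) simp_all
  then show ?thesis by (simp add: sums_def)
qed

text \<open>
  By Parseval both sides are sums over the Taylor coefficients \<open>a\<^sub>n\<close>, and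
  \<open>(s\<^sup>n - r\<^sup>n)\<^sup>2 \<le> (s\<^sup>n)\<^sup>2 - (r\<^sup>n)\<^sup>2\<close>. So the square mean along a circle increases with the radius, and its
  increments control the mean square distance between the restrictions to two circles.
\<close>
lemma circle_mean_square_increment:
  assumes q: "q holomorphic_on ball 0 1" and r: "0 \<le> r" "r \<le> s" "s < 1"
  shows "integral {0..2*pi} (\<lambda>\<theta>. (cmod (q (of_real s * cis \<theta>) - q (of_real r * cis \<theta>)))\<^sup>2)
    \<le> integral {0..2*pi} (\<lambda>\<theta>. (cmod (q (of_real s * cis \<theta>)))\<^sup>2) - integral {0..2*pi} (\<lambda>\<theta>. (cmod (q (of_real r * cis \<theta>)))\<^sup>2)"
proof -
  define a where "a = (\<lambda>n. (deriv ^^ n) q 0 / fact n)"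
  have ps: "(\<lambda>n. a n * z ^ n) sums q z" if "cmod z < 1" for z
    using holomorphic_power_series[OF q, of z] that by (simp add: a_def)
  have abs: "summable (\<lambda>n. cmod (a n * of_real t ^ n))" if "0 \<le> t" "t < 1" for t
  proof (rule powser_insidea)
    show "summable (\<lambda>n. a n * of_real ((1 + t) / 2) ^ n)"
      using ps[of "of_real ((1 + t) / 2)"] that by (intro sums_summable) (auto simp del: of_real_divide of_real_add)
    show "cmod (of_real t) < cmod (of_real ((1 + t) / 2))" using that by (simp del: of_real_divide of_real_add)
  qed
  have circ: "(\<lambda>n. (a n * of_real t ^ n) * cis (real n * \<theta>)) sums q (of_real t * cis \<theta>)" if "0 \<le> t" "t < 1" for t \<theta>
    using ps[of "of_real t * cis \<theta>"] that by (simp add: norm_mult power_mult_distrib Complex.DeMoivre mult.assoc)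
  have P: "(\<lambda>n. (cmod (a n * of_real t ^ n))\<^sup>2) sums (integral {0..2*pi} (\<lambda>\<theta>. (cmod (q (of_real t * cis \<theta>)))\<^sup>2) / (2 * pi))"
    if "0 \<le> t" "t < 1" for t
    by (rule parseval_absolutely_summable[OF abs circ]) (use that in auto)
  have s0: "0 \<le> s" and r1: "r < 1" using r by auto
  have S: "(\<lambda>n. (cmod (a n * of_real s ^ n - a n * of_real r ^ n))\<^sup>2) sums
      (integral {0..2*pi} (\<lambda>\<theta>. (cmod (q (of_real s * cis \<theta>) - q (of_real r * cis \<theta>)))\<^sup>2) / (2 * pi))"
  proof (rule parseval_absolutely_summable)
    show "summable (\<lambda>n. cmod (a n * of_real s ^ n - a n * of_real r ^ n))"
      by (rule summable_comparison_test'[OF summable_add[OF abs[OF s0 r(3)] abs[OF r(1) r1]], of 0])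
        (use norm_triangle_ineq4 in auto)
    show "(\<lambda>n. (a n * of_real s ^ n - a n * of_real r ^ n) * cis (real n * \<theta>)) sums (q (of_real s * cis \<theta>) - q (of_real r * cis \<theta>))" for \<theta>
      unfolding left_diff_distrib by (intro sums_diff circ) (use r s0 r1 in auto)
  qed
  have "(cmod (a n * of_real s ^ n - a n * of_real r ^ n))\<^sup>2
      \<le> (cmod (a n * of_real s ^ n))\<^sup>2 - (cmod (a n * of_real r ^ n))\<^sup>2" for n
  proof -
    have rs: "0 \<le> r ^ n" "r ^ n \<le> s ^ n" using r by (auto intro: power_mono)
    have "a n * of_real s ^ n - a n * of_real r ^ n = a n * of_real (s ^ n - r ^ n)" by (simp add: algebra_simps)
    then have "(cmod (a n * of_real s ^ n - a n * of_real r ^ n))\<^sup>2 = (cmod (a n))\<^sup>2 * (s ^ n - r ^ n)\<^sup>2"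
      by (simp only: norm_mult norm_of_real power_mult_distrib power2_abs)
    also have "\<dots> \<le> (cmod (a n))\<^sup>2 * ((s ^ n)\<^sup>2 - (r ^ n)\<^sup>2)"
    proof (rule mult_left_mono)
      have "r ^ n * r ^ n \<le> r ^ n * s ^ n" using rs by (intro mult_left_mono) auto
      then show "(s ^ n - r ^ n)\<^sup>2 \<le> (s ^ n)\<^sup>2 - (r ^ n)\<^sup>2" by (simp add: power2_eq_square algebra_simps)
    qed simp
    also have "\<dots> = (cmod (a n * of_real s ^ n))\<^sup>2 - (cmod (a n * of_real r ^ n))\<^sup>2"
      using r s0 by (simp add: norm_mult norm_power power_mult_distrib algebra_simps)
    finally show ?thesis .
  qed
  note le = this
  have "integral {0..2*pi} (\<lambda>\<theta>. (cmod (q (of_real s * cis \<theta>) - q (of_real r * cis \<theta>)))\<^sup>2) / (2 * pi)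
    \<le> integral {0..2*pi} (\<lambda>\<theta>. (cmod (q (of_real s * cis \<theta>)))\<^sup>2) / (2*pi) - integral {0..2*pi} (\<lambda>\<theta>. (cmod (q (of_real r * cis \<theta>)))\<^sup>2) / (2*pi)"
    by (rule sums_le[OF le S sums_diff[OF P[OF s0 r(3)] P[OF r(1) r1]]])
  then show ?thesis using pi_gt_zero by (simp add: field_simps)
qed

lemma continuous_on_circle_restriction:
  assumes q: "q holomorphic_on ball 0 1" and s: "0 \<le> s" "s < 1"
  shows "continuous_on A (\<lambda>\<theta>::real. q (of_real s * cis \<theta>))"
proof -
  have "continuous_on (cball 0 s) q"
    using s by (intro holomorphic_on_imp_continuous_on holomorphic_on_subset[OF q]) auto
  then show ?thesis
    by (rule continuous_on_compose2) (use s in \<open>auto intro!: continuous_intros simp: norm_mult\<close>)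
qed

text \<open>
  The square means increase with the radius and are bounded, hence converge; their increments bound
  the \<open>L\<^sup>2\<close> distances.
\<close>
lemma circle_L1_Cauchy:
  assumes q: "q holomorphic_on ball 0 1" and C: "\<And>z. z \<in> ball 0 1 \<Longrightarrow> cmod (q z) \<le> C"
    and \<rho>: "incseq \<rho>" "\<And>n. 0 \<le> \<rho> n" "\<And>n. \<rho> n < 1" and e: "e > 0"
  shows "\<exists>N. \<forall>i\<ge>N. \<forall>j\<ge>N.
    integral {0..2*pi} (\<lambda>\<theta>. cmod (q (of_real (\<rho> i) * cis \<theta>) - q (of_real (\<rho> j) * cis \<theta>))) < e"
proof -
  define J where "J = (\<lambda>n. integral {0..2*pi} (\<lambda>\<theta>. (cmod (q (of_real (\<rho> n) * cis \<theta>)))\<^sup>2))"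
  note cont = continuous_on_circle_restriction[OF q \<rho>(2,3)]
  have D: "integral {0..2*pi} (\<lambda>\<theta>. (cmod (q (of_real (\<rho> j) * cis \<theta>) - q (of_real (\<rho> i) * cis \<theta>)))\<^sup>2) \<le> J j - J i"
    if "i \<le> j" for i j
    unfolding J_def by (rule circle_mean_square_increment[OF q]) (use \<rho> that in \<open>auto simp: incseq_def\<close>)
  have "incseq J"
  proof (rule incseq_SucI)
    fix n
    have "0 \<le> integral {0..2*pi} (\<lambda>\<theta>. (cmod (q (of_real (\<rho> (Suc n)) * cis \<theta>) - q (of_real (\<rho> n) * cis \<theta>)))\<^sup>2)"
      by (intro integral_nonneg integrable_continuous_real continuous_intros cont) auto
    then show "J n \<le> J (Suc n)" using D[of n "Suc n"] by simp
  qed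
  moreover have "J n \<le> 2 * pi * C\<^sup>2" for n
  proof -
    have "J n \<le> integral {0..2*pi} (\<lambda>\<theta>. C\<^sup>2)" unfolding J_def
    proof (rule integral_le)
      show "(\<lambda>\<theta>. (cmod (q (of_real (\<rho> n) * cis \<theta>)))\<^sup>2) integrable_on {0..2*pi}"
        by (intro integrable_continuous_real continuous_intros cont)
      show "(cmod (q (of_real (\<rho> n) * cis \<theta>)))\<^sup>2 \<le> C\<^sup>2" for \<theta>
        by (intro power_mono C) (use \<rho> in \<open>auto simp: norm_mult\<close>)
    qed (intro integrable_continuous_real continuous_intros)
    then show ?thesis by simp
  qed
  ultimately have "convergent J" unfolding convergent_def by (metis incseq_convergent)
  then have "Cauchy J" by (rule convergent_Cauchy)
  \<comment> \<open>The inequality \<open>u \<le> d + u\<^sup>2 / (4 d)\<close> turns a bound for the square mean into one for the mean;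
    with this \<open>d\<close> each of the two summands contributes at most \<open>e / 4\<close>.\<close>
  moreover define d where "d = e / (8 * pi)"
  have d: "d > 0" using e by (simp add: d_def)
  ultimately obtain N where N: "\<And>i j. i \<ge> N \<Longrightarrow> j \<ge> N \<Longrightarrow> \<bar>J i - J j\<bar> < e * d"
    using e d by (metis CauchyD mult_pos_pos real_norm_def)
  have main: "integral {0..2*pi} (\<lambda>\<theta>. cmod (q (of_real (\<rho> j) * cis \<theta>) - q (of_real (\<rho> i) * cis \<theta>))) < e"
    if ij: "i \<le> j" "i \<ge> N" for i j
  proof -
    let ?u = "\<lambda>\<theta>. cmod (q (of_real (\<rho> j) * cis \<theta>) - q (of_real (\<rho> i) * cis \<theta>))"
    have "integral {0..2*pi} ?u \<le> integral {0..2*pi} (\<lambda>\<theta>. d + (1 / (4 * d)) * (?u \<theta>)\<^sup>2)"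
    proof (rule integral_le)
      show "?u \<theta> \<le> d + (1 / (4 * d)) * (?u \<theta>)\<^sup>2" for \<theta>
      proof -
        have "0 \<le> (?u \<theta> - 2 * d)\<^sup>2 / (4 * d)" using d by simp
        also have "\<dots> = d + (1 / (4 * d)) * (?u \<theta>)\<^sup>2 - ?u \<theta>"
          using d by (simp add: field_simps power2_eq_square)
        finally show ?thesis by simp
      qed
    qed (intro integrable_continuous_real continuous_intros cont)+
    also have "\<dots> = 2 * pi * d + (1 / (4 * d)) * integral {0..2*pi} (\<lambda>\<theta>. (?u \<theta>)\<^sup>2)"
    proof -
      have "(\<lambda>\<theta>. (1 / (4 * d)) * (?u \<theta>)\<^sup>2) integrable_on {0..2*pi}"
        by (intro integrable_continuous_real continuous_intros cont)
      then show ?thesis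
        by (subst integral_add) (auto intro!: integrable_continuous_real)
    qed
    also have "(1 / (4 * d)) * integral {0..2*pi} (\<lambda>\<theta>. (?u \<theta>)\<^sup>2) \<le> (1 / (4 * d)) * (e * d)"
      using D[OF ij(1)] N[of j i] ij d by (intro mult_left_mono) auto
    also have "2 * pi * d + (1 / (4 * d)) * (e * d) = e / 2"
      using d by (simp add: d_def)
    finally show ?thesis using e by simp
  qed
  show ?thesis
  proof (intro exI allI impI)
    fix i j assume "N \<le> i" "N \<le> j"
    then show "integral {0..2*pi} (\<lambda>\<theta>. cmod (q (of_real (\<rho> i) * cis \<theta>) - q (of_real (\<rho> j) * cis \<theta>))) < e"
      using main[of i j] main[of j i] by (cases "i \<le> j") (auto simp: norm_minus_commute)
  qed
qed

text \<open>
  This transfers a null set of angles to the plane: the polar coordinate map is differentiable, and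
  such maps preserve null sets.
\<close>
lemma negligible_rays:
  assumes "N \<in> null_sets lborel"
  shows "negligible ((\<lambda>(t, \<theta>). of_real t * cis \<theta>) ` (UNIV \<times> N))"
proof (rule negligible_differentiable_image_negligible)
  have "UNIV \<times> N \<in> null_sets (lborel \<Otimes>\<^sub>M lborel :: (real \<times> real) measure)"
    by (rule lborel.times_in_null_sets2) (use assms in auto)
  then have "UNIV \<times> N \<in> null_sets (lborel :: (real \<times> real) measure)"
    by (simp add: lborel_prod)
  then show "negligible (UNIV \<times> N :: (real \<times> real) set)"
    using negligible_iff_null_sets null_sets_completionI by blast
  have "((\<lambda>p. of_real (fst p) * cis (snd p)) has_derivative
      (\<lambda>h. of_real (fst p) * (of_real (snd h) * (\<i> * cis (snd p))) + of_real (fst h) * cis (snd p))) (at p within S)" for p S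
    by (auto intro!: derivative_eq_intros simp: scaleR_conv_of_real)
  then have "(\<lambda>p. of_real (fst p) * cis (snd p)) differentiable_on (UNIV \<times> N)"
    unfolding differentiable_on_def differentiable_def by blast
  then show "(\<lambda>(t, \<theta>). of_real t * cis \<theta>) differentiable_on (UNIV \<times> N)"
    by (simp add: case_prod_unfold)
qed simp

text \<open>
  A weak form of Fatou's theorem: an \<open>L\<^sup>1\<close> Cauchy sequence has a subsequence that converges almost
  everywhere. The exceptional set of angles is turned into a set of rays, since the limit is needed at almost
  every point of the plane.
\<close>
lemma bounded_holomorphic_boundary_values_AE:
  assumes q: "q holomorphic_on ball 0 1" and C: "\<And>z. z \<in> ball 0 1 \<Longrightarrow> cmod (q z) \<le> C"
    and \<rho>: "incseq \<rho>" "\<And>n. 0 \<le> \<rho> n" "\<And>n. \<rho> n < 1"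
  obtains r :: "nat \<Rightarrow> nat" where "strict_mono r"
    "AE z in lebesgue. convergent (\<lambda>n. q (of_real (\<rho> (r n)) * sgn z))"
proof -
  let ?I = "{0..2*pi}"
  define s where "s = (\<lambda>n \<theta>. indicator ?I \<theta> *\<^sub>R q (of_real (\<rho> n) * cis \<theta>))"
  note cont = continuous_on_circle_restriction[OF q \<rho>(2,3)]
  have int: "integrable lborel (s n)" for n
    unfolding s_def using borel_integrable_atLeastAtMost'[OF cont, of 0 "2*pi" n]
    by (simp add: set_integrable_def)
  have "LINT \<theta>|lborel. cmod (s i \<theta> - s j \<theta>) = integral ?I (\<lambda>\<theta>. cmod (q (of_real (\<rho> i) * cis \<theta>) - q (of_real (\<rho> j) * cis \<theta>)))" for i j
  proof -
    have "(LINT \<theta>|lborel. cmod (s i \<theta> - s j \<theta>)) =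
       (LINT \<theta>:?I|lborel. cmod (q (of_real (\<rho> i) * cis \<theta>) - q (of_real (\<rho> j) * cis \<theta>)))"
      unfolding set_lebesgue_integral_def by (rule Bochner_Integration.integral_cong) (auto simp: s_def indicator_def)
    also have "\<dots> = integral ?I (\<lambda>\<theta>. cmod (q (of_real (\<rho> i) * cis \<theta>) - q (of_real (\<rho> j) * cis \<theta>)))"
      by (intro set_borel_integral_eq_integral borel_integrable_atLeastAtMost' continuous_intros cont)
    finally show ?thesis .
  qed
  then have "\<exists>N. \<forall>i\<ge>N. \<forall>j\<ge>N. (LINT \<theta>|lborel. cmod (s i \<theta> - s j \<theta>)) < e" if "e > 0" for e
    using circle_L1_Cauchy[OF q C \<rho> that] by simp
  from cauchy_L1_AE_cauchy_subseq[OF int this]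
  obtain r where r: "strict_mono r" "AE \<theta> in lborel. Cauchy (\<lambda>i. s (r i) \<theta>)" by metis
  then obtain N where N: "N \<in> null_sets lborel" "\<And>\<theta>. \<theta> \<notin> N \<Longrightarrow> Cauchy (\<lambda>i. s (r i) \<theta>)"
    by (auto elim!: AE_E3)
  have "AE z in lebesgue. convergent (\<lambda>n. q (of_real (\<rho> (r n)) * sgn z))"
  proof (rule AE_I')
    show "(\<lambda>(t, \<theta>). of_real t * cis \<theta>) ` (UNIV \<times> N) \<in> null_sets lebesgue"
      using negligible_rays[OF N(1)] by (simp add: negligible_iff_null_sets)
    show "{z \<in> space lebesgue. \<not> convergent (\<lambda>n. q (of_real (\<rho> (r n)) * sgn z))}
        \<subseteq> (\<lambda>(t, \<theta>). of_real t * cis \<theta>) ` (UNIV \<times> N)"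
    proof clarify
      fix z assume nc: "\<not> convergent (\<lambda>n. q (of_real (\<rho> (r n)) * sgn z))"
      have "z \<noteq> 0" using nc by (auto simp: convergent_const)
      have z: "z = of_real (cmod z) * cis (Arg2pi z)"
        using Arg2pi_eq[of z] by (simp add: cis_conv_exp)
      then have sg: "sgn z = cis (Arg2pi z)"
      proof -
        have "cis (Arg2pi z) = z / of_real (cmod z)" using z \<open>z \<noteq> 0\<close> by (simp add: nonzero_eq_divide_eq mult.commute)
        then show ?thesis by (simp add: sgn_eq)
      qed
      have I: "Arg2pi z \<in> ?I" using Arg2pi_ge_0[of z] Arg2pi_lt_2pi[of z] by simp
      have "Arg2pi z \<in> N"
      proof (rule ccontr)
        assume "Arg2pi z \<notin> N"
        from N(2)[OF this] I have "Cauchy (\<lambda>i. q (of_real (\<rho> (r i)) * sgn z))"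
          by (simp add: s_def sg)
        then show False using nc Cauchy_convergent by blast
      qed
      then show "z \<in> (\<lambda>(t, \<theta>). of_real t * cis \<theta>) ` (UNIV \<times> N)"
        using z by force
    qed
  qed
  with r(1) show thesis by (rule that)
qed

section \<open>Integration by parts off the unit circle\<close>

text \<open>
  This is what makes the fundamental theorem of calculus applicable along lines to functions that
  are differentiable only off the circle.
\<close>
lemma finite_line_Int_unit_circle:
  fixes z d :: complex
  assumes d: "cmod d = 1"
  shows "finite {t::real. cmod (z + of_real t * d) = 1}"
proof (cases "{t::real. cmod (z + of_real t * d) = 1} = {}")
  case False
  then obtain s where s: "cmod (z + of_real s * d) = 1" by auto
  define b where "b = 2 * Re (z * cnj d)"
  have sq: "(cmod (z + of_real t * d))\<^sup>2 = (cmod z)\<^sup>2 + t * b + t\<^sup>2" for t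
  proof -
    have "(cmod (z + of_real t * d))\<^sup>2 = (cmod z)\<^sup>2 + t * b + t\<^sup>2 * (cmod d)\<^sup>2"
      unfolding cmod_power2 b_def by (simp add: power2_eq_square algebra_simps)
    then show ?thesis using d by simp
  qed
  have "t = s \<or> t = - s - b" if "cmod (z + of_real t * d) = 1" for t
  proof -
    have "t * b + t\<^sup>2 = s * b + s\<^sup>2" using sq[of t] sq[of s] that s by simp
    then have "(t - s) * (t + s + b) = 0" by (simp add: algebra_simps power2_eq_square)
    then show ?thesis by auto
  qed
  then have "{t::real. cmod (z + of_real t * d) = 1} \<subseteq> {s, - s - b}" by auto
  then show ?thesis by (rule finite_subset) simp
qed simp

lemma directional_derivative_along_line:
  fixes \<psi> :: "complex \<Rightarrow> complex"
  assumes "(\<psi> has_derivative D) (at (z + of_real t * d))"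
  shows "((\<lambda>t. \<psi> (z + of_real t * d)) has_vector_derivative D d) (at t)"
proof -
  have "((\<lambda>t. z + of_real t * d) has_derivative (\<lambda>h. h *\<^sub>R d)) (at t)"
    by (auto intro!: derivative_eq_intros simp: scaleR_conv_of_real)
  from diff_chain_at[OF this assms] have "((\<lambda>t. \<psi> (z + of_real t * d)) has_derivative (\<lambda>h. D (h *\<^sub>R d))) (at t)"
    by (simp add: o_def)
  moreover have "D (h *\<^sub>R d) = h *\<^sub>R D d" for h
    using assms by (simp add: has_derivative_bounded_linear linear_simps(5))
  ultimately show ?thesis by (simp add: has_vector_derivative_def)
qed

lemma lipschitz_along_line_off_circle:
  fixes \<psi> :: "complex \<Rightarrow> complex"
  assumes cont: "continuous_on UNIV \<psi>" and d: "cmod d = 1"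
    and deriv: "\<And>z. cmod z \<noteq> 1 \<Longrightarrow> (\<psi> has_derivative \<psi>' z) (at z)"
    and B: "\<And>z. cmod z \<noteq> 1 \<Longrightarrow> cmod (\<psi>' z d) \<le> B" and h: "0 \<le> h"
  shows "cmod (\<psi> (z + of_real h * d) - \<psi> z) \<le> B * h"
proof -
  let ?S = "{t::real. cmod (z + of_real t * d) = 1}"
  have "((\<lambda>t. \<psi>' (z + of_real t * d) d) has_integral \<psi> (z + of_real h * d) - \<psi> (z + of_real 0 * d)) {0..h}"
  proof (rule fundamental_theorem_of_calculus_interior_strong[OF finite_line_Int_unit_circle[OF d, of z] h])
    show "continuous_on {0..h} (\<lambda>t. \<psi> (z + of_real t * d))"
      by (rule continuous_on_compose2[OF cont]) (auto intro!: continuous_intros)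
    fix t assume "t \<in> {0<..<h} - ?S"
    then have "(\<psi> has_derivative \<psi>' (z + of_real t * d)) (at (z + of_real t * d))"
      by (intro deriv) simp
    then show "((\<lambda>t. \<psi> (z + of_real t * d)) has_vector_derivative \<psi>' (z + of_real t * d) d) (at t)"
      by (rule directional_derivative_along_line)
  qed
  then have "((\<lambda>t. \<psi>' (z + of_real t * d) d) has_integral \<psi> (z + of_real h * d) - \<psi> z) (cbox 0 h)"
    by simp
  from has_integral_bound_spike_finite[OF _ finite_line_Int_unit_circle[OF d, of z] this, of B]
  show ?thesis using B h order_trans[OF norm_ge_zero B[of 0]] by auto
qed

lemma integrable_continuous_compact_support:
  fixes f :: "complex \<Rightarrow> complex"
  assumes "continuous_on UNIV f" "\<And>z. cmod z > R \<Longrightarrow> f z = 0"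
  shows "integrable lborel f"
proof -
  have "integrable lborel (\<lambda>x. indicator (cball 0 R) x *\<^sub>R f x)"
    by (rule borel_integrable_compact) (auto intro: continuous_on_subset[OF assms(1)])
  moreover have "(\<lambda>x. indicator (cball 0 R) x *\<^sub>R f x) = f"
    using assms(2) by (force simp: indicator_def)
  ultimately show ?thesis by simp
qed

text \<open>
  By translation invariance every difference quotient has integral \<open>0\<close>, and the difference
  quotients converge boundedly off the circle, which is a null set. The value \<open>0\<close> on the circle is
  arbitrary; it gives a function that is defined everywhere.
\<close>
lemma integral_directional_derivative_eq_0:
  fixes \<psi> :: "complex \<Rightarrow> complex"
  assumes cont: "continuous_on UNIV \<psi>" and supp: "\<And>z. cmod z > R \<Longrightarrow> \<psi> z = 0" and d: "cmod d = 1"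
    and deriv: "\<And>z. cmod z \<noteq> 1 \<Longrightarrow> (\<psi> has_derivative \<psi>' z) (at z)"
    and B: "\<And>z. cmod z \<noteq> 1 \<Longrightarrow> cmod (\<psi>' z d) \<le> B"
  shows "(LINT z|lborel. (if cmod z = 1 then 0 else \<psi>' z d)) = 0"
    and "integrable lborel (\<lambda>z. if cmod z = 1 then 0 else \<psi>' z d)"
proof -
  define h where "h = (\<lambda>n::nat. 1 / (real n + 1))"
  have h: "h n > 0" "h n \<le> 1" for n by (auto simp: h_def)
  have h0: "h \<longlonglongrightarrow> 0" unfolding h_def using LIMSEQ_inverse_real_of_nat by (simp add: inverse_eq_divide add.commute)
  define u where "u = (\<lambda>n z. (\<psi> (z + of_real (h n) * d) - \<psi> z) / of_real (h n))"
  define f where "f = (\<lambda>z. if cmod z = 1 then 0 else \<psi>' z d)"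
  have contd: "continuous_on UNIV (\<lambda>z. \<psi> (z + c))" for c
    by (rule continuous_on_compose2[OF cont]) (auto intro!: continuous_intros)
  have int: "integrable lborel (\<lambda>z. \<psi> (z + c))" for c
  proof (rule integrable_continuous_compact_support[OF contd])
    fix z assume "R + cmod c < cmod z"
    then show "\<psi> (z + c) = 0" using norm_triangle_ineq2[of z "-c"] by (intro supp) simp
  qed
  have trans: "(LINT z|lborel. \<psi> (z + c)) = (LINT z|lborel. \<psi> z)" for c
  proof -
    have "(LINT z|lborel. \<psi> z) = (LINT z|distr lborel borel ((+) c). \<psi> z)" by (simp add: lborel_distr_plus)
    also have "\<dots> = (LINT z|lborel. \<psi> (c + z))"
      by (rule integral_distr) (auto intro: borel_measurable_continuous_onI[OF cont])
    finally show ?thesis by (simp add: add.commute)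
  qed
  have u0: "(LINT z|lborel. u n z) = 0" for n
    unfolding u_def using int[of "of_real (h n) * d"] int[of 0] trans[of "of_real (h n) * d"] by simp
  have [measurable]: "\<psi> \<in> borel_measurable borel" by (rule borel_measurable_continuous_onI[OF cont])
  have u_meas [measurable]: "u n \<in> borel_measurable lborel" for n
    unfolding u_def by (rule borel_measurable_divide) auto
  have lim: "(\<lambda>n. u n z) \<longlonglongrightarrow> \<psi>' z d" if z: "cmod z \<noteq> 1" for z
  proof -
    have "((\<lambda>t. \<psi> (z + of_real t * d)) has_vector_derivative \<psi>' z d) (at 0)"
      using directional_derivative_along_line[of \<psi> "\<psi>' z" z 0 d] deriv[OF z] by simp
    then have "((\<lambda>t. norm (\<psi> (z + of_real t * d) - \<psi> z - t *\<^sub>R \<psi>' z d) / norm t) \<longlongrightarrow> 0) (at 0)"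
      unfolding has_vector_derivative_def has_derivative_at by simp
    then have "(\<lambda>n. norm (\<psi> (z + of_real (h n) * d) - \<psi> z - (h n) *\<^sub>R \<psi>' z d) / norm (h n)) \<longlonglongrightarrow> 0"
      by (rule filterlim_compose) (use h0 h in \<open>auto simp: filterlim_at intro!: always_eventually less_imp_neq[symmetric]\<close>)
    moreover have "norm (\<psi> (z + of_real (h n) * d) - \<psi> z - (h n) *\<^sub>R \<psi>' z d) / norm (h n) = norm (u n z - \<psi>' z d)" for n
    proof -
      have "u n z - \<psi>' z d = (\<psi> (z + of_real (h n) * d) - \<psi> z - (h n) *\<^sub>R \<psi>' z d) / of_real (h n)"
        using h[of n] by (simp add: u_def field_simps scaleR_conv_of_real)
      then show ?thesis by (simp add: norm_divide)
    qed
    ultimately have "(\<lambda>n. norm (u n z - \<psi>' z d)) \<longlonglongrightarrow> 0" by simp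
    then show ?thesis by (rule LIM_zero_cancel[OF tendsto_norm_zero_cancel])
  qed
  have f_meas [measurable]: "f \<in> borel_measurable lborel"
  proof (rule borel_measurable_LIMSEQ_metric)
    show "(\<lambda>z. if cmod z = 1 then 0 else u n z) \<in> borel_measurable lborel" for n by measurable
    show "(\<lambda>n. if cmod z = 1 then 0 else u n z) \<longlonglongrightarrow> f z" for z using lim[of z] by (simp add: f_def)
  qed
  have AEc: "AE z in lborel. cmod z \<noteq> 1"
  proof -
    have "sphere (0::complex) 1 \<in> null_sets lebesgue"
      using negligible_sphere[of "0::complex" 1] by (simp only: negligible_iff_null_sets)
    then have "sphere (0::complex) 1 \<in> null_sets lborel"
      by (simp add: null_sets_completion_iff)
    from AE_not_in[OF this] show ?thesis by simp
  qed
  let ?w = "\<lambda>z::complex. indicator (cball 0 (R + 1)) z *\<^sub>R B"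
  have w: "integrable lborel ?w" by (rule borel_integrable_compact) auto
  have AElim: "AE z in lborel. (\<lambda>n. u n z) \<longlonglongrightarrow> f z" using AEc by eventually_elim (simp add: f_def lim)
  have dom: "AE z in lborel. cmod (u n z) \<le> ?w z" for n
  proof (rule AE_I2)
    fix z
    show "cmod (u n z) \<le> ?w z"
    proof (cases "cmod z \<le> R + 1")
      case True
      have "cmod (u n z) \<le> B"
        unfolding u_def using h[of n] lipschitz_along_line_off_circle[OF cont d deriv B, of "h n" z]
        by (simp add: norm_divide pos_divide_le_eq)
      then show ?thesis using True h[of n] by simp
    next
      case False
      have "\<psi> (z + of_real (h n) * d) = 0" "\<psi> z = 0"
        using False h[of n] d norm_triangle_ineq2[of z "- (of_real (h n) * d)"]
        by (auto intro!: supp simp: norm_mult)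
      then show ?thesis using False by (simp add: u_def)
    qed
  qed
  have "(\<lambda>n. LINT z|lborel. u n z) \<longlonglongrightarrow> (LINT z|lborel. f z)"
    by (rule integral_dominated_convergence[OF f_meas u_meas w AElim dom])
  then show "(LINT z|lborel. (if cmod z = 1 then 0 else \<psi>' z d)) = 0"
    unfolding u0 f_def[symmetric] using LIMSEQ_unique tendsto_const by blast
  show "integrable lborel (\<lambda>z. if cmod z = 1 then 0 else \<psi>' z d)"
    using integrable_dominated_convergence[OF f_meas u_meas w AElim dom] by (simp add: f_def)
qed

lemma test_function_properties:
  assumes \<phi>: "\<phi> \<in> test_functions UNIV" and d: "d = 1 \<or> d = \<i>"
  shows "continuous_on UNIV \<phi>" "(\<phi> has_derivative frechet_derivative \<phi> (at z)) (at z)"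
    "continuous_on UNIV (\<lambda>z. frechet_derivative \<phi> (at z) d)"
    "\<exists>R. \<forall>z. cmod z > R \<longrightarrow> \<phi> z = 0 \<and> frechet_derivative \<phi> (at z) d = 0"
proof -
  have C: "real_C n \<phi>" for n using \<phi> by (simp add: test_functions_def)
  show "continuous_on UNIV \<phi>" using C[of 0] by simp
  have diff: "\<phi> differentiable (at z)" for z using C[of "Suc 0"] by simp
  show "(\<phi> has_derivative frechet_derivative \<phi> (at z)) (at z)"
    using diff frechet_derivative_works by blast
  have "continuous_on UNIV (partial_x \<phi>)" "continuous_on UNIV (partial_y \<phi>)" using C[of "Suc 0"] by simp_all
  then show "continuous_on UNIV (\<lambda>z. frechet_derivative \<phi> (at z) d)"
    using d by (auto simp: partial_x_def[abs_def] partial_y_def[abs_def])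
  have "compact (closure {z. \<phi> z \<noteq> 0})" using \<phi> by (simp add: test_functions_def)
  then have "bounded {z. \<phi> z \<noteq> 0}"
    by (rule bounded_subset[OF compact_imp_bounded closure_subset])
  then obtain R where "\<forall>z\<in>{z. \<phi> z \<noteq> 0}. cmod z \<le> R" unfolding bounded_iff by blast
  then have R: "\<phi> z = 0" if "cmod z > R" for z using that by force
  have "frechet_derivative \<phi> (at z) d = 0" if z: "cmod z > R" for z
  proof -
    have "(\<phi> has_derivative (\<lambda>h. 0)) (at z)"
    proof (rule has_derivative_transform_within_open)
      show "((\<lambda>_. 0) has_derivative (\<lambda>h. 0)) (at z)" by simp
      show "open {z. cmod z > R}" by (intro open_Collect_less continuous_intros)
      show "z \<in> {z. cmod z > R}" using z by simp
      show "\<And>x. x \<in> {z. cmod z > R} \<Longrightarrow> 0 = \<phi> x" using R by simp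
    qed
    from frechet_derivative_at[OF this] show ?thesis by (rule fun_cong[symmetric])
  qed
  with R show "\<exists>R. \<forall>z. cmod z > R \<longrightarrow> \<phi> z = 0 \<and> frechet_derivative \<phi> (at z) d = 0" by blast
qed

lemma AE_lebesgue_not_unit_circle: "AE z in lebesgue. cmod z \<noteq> 1"
proof -
  have "sphere (0::complex) 1 \<in> null_sets lebesgue"
    using negligible_sphere[of "0::complex" 1] by (simp only: negligible_iff_null_sets)
  from AE_not_in[OF this] show ?thesis by simp
qed

text \<open>
  The preceding lemma, applied to the product \<open>\<Phi> \<phi>\<close>.
\<close>
lemma integration_by_parts_off_circle:
  assumes \<phi>: "\<phi> \<in> test_functions UNIV" and d: "d = 1 \<or> d = \<i>"
    and cont: "continuous_on UNIV \<Phi>"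
    and deriv: "\<And>z. cmod z \<noteq> 1 \<Longrightarrow> (\<Phi> has_derivative \<Phi>' z) (at z)"
    and bound: "\<And>R. \<exists>B. \<forall>z. cmod z \<le> R \<and> cmod z \<noteq> 1 \<longrightarrow> cmod (\<Phi>' z d) \<le> B"
  shows "integrable lebesgue (\<lambda>z. \<Phi> z * frechet_derivative \<phi> (at z) d)"
    "integrable lebesgue (\<lambda>z. (if cmod z = 1 then 0 else \<Phi>' z d) * \<phi> z)"
    "(LINT z|lebesgue. \<Phi> z * frechet_derivative \<phi> (at z) d) =
      - (LINT z|lebesgue. (if cmod z = 1 then 0 else \<Phi>' z d) * \<phi> z)"
proof -
  note T = test_function_properties[OF \<phi> d]
  let ?D = "\<lambda>z. frechet_derivative \<phi> (at z) d"
  obtain R where R: "\<And>z. cmod z > R \<Longrightarrow> \<phi> z = 0" "\<And>z. cmod z > R \<Longrightarrow> ?D z = 0"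
    using T(4) by blast
  have "bounded ((\<lambda>z. \<Phi> z * ?D z) ` cball 0 R)" "bounded (\<phi> ` cball 0 R)"
    by (intro compact_imp_bounded compact_continuous_image continuous_intros
          continuous_on_subset[OF cont] continuous_on_subset[OF T(1)] continuous_on_subset[OF T(3)]; simp)+
  then obtain M1 M2 where "\<forall>w\<in>(\<lambda>z. \<Phi> z * ?D z) ` cball 0 R. cmod w \<le> M1" "\<forall>w\<in>\<phi> ` cball 0 R. cmod w \<le> M2"
    unfolding bounded_iff by blast
  then have M: "\<And>z. cmod z \<le> R \<Longrightarrow> cmod (\<Phi> z * ?D z) \<le> M1" "\<And>z. cmod z \<le> R \<Longrightarrow> cmod (\<phi> z) \<le> M2"
    by simp_all
  obtain B where B: "\<And>z. cmod z \<le> R \<Longrightarrow> cmod z \<noteq> 1 \<Longrightarrow> cmod (\<Phi>' z d) \<le> B" using bound[of R] by blast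
  let ?\<psi>' = "\<lambda>z h. \<Phi> z * frechet_derivative \<phi> (at z) h + \<Phi>' z h * \<phi> z"
  have contp: "continuous_on UNIV (\<lambda>z. \<Phi> z * \<phi> z)" by (intro continuous_intros cont T(1))
  have supp: "\<Phi> z * \<phi> z = 0" if "cmod z > R" for z using R that by simp
  have d1: "cmod d = 1" using d by auto
  have dp: "((\<lambda>z. \<Phi> z * \<phi> z) has_derivative ?\<psi>' z) (at z)" if "cmod z \<noteq> 1" for z
    by (rule has_derivative_mult[OF deriv[OF that] T(2)])
  have bp: "cmod (?\<psi>' z d) \<le> max 0 M1 + max 0 B * max 0 M2" if z: "cmod z \<noteq> 1" for z
  proof (cases "cmod z \<le> R")
    case True
    have "cmod (?\<psi>' z d) \<le> cmod (\<Phi> z * ?D z) + cmod (\<Phi>' z d) * cmod (\<phi> z)"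
      using norm_triangle_ineq by (metis norm_mult)
    also have "\<dots> \<le> max 0 M1 + max 0 B * max 0 M2"
      using M[OF True] B[OF True z] by (intro add_mono mult_mono) auto
    finally show ?thesis .
  next
    case False
    then show ?thesis using R[of z] by simp
  qed
  note I = integral_directional_derivative_eq_0[OF contp supp d1 dp bp]
  have I1: "integrable lborel (\<lambda>z. \<Phi> z * ?D z)"
    by (rule integrable_continuous_compact_support[where R = R]) (auto intro!: continuous_intros cont T(3) simp: R)
  have eq: "(if cmod z = 1 then 0 else ?\<psi>' z d) = (if cmod z = 1 then 0 else \<Phi> z * ?D z) + (if cmod z = 1 then 0 else \<Phi>' z d) * \<phi> z" for z
    by simp
  have L1: "integrable lebesgue (\<lambda>z. if cmod z = 1 then 0 else ?\<psi>' z d)"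
    using I(2) integrable_completion borel_measurable_integrable by blast
  have L0: "(LINT z|lebesgue. (if cmod z = 1 then 0 else ?\<psi>' z d)) = 0"
    using I(1) integral_completion[OF borel_measurable_integrable[OF I(2)]] by simp
  show L2: "integrable lebesgue (\<lambda>z. \<Phi> z * ?D z)"
    using I1 integrable_completion borel_measurable_integrable by blast
  let ?E = "\<lambda>z. (if cmod z = 1 then 0 else ?\<psi>' z d) - (if cmod z = 1 then 0 else \<Phi> z * ?D z)"
  have L3: "integrable lborel (\<lambda>z. if cmod z = 1 then 0 else \<Phi> z * ?D z)"
    using integrable_mult_indicator[of "- sphere 0 1" lborel "\<lambda>z. \<Phi> z * ?D z"] I1
    by (auto simp: indicator_def if_distrib[of "\<lambda>x. x *\<^sub>R _"] cong: if_cong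
        elim!: Bochner_Integration.integrable_cong[THEN iffD1, rotated 2])
  then have L4: "integrable lebesgue (\<lambda>z. if cmod z = 1 then 0 else \<Phi> z * ?D z)"
    using integrable_completion borel_measurable_integrable by blast
  have E: "?E z = (if cmod z = 1 then 0 else \<Phi>' z d) * \<phi> z" for z by simp
  have "integrable lebesgue ?E" by (intro Bochner_Integration.integrable_diff L1 L4)
  then show "integrable lebesgue (\<lambda>z. (if cmod z = 1 then 0 else \<Phi>' z d) * \<phi> z)"
    unfolding E .
  have "(LINT z|lebesgue. ?E z) = 0 - (LINT z|lebesgue. (if cmod z = 1 then 0 else \<Phi> z * ?D z))"
    by (subst Bochner_Integration.integral_diff[OF L1 L4]) (simp only: L0)
  also have "(LINT z|lebesgue. (if cmod z = 1 then 0 else \<Phi> z * ?D z)) = (LINT z|lebesgue. \<Phi> z * ?D z)"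
  proof (rule integral_cong_AE)
    show "AE z in lebesgue. (if cmod z = 1 then 0 else \<Phi> z * ?D z) = \<Phi> z * ?D z"
      using AE_lebesgue_not_unit_circle by eventually_elim simp
  qed (use L2 L4 in \<open>auto dest: borel_measurable_integrable\<close>)
  finally show "(LINT z|lebesgue. \<Phi> z * ?D z) = - (LINT z|lebesgue. (if cmod z = 1 then 0 else \<Phi>' z d) * \<phi> z)"
    unfolding E by simp
qed

text \<open>
  Integration by parts survives limits with almost everywhere convergent, locally bounded derivatives.
  It is used in the two directions \<open>1\<close> and \<open>\<i>\<close>, from which both Wirtinger derivatives are combined.
\<close>
lemma weak_directional_derivative_limit:
  assumes \<phi>: "\<phi> \<in> test_functions UNIV" and d: "d = 1 \<or> d = \<i>"
    and cont: "\<And>n. continuous_on UNIV (\<Phi> n)" and cont': "continuous_on UNIV F"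
    and deriv: "\<And>n z. cmod z \<noteq> 1 \<Longrightarrow> (\<Phi> n has_derivative \<Phi>' n z) (at z)"
    and bound: "\<And>R. \<exists>B. \<forall>n z. cmod z \<le> R \<longrightarrow> cmod (\<Phi> n z) \<le> B \<and> (cmod z \<noteq> 1 \<longrightarrow> cmod (\<Phi>' n z d) \<le> B)"
    and lim: "\<And>z. (\<lambda>n. \<Phi> n z) \<longlonglongrightarrow> F z"
    and G: "G \<in> borel_measurable lebesgue" and limd: "AE z in lebesgue. (\<lambda>n. \<Phi>' n z d) \<longlonglongrightarrow> G z"
  shows "integrable lebesgue (\<lambda>z. F z * frechet_derivative \<phi> (at z) d)"
    "integrable lebesgue (\<lambda>z. G z * \<phi> z)"
    "(LINT z|lebesgue. F z * frechet_derivative \<phi> (at z) d) = - (LINT z|lebesgue. G z * \<phi> z)"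
proof -
  note T = test_function_properties[OF \<phi> d]
  let ?D = "\<lambda>z. frechet_derivative \<phi> (at z) d"
  let ?d = "\<lambda>n z. if cmod z = 1 then 0 else \<Phi>' n z d"
  obtain R where R: "\<And>z. cmod z > R \<Longrightarrow> \<phi> z = 0" "\<And>z. cmod z > R \<Longrightarrow> ?D z = 0"
    using T(4) by blast
  obtain B where B: "\<And>n z. cmod z \<le> R \<Longrightarrow> cmod (\<Phi> n z) \<le> B"
    "\<And>n z. cmod z \<le> R \<Longrightarrow> cmod z \<noteq> 1 \<Longrightarrow> cmod (\<Phi>' n z d) \<le> B" using bound[of R] by blast
  have IBP: "integrable lebesgue (\<lambda>z. \<Phi> n z * ?D z)" "integrable lebesgue (\<lambda>z. ?d n z * \<phi> z)"
    "(LINT z|lebesgue. \<Phi> n z * ?D z) = - (LINT z|lebesgue. ?d n z * \<phi> z)" for n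
    using integration_by_parts_off_circle[OF \<phi> d cont[of n] deriv] bound by blast+
  have meas: "f \<in> borel_measurable lebesgue" if "continuous_on UNIV f" for f :: "complex \<Rightarrow> complex"
    using borel_measurable_continuous_onI[OF that] by (simp add: measurable_completion)
  have intc: "integrable lebesgue f" if "continuous_on UNIV f" "\<And>z. cmod z > R \<Longrightarrow> f z = 0" for f :: "complex \<Rightarrow> complex"
    using integrable_continuous_compact_support[OF that] integrable_completion borel_measurable_integrable by blast
  have w1: "integrable lebesgue (\<lambda>z. max 0 B * cmod (?D z))"
    by (intro integrable_mult_right integrable_norm intc T(3) R(2))
  have w2: "integrable lebesgue (\<lambda>z. max 0 B * cmod (\<phi> z))"
    by (intro integrable_mult_right integrable_norm intc T(1) R(1))
  have m1: "(\<lambda>z. F z * ?D z) \<in> borel_measurable lebesgue" by (intro meas continuous_intros cont' T(3))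
  have m2: "(\<lambda>z. G z * \<phi> z) \<in> borel_measurable lebesgue" by (intro borel_measurable_times G meas T(1))
  have l1: "AE z in lebesgue. (\<lambda>n. \<Phi> n z * ?D z) \<longlonglongrightarrow> F z * ?D z"
    by (intro AE_I2 tendsto_intros lim)
  have l2: "AE z in lebesgue. (\<lambda>n. ?d n z * \<phi> z) \<longlonglongrightarrow> G z * \<phi> z"
    using limd AE_lebesgue_not_unit_circle by eventually_elim (auto intro!: tendsto_intros)
  have b1: "AE z in lebesgue. norm (\<Phi> n z * ?D z) \<le> max 0 B * cmod (?D z)" for n
  proof (rule AE_I2)
    show "norm (\<Phi> n z * ?D z) \<le> max 0 B * cmod (?D z)" for z
      using B(1)[of z n] R(2)[of z] by (cases "cmod z \<le> R") (auto simp: norm_mult intro!: mult_right_mono)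
  qed
  have b2: "AE z in lebesgue. norm (?d n z * \<phi> z) \<le> max 0 B * cmod (\<phi> z)" for n
  proof (rule AE_I2)
    show "norm (?d n z * \<phi> z) \<le> max 0 B * cmod (\<phi> z)" for z
      using B(2)[of z n] R(1)[of z] by (cases "cmod z \<le> R") (auto simp: norm_mult intro!: mult_right_mono)
  qed
  have s1: "(\<lambda>z. \<Phi> n z * ?D z) \<in> borel_measurable lebesgue" "(\<lambda>z. ?d n z * \<phi> z) \<in> borel_measurable lebesgue" for n
    using IBP(1,2)[of n] by (auto dest: borel_measurable_integrable)
  show "integrable lebesgue (\<lambda>z. F z * ?D z)" by (rule integrable_dominated_convergence[OF m1 s1(1) w1 l1 b1])
  show "integrable lebesgue (\<lambda>z. G z * \<phi> z)" by (rule integrable_dominated_convergence[OF m2 s1(2) w2 l2 b2])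
  have "(\<lambda>n. LINT z|lebesgue. \<Phi> n z * ?D z) \<longlonglongrightarrow> (LINT z|lebesgue. F z * ?D z)"
    by (rule integral_dominated_convergence[OF m1 s1(1) w1 l1 b1])
  moreover have "(\<lambda>n. - (LINT z|lebesgue. ?d n z * \<phi> z)) \<longlonglongrightarrow> - (LINT z|lebesgue. G z * \<phi> z)"
    by (intro tendsto_minus integral_dominated_convergence[OF m2 s1(2) w2 l2 b2])
  ultimately show "(LINT z|lebesgue. F z * ?D z) = - (LINT z|lebesgue. G z * \<phi> z)"
    unfolding IBP(3) by (rule LIMSEQ_unique)
qed

section \<open>Local injectivity of an affine continuation\<close>

text \<open>
  The mean value theorem on a segment, with derivative known only inside the half-plane: the segment
  is shifted slightly to the left, and the shift tends to \<open>0\<close>. A general linear functional \<open>Re (u \<cdot>)\<close>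
  yields estimates of norms as well as of one-sided components.
\<close>
lemma half_plane_mean_value:
  assumes cont: "continuous_on {w. Re w \<le> 0} g"
    and deriv: "\<And>w. Re w < 0 \<Longrightarrow> (g has_field_derivative g' w) (at w)"
    and ab: "a \<in> ball p \<delta>" "Re a \<le> 0" "b \<in> ball p \<delta>" "Re b \<le> 0"
    and m: "\<And>w. w \<in> ball p \<delta> \<Longrightarrow> Re w < 0 \<Longrightarrow> Re (u * ((b - a) * g' w)) \<le> m"
  shows "Re (u * (g b - g a)) \<le> m"
proof -
  have inner: "Re (u * (g b' - g a')) \<le> m"
    if ab': "a' \<in> ball p \<delta>" "Re a' < 0" "b' \<in> ball p \<delta>" "Re b' < 0" "b' - a' = b - a" for a' b'
  proof -
    let ?c = "\<lambda>t::real. a' + of_real t * (b' - a')"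
    have seg: "?c t \<in> ball p \<delta> \<and> Re (?c t) < 0" if "0 \<le> t" "t \<le> 1" for t
    proof -
      have "convex (ball p \<delta> \<inter> {w. Re w < 0})"
        by (intro convex_Int convex_ball convex_halfspace_Re_lt)
      from convexD_alt[OF this, of a' b' t] ab' that show ?thesis
        by (simp add: scaleR_conv_of_real algebra_simps)
    qed
    have "((\<lambda>t. Re (u * g (?c t))) has_real_derivative Re (u * ((b - a) * g' (?c t)))) (at t)" if "0 \<le> t" "t \<le> 1" for t
    proof -
      have "((\<lambda>z. a' + z * (b' - a')) has_field_derivative (b - a)) (at (of_real t))"
        using ab'(5) by (auto intro!: derivative_eq_intros)
      from DERIV_chain2[OF deriv this] seg[OF that]
      have "((\<lambda>z. g (a' + z * (b' - a'))) has_field_derivative g' (?c t) * (b - a)) (at (of_real t))" by simp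
      then have "((\<lambda>z. u * g (a' + z * (b' - a'))) has_field_derivative u * (g' (?c t) * (b - a))) (at (of_real t))"
        by (rule DERIV_cmult)
      then have "((\<lambda>t. u * g (?c t)) has_vector_derivative u * (g' (?c t) * (b - a))) (at t)"
        by (rule has_vector_derivative_real_field)
      then have "((\<lambda>t. Re (u * g (?c t))) has_vector_derivative Re (u * (g' (?c t) * (b - a)))) (at t)"
        by (rule bounded_linear.has_vector_derivative[OF bounded_linear_Re])
      then show ?thesis by (simp add: has_real_derivative_iff_has_vector_derivative mult.commute)
    qed
    from MVT2[of 0 1 "\<lambda>t. Re (u * g (?c t))", OF _ this]
    obtain t where t: "0 < t" "t < 1" "Re (u * g (?c 1)) - Re (u * g (?c 0)) = (1 - 0) * Re (u * ((b - a) * g' (?c t)))"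
      by auto
    moreover have "Re (u * ((b - a) * g' (?c t))) \<le> m" using seg[of t] t by (intro m) auto
    ultimately show ?thesis by (simp add: algebra_simps)
  qed
  define t where "t = (\<lambda>n::nat. inverse (real (Suc n)))"
  have t0: "(\<lambda>n. complex_of_real (t n)) \<longlonglongrightarrow> 0"
    unfolding t_def using tendsto_of_real[OF LIMSEQ_inverse_real_of_nat, where 'a = complex] by simp
  have tpos: "t n > 0" for n by (simp add: t_def)
  have lim: "(\<lambda>n. w - of_real (t n)) \<longlonglongrightarrow> w" for w :: complex
    using tendsto_diff[OF tendsto_const[of w] t0] by simp
  have glim: "(\<lambda>n. g (w - of_real (t n))) \<longlonglongrightarrow> g w" if "Re w \<le> 0" for w
    by (rule continuous_on_tendsto_compose[OF cont lim]) (use that less_imp_le[OF tpos] in \<open>auto intro!: always_eventually intro: order_trans\<close>)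
  have ev: "\<forall>\<^sub>F n in sequentially. w - of_real (t n) \<in> ball p \<delta>" if "w \<in> ball p \<delta>" for w
    using topological_tendstoD[OF lim open_ball that] .
  have "(\<lambda>n. Re (u * (g (b - of_real (t n)) - g (a - of_real (t n))))) \<longlonglongrightarrow> Re (u * (g b - g a))"
    by (intro tendsto_intros glim ab)
  moreover have "\<forall>\<^sub>F n in sequentially. Re (u * (g (b - of_real (t n)) - g (a - of_real (t n)))) \<le> m"
    using ev[OF ab(1)] ev[OF ab(3)]
  proof eventually_elim
    case (elim n)
    show ?case by (rule inner) (use elim ab tpos[of n] in auto)
  qed
  ultimately show ?thesis by (rule tendsto_upperbound) simp
qed

lemma half_plane_lipschitz:
  assumes cont: "continuous_on {w. Re w \<le> 0} g"
    and deriv: "\<And>w. Re w < 0 \<Longrightarrow> (g has_field_derivative g' w) (at w)"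
    and ab: "a \<in> ball p \<delta>" "Re a \<le> 0" "b \<in> ball p \<delta>" "Re b \<le> 0"
    and e: "\<And>w. w \<in> ball p \<delta> \<Longrightarrow> Re w < 0 \<Longrightarrow> cmod (g' w) \<le> e"
  shows "cmod (g b - g a) \<le> e * cmod (b - a)"
proof (cases "g b = g a")
  case True
  \<comment> \<open>The bound \<open>e\<close> is only known to dominate a norm at points with negative real part, so such a
    point of the ball has to be produced.\<close>
  have "e \<ge> 0"
  proof -
    define r where "r = \<delta> - dist p a"
    have r: "r > 0" using ab(1) by (simp add: r_def)
    have "a - of_real (r / 2) \<in> ball p \<delta>"
    proof -
      have "dist p (a - of_real (r / 2)) \<le> dist p a + r / 2"
        using dist_triangle[of p "a - of_real (r/2)" a] r by (simp add: dist_norm)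
      moreover have "dist p a + r / 2 < \<delta>" using r by (simp add: r_def field_simps)
      ultimately show ?thesis unfolding mem_ball by linarith
    qed
    from e[OF this] show ?thesis using ab r by (smt (verit) norm_ge_zero Re_complex_of_real minus_complex.simps(1) half_gt_zero)
  qed
  with True show ?thesis by simp
next
  case False
  let ?X = "g b - g a"
  have "Re (cnj ?X * ?X) \<le> cmod ?X * (e * cmod (b - a))"
  proof (rule half_plane_mean_value[OF cont deriv ab])
    fix w assume w: "w \<in> ball p \<delta>" "Re w < 0"
    have "Re (cnj ?X * ((b - a) * g' w)) \<le> cmod (cnj ?X * ((b - a) * g' w))" by (rule complex_Re_le_cmod)
    also have "\<dots> = cmod ?X * (cmod (g' w) * cmod (b - a))" by (simp only: norm_mult complex_mod_cnj mult.commute)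
    also have "\<dots> \<le> cmod ?X * (e * cmod (b - a))"
      using e[OF w] by (intro mult_left_mono mult_right_mono) auto
    finally show "Re (cnj ?X * ((b - a) * g' w)) \<le> cmod ?X * (e * cmod (b - a))" .
  qed
  moreover have "Re (cnj ?X * ?X) = cmod ?X * cmod ?X"
    by (metis Re_complex_of_real complex_norm_square mult.commute power2_eq_square)
  ultimately show ?thesis using False by simp
qed

text \<open>
  The logarithmic counterpart of the projection of the plane onto the closed unit disc; with
  \<open>excess\<close> it splits \<open>Z = log z\<close> into the data \<open>\<zeta>\<close> and \<open>|z| - 1\<close>.
\<close>
definition left_half :: "complex \<Rightarrow> complex" where
  "left_half Z = Complex (min (Re Z) 0) (Im Z)"

definition excess :: "complex \<Rightarrow> real" where
  "excess Z = max (exp (Re Z)) 1 - 1"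

lemma Re_left_half: "Re (left_half Z) \<le> 0" by (simp add: left_half_def)

lemma dist_left_half: "dist (left_half Z) (left_half W) \<le> dist Z W"
proof -
  have "\<bar>min (Re Z) 0 - min (Re W) 0\<bar> \<le> \<bar>Re Z - Re W\<bar>" by linarith
  then have "(min (Re Z) 0 - min (Re W) 0)\<^sup>2 \<le> (Re Z - Re W)\<^sup>2" by (metis abs_le_square_iff)
  then show ?thesis by (simp add: dist_norm cmod_def left_half_def)
qed

text \<open>
  Divide by \<open>k = K (left_half Z0)\<close>. If two nearby points \<open>Z\<close>, \<open>W\<close> with \<open>Im Z \<le> Im W\<close> have the
  same image, then the vanishing difference of the images is, up to the factor \<open>k\<close>, the sum of three terms: \<open>T1\<close> comes from
  \<open>\<Psi>\<close> and is almost \<open>left_half W - left_half Z\<close>; \<open>T2\<close> comes from the change of the excess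
  and is almost that (real) change; \<open>T3\<close> comes from turning \<open>K\<close> at the common excess. The last one need
  not be small compared with the angle \<open>\<theta>\<close>, but \<open>K' = K q\<close> with \<open>Re q > 0\<close> makes its imaginary part nonnegative. The imaginary parts
  then bound \<open>\<theta>\<close> by a small multiple of the radial displacement \<open>x + \<sigma>\<close>, and the real parts force
  that displacement to vanish.
\<close>
lemma affine_continuation_locally_injective:
  fixes \<Psi> K q :: "complex \<Rightarrow> complex"
  assumes \<Psi>: "continuous_on {w. Re w \<le> 0} \<Psi>" "\<And>w. Re w < 0 \<Longrightarrow> (\<Psi> has_field_derivative K w) (at w)"
    and K: "continuous_on {w. Re w \<le> 0} K" "\<And>w. Re w < 0 \<Longrightarrow> (K has_field_derivative K w * q w) (at w)"
    and K0: "\<And>w. Re w \<le> 0 \<Longrightarrow> K w \<noteq> 0"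
    and c: "c > 0" "\<And>w. Re w < 0 \<Longrightarrow> Re (q w) \<ge> c" and C: "C > 0" "\<And>w. Re w < 0 \<Longrightarrow> cmod (q w) \<le> C"
  obtains \<delta> where "\<delta> > 0" "inj_on (\<lambda>Z. \<Psi> (left_half Z) + of_real (excess Z) * K (left_half Z)) (ball Z0 \<delta>)"
proof -
  define p where "p = left_half Z0"
  define k where "k = K p"
  have k: "k \<noteq> 0" by (simp add: k_def p_def K0 Re_left_half)
  define S where "S = exp (Re Z0 + 1)"
  have S: "S > 0" by (simp add: S_def)
  \<comment> \<open>On the ball chosen below \<open>K\<close> deviates from \<open>k\<close> by the relative error \<open>\<epsilon>\<close>. The bound by \<open>c / C\<close>
    keeps \<open>Re (q K / k)\<close> nonnegative; the other two make the estimates for \<open>\<theta>\<close> and \<open>x + \<sigma>\<close> at the end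
    contradict each other unless both vanish.\<close>
  define \<epsilon> where "\<epsilon> = min (1 / 4) (min (c / C) (1 / (16 * S * C)))"
  have \<epsilon>: "\<epsilon> > 0" "\<epsilon> \<le> 1 / 4" "\<epsilon> * C \<le> c" "4 * S * C * \<epsilon> \<le> 1 / 4"
  proof -
    show "\<epsilon> > 0" using c C S by (auto simp: \<epsilon>_def)
    show "\<epsilon> \<le> 1 / 4" unfolding \<epsilon>_def by (rule min.cobounded1)
    have "\<epsilon> \<le> c / C" "\<epsilon> \<le> 1 / (16 * S * C)" by (auto simp: \<epsilon>_def)
    then show "\<epsilon> * C \<le> c" "4 * S * C * \<epsilon> \<le> 1 / 4" using C S by (auto simp: field_simps)
  qed
  obtain \<delta>0 where \<delta>0: "\<delta>0 > 0" "\<And>w. Re w \<le> 0 \<Longrightarrow> dist w p < \<delta>0 \<Longrightarrow> dist (K w) k < \<epsilon> * cmod k"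
    using K(1)[unfolded continuous_on_iff, rule_format, of p "\<epsilon> * cmod k"] \<epsilon>(1) k Re_left_half[of Z0]
    by (auto simp: p_def k_def)
  define \<delta> where "\<delta> = min \<delta>0 1"
  have \<delta>: "\<delta> > 0" using \<delta>0 by (simp add: \<delta>_def)
  have near: "cmod (K w - k) \<le> \<epsilon> * cmod k" if "w \<in> ball p \<delta>" "Re w \<le> 0" for w
    using \<delta>0(2)[of w] that by (simp add: dist_norm norm_minus_commute \<delta>_def less_imp_le)
  define M where "M = (\<lambda>Z. \<Psi> (left_half Z) + of_real (excess Z) * K (left_half Z))"
  have excess_le: "0 \<le> excess Z \<and> excess Z \<le> S" if "Z \<in> ball Z0 \<delta>" for Z
  proof -
    have "\<bar>Re Z0 - Re Z\<bar> \<le> dist Z0 Z" using abs_Re_le_cmod[of "Z0 - Z"] by (simp add: dist_norm)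
    moreover have "dist Z0 Z < 1" using that by (simp add: \<delta>_def)
    ultimately have "Re Z \<le> Re Z0 + 1" by linarith
    then have "exp (Re Z) \<le> S" by (simp add: S_def)
    then show ?thesis using S by (simp add: excess_def)
  qed
  have key: "Z = W" if ZW: "Z \<in> ball Z0 \<delta>" "W \<in> ball Z0 \<delta>" "Im Z \<le> Im W" and MM: "M Z = M W" for Z W
  proof -
    define a b where "a = left_half Z" and "b = left_half W"
    have ab: "a \<in> ball p \<delta>" "Re a \<le> 0" "b \<in> ball p \<delta>" "Re b \<le> 0"
      using ZW(1,2) order_le_less_trans[OF dist_left_half] by (auto simp: a_def b_def p_def Re_left_half)
    define x \<theta> \<sigma> where "x = Re (b - a)" and "\<theta> = Im (b - a)" and "\<sigma> = excess W - excess Z"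
    have \<theta>: "\<theta> \<ge> 0" using ZW(3) by (simp add: \<theta>_def a_def b_def left_half_def)
    have same_sign: "\<bar>x\<bar> + \<bar>\<sigma>\<bar> = \<bar>x + \<sigma>\<bar>"
    proof (cases "Re Z \<le> Re W")
      case True
      then have "x \<ge> 0" "\<sigma> \<ge> 0" by (auto simp: x_def \<sigma>_def a_def b_def left_half_def excess_def max_def)
      then show ?thesis by simp
    next
      case False
      then have "x \<le> 0" "\<sigma> \<le> 0" by (auto simp: x_def \<sigma>_def a_def b_def left_half_def excess_def max_def)
      then show ?thesis by simp
    qed
    \<comment> \<open>If the common excess \<open>m\<close> is positive then both points lie to the right of the imaginary axis, so
      \<open>b - a\<close> is imaginary and \<open>K b - K a\<close> is a turn along that axis.\<close>
    define m where "m = min (excess Z) (excess W)"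
    have m: "0 \<le> m" "m \<le> S" using excess_le[OF ZW(1)] excess_le[OF ZW(2)] by (auto simp: m_def)
    define w where "w = (if \<sigma> \<ge> 0 then b else a)"
    have w: "w \<in> ball p \<delta>" "Re w \<le> 0" using ab by (auto simp: w_def)
    define T1 T2 T3 where "T1 = (\<Psi> b - \<Psi> a) / k" and "T2 = of_real \<sigma> * K w / k" and "T3 = of_real m * (K b - K a) / k"
    have split: "T1 + T2 + T3 = 0"
    proof -
      have "(T1 + T2 + T3) * k = (\<Psi> b - \<Psi> a) + (of_real \<sigma> * K w + of_real m * (K b - K a))"
        using k by (simp add: T1_def T2_def T3_def field_simps)
      also have "of_real \<sigma> * K w + of_real m * (K b - K a) = of_real (excess W) * K b - of_real (excess Z) * K a"
        by (auto simp: w_def m_def \<sigma>_def algebra_simps min_def)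
      also have "(\<Psi> b - \<Psi> a) + (of_real (excess W) * K b - of_real (excess Z) * K a) = M W - M Z"
        by (simp add: M_def a_def b_def)
      finally show ?thesis using MM k by simp
    qed
    have T1: "cmod (T1 - (b - a)) \<le> \<epsilon> * (\<bar>x\<bar> + \<theta>)"
    proof -
      have "cmod ((\<Psi> b - k * b) - (\<Psi> a - k * a)) \<le> (\<epsilon> * cmod k) * cmod (b - a)"
      proof (rule half_plane_lipschitz[OF _ _ ab])
        show "continuous_on {w. Re w \<le> 0} (\<lambda>w. \<Psi> w - k * w)" by (intro continuous_intros \<Psi>)
        show "((\<lambda>w. \<Psi> w - k * w) has_field_derivative K w - k) (at w)" if "Re w < 0" for w
          using \<Psi>(2)[OF that] by (auto intro!: derivative_eq_intros)
        show "cmod (K w - k) \<le> \<epsilon> * cmod k" if "w \<in> ball p \<delta>" "Re w < 0" for w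
          using near that by simp
      qed
      also have "(\<Psi> b - k * b) - (\<Psi> a - k * a) = k * (T1 - (b - a))"
        using k by (simp add: T1_def field_simps)
      finally have "cmod (T1 - (b - a)) \<le> \<epsilon> * cmod (b - a)" using k by (simp add: norm_mult)
      also have "\<dots> \<le> \<epsilon> * (\<bar>x\<bar> + \<theta>)"
        using cmod_le[of "b - a"] \<theta> \<epsilon>(1) by (intro mult_left_mono) (auto simp: x_def \<theta>_def)
      finally show ?thesis .
    qed
    have T2: "cmod (T2 - of_real \<sigma>) \<le> \<epsilon> * \<bar>\<sigma>\<bar>"
    proof -
      have "T2 - of_real \<sigma> = of_real \<sigma> * (K w - k) / k" using k by (simp add: T2_def field_simps)
      then have "cmod (T2 - of_real \<sigma>) = \<bar>\<sigma>\<bar> * cmod (K w - k) / cmod k" by (simp add: norm_mult norm_divide)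
      also have "\<dots> \<le> \<bar>\<sigma>\<bar> * (\<epsilon> * cmod k) / cmod k"
        by (intro divide_right_mono mult_left_mono near w) auto
      finally show ?thesis using k by (simp add: mult.commute)
    qed
    have T3: "Im T3 \<ge> 0 \<and> cmod T3 \<le> 2 * S * C * \<theta>"
    proof (cases "m = 0")
      case True
      then show ?thesis using \<theta> S C by (simp add: T3_def)
    next
      case False
      then have "excess Z > 0" "excess W > 0" using m by (auto simp: m_def min_def split: if_splits)
      then have "Re Z > 0" "Re W > 0" by (auto simp: excess_def max_def split: if_splits)
      then have ba: "b - a = \<i> * of_real \<theta>"
        by (simp add: complex_eq_iff \<theta>_def a_def b_def left_half_def)
      have Kw: "cmod (K w / k - 1) \<le> \<epsilon>" if "w \<in> ball p \<delta>" "Re w < 0" for w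
      proof -
        have "K w / k - 1 = (K w - k) / k" using k by (simp add: field_simps)
        then show ?thesis using near[of w] that k by (simp add: norm_divide pos_divide_le_eq)
      qed
      have "Re ((\<i> / k) * (K b - K a)) \<le> 0"
      proof (rule half_plane_mean_value[OF K ab])
        fix w assume w: "w \<in> ball p \<delta>" "Re w < 0"
        have "(\<i> / k) * ((b - a) * (K w * q w)) = - of_real \<theta> * (q w + (K w / k - 1) * q w)"
          using k by (simp add: ba field_simps)
        then have "Re ((\<i> / k) * ((b - a) * (K w * q w))) = Re (of_real (- \<theta>) * (q w + (K w / k - 1) * q w))"
          by simp
        also have "\<dots> = - \<theta> * (Re (q w) + Re ((K w / k - 1) * q w))"
          by (simp only: Re_complex_of_real Im_complex_of_real times_complex.simps(1) plus_complex.simps(1))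
        finally have "Re ((\<i> / k) * ((b - a) * (K w * q w))) = - \<theta> * (Re (q w) + Re ((K w / k - 1) * q w))" .
        moreover have "Re ((K w / k - 1) * q w) \<ge> - c"
        proof -
          have "cmod ((K w / k - 1) * q w) \<le> \<epsilon> * C"
            unfolding norm_mult using Kw[OF w] C(2)[OF w(2)] \<epsilon> by (intro mult_mono) auto
          then show ?thesis using \<epsilon>(3) abs_Re_le_cmod[of "(K w / k - 1) * q w"] by linarith
        qed
        ultimately show "Re ((\<i> / k) * ((b - a) * (K w * q w))) \<le> 0"
          using c(2)[OF w(2)] \<theta> by (simp add: mult_nonneg_nonneg)
      qed
      then have "Re (\<i> * (K b - K a) / k) \<le> 0" by (simp only: times_divide_eq_left)
      then have "Im ((K b - K a) / k) \<ge> 0" by (simp add: times_divide_eq_right[symmetric] del: times_divide_eq_right)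
      moreover have "T3 = of_real m * ((K b - K a) / k)" by (simp only: T3_def times_divide_eq_right)
      then have "Im T3 = m * Im ((K b - K a) / k)" by (metis Im_complex_of_real Re_complex_of_real add_0_right mult_zero_left times_complex.simps(2))
      ultimately have "Im T3 \<ge> 0" using m by simp
      moreover have "cmod T3 \<le> 2 * S * C * \<theta>"
      proof -
        have "cmod (K b - K a) \<le> (2 * cmod k * C) * cmod (b - a)"
        proof (rule half_plane_lipschitz[OF K ab])
          fix w assume w: "w \<in> ball p \<delta>" "Re w < 0"
          have "cmod (K w) \<le> cmod k + cmod (K w - k)" using norm_triangle_ineq[of k "K w - k"] by simp
          also have "\<dots> \<le> cmod k + \<epsilon> * cmod k" using near w by simp
          also have "\<dots> \<le> 2 * cmod k" using mult_right_mono[OF \<epsilon>(2), of "cmod k"] norm_ge_zero[of k] by linarith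
          finally show "cmod (K w * q w) \<le> 2 * cmod k * C"
            unfolding norm_mult using C(2)[OF w(2)] by (intro mult_mono) auto
        qed
        then have "m * cmod (K b - K a) / cmod k \<le> S * (2 * cmod k * C * \<theta>) / cmod k"
          using m S \<theta> by (intro divide_right_mono mult_mono) (auto simp: ba norm_mult)
        then show ?thesis using k m by (simp add: T3_def norm_mult norm_divide)
      qed
      ultimately show ?thesis ..
    qed
    define E where "E = (T1 - (b - a)) + (T2 - of_real \<sigma>)"
    have "cmod E \<le> \<epsilon> * (\<bar>x\<bar> + \<theta>) + \<epsilon> * \<bar>\<sigma>\<bar>" unfolding E_def by (rule norm_triangle_mono[OF T1 T2])
    also have "\<dots> = \<epsilon> * (\<bar>x + \<sigma>\<bar> + \<theta>)" unfolding same_sign[symmetric] by (simp add: algebra_simps)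
    finally have E: "\<bar>Re E\<bar> \<le> \<epsilon> * (\<bar>x + \<sigma>\<bar> + \<theta>)" "\<bar>Im E\<bar> \<le> \<epsilon> * (\<bar>x + \<sigma>\<bar> + \<theta>)"
      using abs_Re_le_cmod[of E] abs_Im_le_cmod[of E] by linarith+
    have "T1 + T2 + T3 = E + (b - a) + of_real \<sigma> + T3" by (simp add: E_def)
    then have eqs: "Re E + x + \<sigma> + Re T3 = 0" "Im E + \<theta> + Im T3 = 0"
      unfolding split by (auto simp: complex_eq_iff x_def \<theta>_def)
    define y where "y = \<bar>x + \<sigma>\<bar>"
    have "\<theta> \<le> \<epsilon> * (y + \<theta>)" using eqs(2) E(2) T3 unfolding y_def by linarith
    moreover have "\<epsilon> * \<theta> \<le> 1 / 4 * \<theta>" using \<epsilon>(2) \<theta> by (rule mult_right_mono)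
    ultimately have th: "\<theta> \<le> 2 * \<epsilon> * y" using \<theta> \<epsilon>(1) by (simp add: algebra_simps y_def)
    have "\<bar>Re T3\<bar> \<le> 2 * S * C * \<theta>" using T3 abs_Re_le_cmod[of T3] by linarith
    also have "\<dots> \<le> 2 * S * C * (2 * \<epsilon> * y)" using th S C by (intro mult_left_mono) auto
    also have "\<dots> = (4 * S * C * \<epsilon>) * y" by simp
    also have "\<dots> \<le> 1 / 4 * y" using \<epsilon>(4) by (intro mult_right_mono) (auto simp: y_def)
    finally have "y \<le> \<epsilon> * (y + \<theta>) + 1 / 4 * y" using eqs(1) E(1) unfolding y_def by linarith
    moreover have "\<epsilon> * y \<le> 1 / 4 * y" using \<epsilon>(2) by (intro mult_right_mono) (auto simp: y_def)
    ultimately have "y \<le> 0" using th \<open>\<epsilon> * \<theta> \<le> 1 / 4 * \<theta>\<close> by (simp add: algebra_simps)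
    then have y0: "x + \<sigma> = 0" "y = 0" by (auto simp: y_def)
    then have "\<theta> = 0" "x = 0" "\<sigma> = 0" using th \<theta> same_sign by auto
    then show "Z = W"
      unfolding x_def \<theta>_def \<sigma>_def a_def b_def left_half_def excess_def
      by (auto simp: complex_eq_iff min_def max_def split: if_splits)
  qed
  have "inj_on M (ball Z0 \<delta>)"
    by (rule inj_onI) (metis key linear)
  with \<delta> show thesis using that unfolding M_def by blast
qed

section \<open>Global injectivity and orientation\<close>

text \<open>
  By invariance of domain \<open>F\<close> is open, and its range is closed as \<open>F\<close> is proper. The values taken at
  least twice form an open set. A value taken exactly once has a neighbourhood of such values,
  because the preimages of nearby values lie in a compact set and cannot avoid the neighbourhood of
  the single preimage on which \<open>F\<close> is injective. So the values taken exactly once form an open and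
  closed set, which contains \<open>F 0\<close>.
\<close>
lemma proper_locally_injective_bij:
  fixes F :: "complex \<Rightarrow> complex"
  assumes cont: "continuous_on UNIV F"
    and inj: "\<And>z. \<exists>\<delta>>0. inj_on F (ball z \<delta>)"
    and proper: "\<And>B. \<exists>R. \<forall>z. cmod (F z) \<le> B \<longrightarrow> cmod z \<le> R"
    and zero: "\<And>z. F z = F 0 \<Longrightarrow> z = 0"
  shows "bij F" "\<And>U. open U \<Longrightarrow> open (F ` U)"
proof -
  have contS: "continuous_on A F" for A by (rule continuous_on_subset[OF cont subset_UNIV])
  have loc: "\<exists>\<delta>>0. inj_on F (ball z \<delta>) \<and> (\<forall>\<epsilon>>0. \<epsilon> \<le> \<delta> \<longrightarrow> open (F ` ball z \<epsilon>))" for z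
  proof -
    obtain \<delta> where \<delta>: "\<delta> > 0" "inj_on F (ball z \<delta>)" using inj[of z] by blast
    have "open (F ` ball z \<epsilon>)" if "\<epsilon> \<le> \<delta>" for \<epsilon>
      by (rule invariance_of_domain[OF contS open_ball inj_on_subset[OF \<delta>(2) subset_ball[OF that]]])
    with \<delta> show ?thesis by blast
  qed
  show op: "open (F ` U)" if U: "open U" for U
  proof (subst open_subopen, clarify)
    fix z assume z: "z \<in> U"
    obtain \<delta> where \<delta>: "\<delta> > 0" "\<And>\<epsilon>. \<epsilon> > 0 \<Longrightarrow> \<epsilon> \<le> \<delta> \<Longrightarrow> open (F ` ball z \<epsilon>)" using loc[of z] by blast
    obtain e where e: "e > 0" "ball z e \<subseteq> U" using U z open_contains_ball[of U] by blast
    show "\<exists>T. open T \<and> F z \<in> T \<and> T \<subseteq> F ` U"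
    proof (intro exI conjI)
      show "open (F ` ball z (min \<delta> e))" using \<delta> e by auto
      show "F z \<in> F ` ball z (min \<delta> e)" using \<delta> e by auto
      show "F ` ball z (min \<delta> e) \<subseteq> F ` U" using e by auto
    qed
  qed
  have preimages: "\<exists>R. \<forall>z. F z \<in> ball w 1 \<longrightarrow> z \<in> cball 0 R" for w
  proof -
    obtain R where "\<And>z. cmod (F z) \<le> cmod w + 1 \<Longrightarrow> cmod z \<le> R" using proper[of "cmod w + 1"] by blast
    moreover have "cmod (F z) \<le> cmod w + 1" if "F z \<in> ball w 1" for z
      using that norm_triangle_ineq2[of "F z" w] by (simp add: dist_norm norm_minus_commute)
    ultimately show ?thesis by auto
  qed
  have closed_range: "closed (range F)"
    unfolding closed_def
  proof (subst open_subopen, clarify)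
    fix w assume w: "w \<notin> range F"
    obtain R where R: "\<And>z. F z \<in> ball w 1 \<Longrightarrow> z \<in> cball 0 R" using preimages[of w] by blast
    have "compact (F ` cball 0 R)" by (intro compact_continuous_image contS compact_cball)
    then have "open (ball w 1 - F ` cball 0 R)" by (intro open_Diff open_ball compact_imp_closed)
    moreover have "w \<in> ball w 1 - F ` cball 0 R" using w by auto
    moreover have "ball w 1 - F ` cball 0 R \<subseteq> - range F" using R by blast
    ultimately show "\<exists>T. open T \<and> w \<in> T \<and> T \<subseteq> - range F" by blast
  qed
  define D where "D = {w. \<exists>a b. a \<noteq> b \<and> F a = w \<and> F b = w}"
  have "open D"
  proof (subst open_subopen, clarify)
    fix w assume "w \<in> D"
    then obtain a b where ab: "a \<noteq> b" "F a = w" "F b = w" by (auto simp: D_def)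
    obtain U V where UV: "open U" "open V" "a \<in> U" "b \<in> V" "U \<inter> V = {}" using hausdorff[OF ab(1)] by blast
    show "\<exists>T. open T \<and> w \<in> T \<and> T \<subseteq> D"
    proof (intro exI conjI)
      show "open (F ` U \<inter> F ` V)" by (rule open_Int[OF op[OF UV(1)] op[OF UV(2)]])
      show "w \<in> F ` U \<inter> F ` V" using imageI[OF UV(3), of F] imageI[OF UV(4), of F] unfolding ab(2,3) by (rule IntI)
      show "F ` U \<inter> F ` V \<subseteq> D"
      proof
        fix v assume "v \<in> F ` U \<inter> F ` V"
        then obtain a' b' where v: "a' \<in> U" "v = F a'" "b' \<in> V" "v = F b'" by (elim IntE imageE)
        then have "a' \<noteq> b'" using UV(5) by auto
        with v(2,4) show "v \<in> D" unfolding D_def by auto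
      qed
    qed
  qed
  define S where "S = range F - D"
  have "closed S" unfolding S_def by (rule closed_Diff[OF closed_range \<open>open D\<close>])
  moreover have "open S"
  proof (subst open_subopen, clarify)
    fix w assume "w \<in> S"
    then obtain z where z1: "F z = w" and "w \<notin> D" unfolding S_def by blast
    then have z: "F z = w" "\<And>z'. F z' = w \<Longrightarrow> z' = z" unfolding D_def by auto
    obtain \<delta> where \<delta>: "\<delta> > 0" "inj_on F (ball z \<delta>)" using inj[of z] by blast
    obtain R where R: "\<And>z. F z \<in> ball w 1 \<Longrightarrow> z \<in> cball 0 R" using preimages[of w] by blast
    \<comment> \<open>\<open>C\<close> catches the preimages of values near \<open>w\<close> that are not close to \<open>z\<close>; its compact image misses \<open>w\<close>.\<close>
    define C where "C = cball 0 R - ball z \<delta>"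
    have "compact C" unfolding C_def by (intro compact_diff compact_cball open_ball)
    then have cl: "closed (F ` C)" by (intro compact_imp_closed compact_continuous_image contS)
    let ?T = "(ball w 1 \<inter> F ` ball z \<delta>) - F ` C"
    show "\<exists>T. open T \<and> w \<in> T \<and> T \<subseteq> S"
    proof (intro exI conjI)
      show "open ?T" by (intro open_Diff open_Int open_ball op cl)
      have "y \<notin> C" if "w = F y" for y
        using z(2)[OF that[symmetric]] \<delta>(1) by (simp add: C_def)
      then have "w \<notin> F ` C" by (auto elim!: imageE)
      moreover have "F z \<in> F ` ball z \<delta>" using \<delta>(1) by (intro imageI) simp
      ultimately show "w \<in> ?T" unfolding z(1) by simp
      show "?T \<subseteq> S"
      proof
        fix v assume v: "v \<in> ?T"
        have only: "y \<in> ball z \<delta>" if "F y = v" for y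
        proof -
          have "y \<in> cball 0 R" using v that by (intro R) simp
          moreover have "y \<notin> C" using v that[symmetric] imageI[of y C F] by auto
          ultimately show ?thesis by (simp add: C_def)
        qed
        have "v \<notin> D"
        proof
          assume "v \<in> D"
          then obtain a b where ab: "a \<noteq> b" "F a = v" "F b = v" unfolding D_def by auto
          then show False using inj_onD[OF \<delta>(2), of a b] only by simp
        qed
        moreover have "v \<in> range F" using v by (elim DiffE IntE imageE) simp
        ultimately show "v \<in> S" by (simp add: S_def)
      qed
    qed
  qed
  moreover have "F 0 \<in> S"
  proof -
    have "F 0 \<notin> D"
    proof
      assume "F 0 \<in> D"
      then obtain a b where "a \<noteq> b" "F a = F 0" "F b = F 0" unfolding D_def by auto
      then show False using zero[of a] zero[of b] by simp
    qed
    then show ?thesis by (simp add: S_def)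
  qed
  ultimately have "S = UNIV" using clopen[of S] by auto
  then have "D = {}" "range F = UNIV" by (auto simp: S_def)
  have "inj F"
  proof (rule injI, rule ccontr)
    fix x y assume "F x = F y" "x \<noteq> y"
    then have "F y \<in> D" unfolding D_def by auto
    with \<open>D = {}\<close> show False by simp
  qed
  with \<open>range F = UNIV\<close> show "bij F" by (simp add: bij_def)
qed

text \<open>
  By injectivity the circle can be moved and rescaled together with its centre without its image ever meeting
  the image of the centre; once the circle has radius \<open>1/2\<close> and centre \<open>0\<close>, the factor \<open>exp l\<close> is
  contracted to \<open>1\<close>.
\<close>
lemma injective_sense_preserving:
  fixes F l :: "complex \<Rightarrow> complex"
  assumes cont: "continuous_on UNIV F" and inj: "inj F" and F0: "F 0 = 0"
    and l: "continuous_on (cball 0 (1/2)) l" "\<And>z. z \<in> cball 0 (1/2) \<Longrightarrow> F z = z * exp (l z)"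
  shows "sense_preserving_on UNIV F"
  unfolding sense_preserving_on_def
proof (intro allI impI)
  fix z :: complex and r :: real
  assume "r > 0 \<and> cball z r \<subseteq> UNIV"
  then have r: "r > 0" by simp
  let ?e = "\<lambda>x::real. exp (2 * of_real pi * \<i> * of_real x)"
  \<comment> \<open>The circle of radius \<open>1/2\<close> around \<open>0\<close> is moved linearly to the circle of radius \<open>r\<close> around \<open>z\<close>.\<close>
  define rad where "rad = (\<lambda>t. (1 - t) / 2 + t * r)"
  have rad: "rad t > 0" if "t \<in> {0..1}" for t
  proof (cases "t = 0")
    case False
    then have "t * r > 0" "(1 - t) / 2 \<ge> 0" using that r by auto
    then show ?thesis unfolding rad_def by linarith
  qed (simp add: rad_def)
  have period: "?e 1 = ?e 0" by simp
  have "homotopic_loops (-{0}) (\<lambda>x. F (of_real (1/2) * ?e x)) (\<lambda>x. F (z + of_real r * ?e x) - F z)"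
    unfolding homotopic_loops
  proof (intro exI conjI ballI)
    let ?h = "\<lambda>y::real \<times> real. F (of_real (fst y) * z + of_real (rad (fst y)) * ?e (snd y)) - F (of_real (fst y) * z)"
    show "continuous_on ({0..1} \<times> {0..1}) ?h"
      unfolding rad_def by (intro continuous_intros continuous_on_compose2[OF cont]) auto
    show "?h \<in> {0..1} \<times> {0..1} \<rightarrow> - {0}"
    proof
      fix y :: "real \<times> real" assume "y \<in> {0..1} \<times> {0..1}"
      then have "rad (fst y) > 0" using rad by auto
      then have "of_real (fst y) * z + of_real (rad (fst y)) * ?e (snd y) \<noteq> of_real (fst y) * z" by simp
      then show "?h y \<in> - {0}" by (simp only: Compl_iff singleton_iff right_minus_eq inj_eq[OF inj] not_False_eq_True)
    qed
    show "?h (0, x) = F (of_real (1/2) * ?e x)" for x by (simp add: rad_def F0)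
    show "?h (1, x) = F (z + of_real r * ?e x) - F z" for x by (simp add: rad_def)
    show "pathfinish (?h \<circ> Pair t) = pathstart (?h \<circ> Pair t)" for t
      using period by (simp add: pathfinish_def pathstart_def)
  qed
  then have "winding_number (\<lambda>x. F (of_real (1/2) * ?e x)) 0 = winding_number (\<lambda>x. F (z + of_real r * ?e x) - F z) 0"
    by (rule winding_number_homotopic_loops)
  also have "\<dots> = winding_number (F \<circ> circlepath z r) (F z)"
    unfolding winding_number_offset[of "F \<circ> circlepath z r"] by (simp add: circlepath o_def)
  finally have 1: "winding_number (F \<circ> circlepath z r) (F z) = winding_number (\<lambda>x. F (of_real (1/2) * ?e x)) 0" ..
  have "homotopic_loops (-{0}) (\<lambda>x. of_real (1/2) * ?e x) (\<lambda>x. F (of_real (1/2) * ?e x))"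
    unfolding homotopic_loops
  proof (intro exI conjI ballI)
    let ?h = "\<lambda>y::real \<times> real. (of_real (1/2) * ?e (snd y)) * exp (of_real (fst y) * l (of_real (1/2) * ?e (snd y)))"
    show "continuous_on ({0..1} \<times> {0..1}) ?h"
      by (intro continuous_intros continuous_on_compose2[OF l(1)]) (auto simp: norm_mult)
    show "?h \<in> {0..1} \<times> {0..1} \<rightarrow> - {0}" by auto
    show "?h (0, x) = of_real (1/2) * ?e x" for x by simp
    show "?h (1, x) = F (of_real (1/2) * ?e x)" for x
      by (subst l(2)) (auto simp: norm_mult)
    show "pathfinish (?h \<circ> Pair t) = pathstart (?h \<circ> Pair t)" for t
      using period by (simp add: pathfinish_def pathstart_def)
  qed
  then have "winding_number (\<lambda>x. of_real (1/2) * ?e x) 0 = winding_number (\<lambda>x. F (of_real (1/2) * ?e x)) 0"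
    by (rule winding_number_homotopic_loops)
  moreover have "winding_number (\<lambda>x. of_real (1/2) * ?e x) 0 = 1"
    using winding_number_circlepath_centre[of "1/2" 0] by (simp add: circlepath)
  ultimately show "winding_number (F \<circ> circlepath z r) (F z) = 1" using 1 by simp
qed

section \<open>The explicit extension and its derivative\<close>

text \<open>
  The data left of \<open>f(z) = z exp(l(z))\<close> once boundary regularity is known. The functions \<open>l\<close> and \<open>P\<close>
  have values on the closed disc, while \<open>q\<close> lives on the open disc only.
\<close>
locale bazilevic_data =
  fixes \<gamma> :: complex and k :: real and l P q :: "complex \<Rightarrow> complex"
  assumes \<gamma>: "Re \<gamma> > 0" and k: "0 \<le> k" "k < 1"
    and l_cont: "continuous_on (cball 0 1) l" and P_cont: "continuous_on (cball 0 1) P"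
    and l_hol: "l holomorphic_on ball 0 1" and P_hol: "P holomorphic_on ball 0 1" and q_hol: "q holomorphic_on ball 0 1"
    and P_eq: "\<And>z. z \<in> ball 0 1 \<Longrightarrow> P z = \<gamma> * (1 + z * deriv l z)"
    and P_ode: "\<And>z. z \<in> ball 0 1 \<Longrightarrow> z * deriv P z = P z * (q z - P z)"
    and P_U: "\<And>z. z \<in> cball 0 1 \<Longrightarrow> P z \<in> U_disk k" and q_U: "\<And>z. z \<in> ball 0 1 \<Longrightarrow> q z \<in> U_disk k"
begin

text \<open>
  The least real part of a point of \<open>U(k)\<close>.
\<close>
definition c0 :: real where "c0 = (1 - k) / (1 + k)"

text \<open>
  The pair \<open>(retract z, height z)\<close> gives one formula for the extension that covers the disc and its exterior.
\<close>
definition retract :: "complex \<Rightarrow> complex" where "retract z = z / of_real (max 1 (cmod z))"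

definition height :: "complex \<Rightarrow> real" where "height z = max 1 (cmod z) - 1"

text \<open>
  The map \<open>\<Phi> 1\<close> is the extension \<open>F\<close>. For \<open>\<rho> < 1\<close> the boundary data are taken from the circle of
  radius \<open>\<rho>\<close>, where everything is smooth; up to the factor \<open>\<rho>\<close> this is the extension of \<open>f(\<rho>z)\<close>.
\<close>
definition \<Phi> :: "real \<Rightarrow> complex \<Rightarrow> complex" where
  "\<Phi> \<rho> z = retract z * exp (l (of_real \<rho> * retract z) + Ln (1 + of_real (height z) * P (of_real \<rho> * retract z)) / \<gamma>)"

lemma c0_pos: "c0 > 0" using k by (simp add: c0_def)

lemma \<gamma>_nz: "\<gamma> \<noteq> 0" using \<gamma> by auto

lemma P_Re: "z \<in> cball 0 1 \<Longrightarrow> Re (P z) \<ge> c0"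
  unfolding c0_def by (rule U_disk_Re_pos[OF k P_U])

lemma U_bound: obtains C where "C > 0" "\<And>w. w \<in> U_disk k \<Longrightarrow> cmod w \<le> C"
  using U_disk_bounded[OF k] unfolding bounded_pos by blast

lemma height_nonneg: "height z \<ge> 0" by (simp add: height_def)

lemma norm_retract_le: "cmod (retract z) \<le> 1"
  by (simp add: retract_def norm_divide divide_le_eq)

lemma scaled_retract_cball: "0 \<le> \<rho> \<Longrightarrow> \<rho> \<le> 1 \<Longrightarrow> of_real \<rho> * retract z \<in> cball 0 1"
  using mult_mono[of \<rho> 1 "cmod (retract z)" 1] norm_retract_le[of z] by (simp add: norm_mult)

lemma scaled_retract_ball: "0 \<le> \<rho> \<Longrightarrow> \<rho> < 1 \<Longrightarrow> of_real \<rho> * retract z \<in> ball 0 1"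
  using mult_left_mono[OF norm_retract_le[of z], of \<rho>] by (simp add: norm_mult)

lemma retract_cball: "retract z \<in> cball 0 1" using norm_retract_le by simp

lemma retract_inside: "cmod z \<le> 1 \<Longrightarrow> retract z = z" and height_inside: "cmod z \<le> 1 \<Longrightarrow> height z = 0"
  by (simp_all add: retract_def height_def max_def)

lemma retract_outside: "cmod z \<ge> 1 \<Longrightarrow> retract z = sgn z" and height_outside: "cmod z \<ge> 1 \<Longrightarrow> height z = cmod z - 1"
  by (simp_all add: retract_def height_def max_def sgn_eq)

lemma retract_cont: "continuous_on S retract"
  unfolding retract_def by (intro continuous_intros) auto

lemma height_cont: "continuous_on S height"
  unfolding height_def by (intro continuous_intros)

lemma stretch_Re:
  assumes "w \<in> cball 0 1" "s \<ge> 0"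
  shows "Re (1 + of_real s * P w) \<ge> 1 + s * c0"
  using mult_left_mono[OF P_Re[OF assms(1)] assms(2)] by simp

lemma stretch_Re_ge_1:
  assumes "w \<in> cball 0 1" "s \<ge> 0"
  shows "Re (1 + of_real s * P w) \<ge> 1"
  using stretch_Re[OF assms] mult_nonneg_nonneg[OF assms(2) less_imp_le[OF c0_pos]] by linarith

lemma stretch_slit:
  assumes "w \<in> cball 0 1" "s \<ge> 0"
  shows "1 + of_real s * P w \<notin> \<real>\<^sub>\<le>\<^sub>0"
  using stretch_Re_ge_1[OF assms] by (auto simp: complex_nonpos_Reals_iff)

lemma stretch_nz:
  assumes "w \<in> cball 0 1" "s \<ge> 0"
  shows "1 + of_real s * P w \<noteq> 0" "cmod (1 + of_real s * P w) \<ge> 1"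
proof -
  show "cmod (1 + of_real s * P w) \<ge> 1"
    using order_trans[OF stretch_Re_ge_1[OF assms] complex_Re_le_cmod] .
  then show "1 + of_real s * P w \<noteq> 0" by auto
qed

lemma \<Phi>_jointly_continuous: "continuous_on ({0..1} \<times> UNIV) (\<lambda>y. \<Phi> (fst y) (snd y))"
proof -
  let ?w = "\<lambda>y. of_real (fst y) * retract (snd y)"
  have w: "continuous_on ({0..1} \<times> UNIV) ?w"
    by (intro continuous_intros continuous_on_compose2[OF retract_cont[of UNIV]]) auto
  have h: "continuous_on ({0..1} \<times> UNIV) (\<lambda>y::real \<times> complex. height (snd y))"
    by (rule continuous_on_compose2[OF height_cont[of UNIV]]) (auto intro!: continuous_intros)
  have r: "continuous_on ({0..1} \<times> UNIV) (\<lambda>y::real \<times> complex. retract (snd y))"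
    by (rule continuous_on_compose2[OF retract_cont[of UNIV]]) (auto intro!: continuous_intros)
  have im: "?w ` ({0..1} \<times> UNIV) \<subseteq> cball 0 1"
    using scaled_retract_cball by auto
  have lw: "continuous_on ({0..1} \<times> UNIV) (\<lambda>y. l (?w y))" by (rule continuous_on_compose2[OF l_cont w im])
  have Pw: "continuous_on ({0..1} \<times> UNIV) (\<lambda>y. P (?w y))" by (rule continuous_on_compose2[OF P_cont w im])
  have "1 + of_real (height (snd y)) * P (?w y) \<notin> \<real>\<^sub>\<le>\<^sub>0" if "y \<in> {0..1} \<times> UNIV" for y
    by (intro stretch_slit scaled_retract_cball height_nonneg) (use that in auto)
  then have "continuous_on ({0..1} \<times> UNIV) (\<lambda>y. Ln (1 + of_real (height (snd y)) * P (?w y)))"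
    by (intro continuous_on_Ln' continuous_on_mult continuous_on_add continuous_on_const continuous_on_of_real h Pw)
  then show ?thesis unfolding \<Phi>_def
    by (intro continuous_on_mult r continuous_on_exp continuous_on_add lw continuous_on_divide continuous_on_const) (use \<gamma>_nz in auto)
qed

lemma \<Phi>_continuous:
  assumes "0 \<le> \<rho>" "\<rho> \<le> 1"
  shows "continuous_on S (\<Phi> \<rho>)"
proof -
  have "continuous_on S (\<lambda>z. (\<lambda>y. \<Phi> (fst y) (snd y)) (\<rho>, z))"
    by (rule continuous_on_compose2[OF \<Phi>_jointly_continuous]) (use assms in \<open>auto intro!: continuous_intros\<close>)
  then show ?thesis by simp
qed

lemma \<Phi>_bounded:
  obtains B where "\<And>\<rho> z. 0 \<le> \<rho> \<Longrightarrow> \<rho> \<le> 1 \<Longrightarrow> cmod z \<le> R \<Longrightarrow> cmod (\<Phi> \<rho> z) \<le> B"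
proof -
  have "bounded ((\<lambda>y. \<Phi> (fst y) (snd y)) ` ({0..1} \<times> cball 0 R))"
    by (intro compact_imp_bounded compact_continuous_image continuous_on_subset[OF \<Phi>_jointly_continuous] compact_Times) auto
  then obtain B where "\<forall>x \<in> (\<lambda>y. \<Phi> (fst y) (snd y)) ` ({0..1} \<times> cball 0 R). cmod x \<le> B"
    unfolding bounded_iff by blast
  then have "cmod (\<Phi> \<rho> z) \<le> B" if "0 \<le> \<rho>" "\<rho> \<le> 1" "cmod z \<le> R" for \<rho> z
    using that by force
  then show thesis by (rule that)
qed

lemma \<Phi>_tendsto:
  assumes "\<And>n. 0 \<le> \<rho> n" "\<And>n. \<rho> n \<le> 1" "\<rho> \<longlonglongrightarrow> 1"
  shows "(\<lambda>n. \<Phi> (\<rho> n) z) \<longlonglongrightarrow> \<Phi> 1 z"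
proof -
  have "(\<lambda>n. (\<lambda>y. \<Phi> (fst y) (snd y)) (\<rho> n, z)) \<longlonglongrightarrow> (\<lambda>y. \<Phi> (fst y) (snd y)) (1, z)"
    by (rule continuous_on_tendsto_compose[OF \<Phi>_jointly_continuous])
      (use assms in \<open>auto intro!: tendsto_intros\<close>)
  then show ?thesis by simp
qed

lemma \<Phi>_inside: "cmod z \<le> 1 \<Longrightarrow> \<Phi> \<rho> z = z * exp (l (of_real \<rho> * z))"
  by (simp add: \<Phi>_def retract_inside height_inside)

lemma l_deriv: "z \<in> ball 0 1 \<Longrightarrow> (l has_field_derivative deriv l z) (at z)"
  and P_deriv: "z \<in> ball 0 1 \<Longrightarrow> (P has_field_derivative deriv P z) (at z)"
  using holomorphic_derivI[OF l_hol open_ball] holomorphic_derivI[OF P_hol open_ball] by auto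

text \<open>
  The real derivative of \<open>\<Phi> \<rho>\<close> at \<open>z\<close> in the direction \<open>h\<close>. Outside the disc it is expressed through
  \<open>h/z = d (log z)\<close>, whose real and imaginary parts are the radial and the angular increment. The value \<open>Q\<close> replaces
  \<open>q\<close>: it is \<open>q (\<rho> \<zeta>)\<close> for \<open>\<rho> < 1\<close> and the boundary value of \<open>q\<close> for \<open>\<rho> = 1\<close>.
\<close>
definition d\<Phi> :: "real \<Rightarrow> complex \<Rightarrow> complex \<Rightarrow> complex \<Rightarrow> complex" where
  "d\<Phi> \<rho> Q z h = (let w = of_real \<rho> * retract z; s = height z; D = P w / (\<gamma> * (1 + of_real s * P w)) in
     if cmod z < 1 then exp (l w) * P w / \<gamma> * h
     else \<Phi> \<rho> z * (D * of_real (1 + s) * of_real (Re (h / z)) + \<i> * D * (1 + of_real s * Q) * of_real (Im (h / z))))"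

text \<open>
  Here \<open>\<Phi> \<rho>\<close> is holomorphic, as \<open>P = \<gamma> (1 + z l')\<close> shows.
\<close>
lemma \<Phi>_has_derivative_inside:
  assumes \<rho>: "0 \<le> \<rho>" "\<rho> \<le> 1" and z: "cmod z < 1"
  shows "(\<Phi> \<rho> has_field_derivative exp (l (of_real \<rho> * z)) * P (of_real \<rho> * z) / \<gamma>) (at z)"
proof -
  let ?w = "of_real \<rho> * z"
  have w: "?w \<in> ball 0 1"
    using mult_mono[of \<rho> 1 "cmod z" "cmod z"] \<rho> z by (simp add: norm_mult)
  have "((\<lambda>z. of_real \<rho> * z) has_field_derivative of_real \<rho>) (at z)"
    by (auto intro!: derivative_eq_intros)
  from DERIV_chain2[OF l_deriv[OF w] this]
  have "((\<lambda>z. l (of_real \<rho> * z)) has_field_derivative deriv l ?w * of_real \<rho>) (at z)" .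
  then have "((\<lambda>z. z * exp (l (of_real \<rho> * z))) has_field_derivative
      1 * exp (l ?w) + z * (exp (l ?w) * (deriv l ?w * of_real \<rho>))) (at z)"
    by (auto intro!: derivative_eq_intros)
  moreover have "1 * exp (l ?w) + z * (exp (l ?w) * (deriv l ?w * of_real \<rho>)) = exp (l ?w) * P ?w / \<gamma>"
    using P_eq[OF w] \<gamma>_nz by (simp add: field_simps)
  ultimately have "((\<lambda>z. z * exp (l (of_real \<rho> * z))) has_field_derivative exp (l ?w) * P ?w / \<gamma>) (at z)" by simp
  then show ?thesis
    by (rule has_field_derivative_transform_within_open[of _ _ _ "ball 0 1"]) (use z \<Phi>_inside in auto)
qed

text \<open>
  In the coordinate \<open>log z\<close> the modulus and the direction are \<open>exp\<close> of the real and of \<open>\<i>\<close> times the imaginary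
  part.
\<close>
lemma sgn_has_derivative:
  assumes "z \<noteq> 0"
  shows "(cmod has_derivative (\<lambda>h. cmod z * Re (h / z))) (at z)"
    "(sgn has_derivative (\<lambda>h. \<i> * sgn z * of_real (Im (h / z)))) (at z)"
proof -
  have "h \<bullet> sgn z = cmod z * Re (h / z)" for h
  proof -
    have "h = z * (h / z)" using assms by simp
    then have "h \<bullet> z = (z * (h / z)) \<bullet> z" by simp
    also have "\<dots> = (cmod z)\<^sup>2 * Re (h / z)"
      unfolding inner_complex_def cmod_power2 by (simp add: power2_eq_square algebra_simps del: times_divide_eq_right times_divide_eq_left)
    finally show ?thesis using assms by (simp add: sgn_div_norm power2_eq_square field_simps)
  qed
  then show n: "(cmod has_derivative (\<lambda>h. cmod z * Re (h / z))) (at z)"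
    using has_derivative_norm[OF assms] by simp
  have "((\<lambda>z. z / of_real (cmod z)) has_derivative
     (\<lambda>h. (h * of_real (cmod z) - z * of_real (cmod z * Re (h / z))) / (of_real (cmod z) * of_real (cmod z)))) (at z)"
    by (rule has_derivative_divide'[OF has_derivative_ident has_derivative_of_real[OF n]]) (use assms in simp)
  moreover have "(h * of_real (cmod z) - z * of_real (cmod z * Re (h / z))) / (of_real (cmod z) * of_real (cmod z))
      = \<i> * sgn z * of_real (Im (h / z))" for h
  proof -
    have "h = z * (h / z)" using assms by simp
    also have "h / z = of_real (Re (h / z)) + \<i> * of_real (Im (h / z))" by (rule complex_eq)
    finally have "h - z * of_real (Re (h / z)) = \<i> * z * of_real (Im (h / z))"
      by (simp add: algebra_simps)
    then have "h * of_real (cmod z) - z * of_real (cmod z * Re (h / z)) = of_real (cmod z) * (\<i> * z * of_real (Im (h / z)))"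
      by (metis (no_types, opaque_lifting) mult.assoc mult.commute of_real_mult right_diff_distrib')
    then show ?thesis using assms by (simp add: sgn_eq)
  qed
  ultimately show "(sgn has_derivative (\<lambda>h. \<i> * sgn z * of_real (Im (h / z)))) (at z)"
    by (simp add: sgn_eq[abs_def])
qed

text \<open>
  Logarithmic differentiation. The angular terms combine because
  \<open>P/\<gamma> + s P (q - P) / (\<gamma> (1 + s P)) = P (1 + s q) / (\<gamma> (1 + s P))\<close>; here the differential equation of \<open>P\<close>
  is used.
\<close>
lemma \<Phi>_has_derivative_outside:
  assumes \<rho>: "0 \<le> \<rho>" "\<rho> < 1" and z: "cmod z > 1"
  shows "(\<Phi> \<rho> has_derivative d\<Phi> \<rho> (q (of_real \<rho> * sgn z)) z) (at z)"
proof -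
  define w where "w = of_real \<rho> * sgn z"
  define s where "s = cmod z - 1"
  define D where "D = P w / (\<gamma> * (1 + of_real s * P w))"
  have z0: "z \<noteq> 0" using z by auto
  have w: "w \<in> ball 0 1" using \<rho> z0 by (simp add: w_def norm_mult norm_sgn)
  then have wc: "w \<in> cball 0 1" by simp
  have s: "s \<ge> 0" using z by (simp add: s_def)
  note n = sgn_has_derivative(1)[OF z0] and sg = sgn_has_derivative(2)[OF z0]
  have dw: "((\<lambda>z. of_real \<rho> * sgn z) has_derivative (\<lambda>h. \<i> * w * of_real (Im (h / z)))) (at z)"
    using has_derivative_mult_right[OF sg, of "of_real \<rho>"] by (simp add: w_def mult_ac)
  have dl: "((\<lambda>z. l (of_real \<rho> * sgn z)) has_derivative (\<lambda>h. deriv l w * (\<i> * w * of_real (Im (h / z))))) (at z)"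
    using diff_chain_at[OF dw, of l "\<lambda>h. deriv l w * h"] l_deriv[OF w] unfolding w_def
    by (simp add: has_field_derivative_def o_def)
  have dP: "((\<lambda>z. P (of_real \<rho> * sgn z)) has_derivative (\<lambda>h. deriv P w * (\<i> * w * of_real (Im (h / z))))) (at z)"
    using diff_chain_at[OF dw, of P "\<lambda>h. deriv P w * h"] P_deriv[OF w] unfolding w_def
    by (simp add: has_field_derivative_def o_def)
  have lw: "w * deriv l w = P w / \<gamma> - 1" using P_eq[OF w] \<gamma>_nz by (simp add: field_simps)
  have dl': "((\<lambda>z. l (of_real \<rho> * sgn z)) has_derivative (\<lambda>h. \<i> * (P w / \<gamma> - 1) * of_real (Im (h / z)))) (at z)"
    using dl unfolding lw[symmetric] by (simp add: mult_ac)
  have dP': "((\<lambda>z. P (of_real \<rho> * sgn z)) has_derivative (\<lambda>h. \<i> * (P w * (q w - P w)) * of_real (Im (h / z)))) (at z)"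
    using dP unfolding P_ode[OF w, symmetric] by (simp add: mult_ac)
  have dX: "((\<lambda>z. 1 + of_real (cmod z - 1) * P (of_real \<rho> * sgn z)) has_derivative
      (\<lambda>h. of_real s * (\<i> * (P w * (q w - P w)) * of_real (Im (h / z))) + of_real (cmod z * Re (h / z)) * P w)) (at z)"
  proof -
    have "((\<lambda>z. cmod z - 1) has_derivative (\<lambda>h. cmod z * Re (h / z))) (at z)"
      using has_derivative_diff[OF n has_derivative_const[of 1]] by simp
    from has_derivative_mult[OF has_derivative_of_real[OF this] dP']
    have "((\<lambda>z. of_real (cmod z - 1) * P (of_real \<rho> * sgn z)) has_derivative
      (\<lambda>h. of_real s * (\<i> * (P w * (q w - P w)) * of_real (Im (h / z))) + of_real (cmod z * Re (h / z)) * P w)) (at z)"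
      by (simp add: s_def w_def)
    from has_derivative_add[OF has_derivative_const[of 1] this] show ?thesis by simp
  qed
  let ?X = "1 + of_real s * P w"
  have X: "?X \<noteq> 0" "?X \<notin> \<real>\<^sub>\<le>\<^sub>0" using stretch_nz[OF wc s] stretch_slit[OF wc s] by auto
  have "(Ln has_derivative (\<lambda>h. inverse ?X * h)) (at ?X)"
    using has_field_derivative_Ln[OF X(2)] by (simp add: has_field_derivative_def)
  then have "(Ln has_derivative (\<lambda>h. inverse ?X * h)) (at (1 + of_real (cmod z - 1) * P (of_real \<rho> * sgn z)))"
    by (simp add: s_def w_def)
  from diff_chain_at[OF dX this]
  have dLn: "((\<lambda>z. Ln (1 + of_real (cmod z - 1) * P (of_real \<rho> * sgn z))) has_derivative
     (\<lambda>h. inverse ?X * (of_real s * (\<i> * (P w * (q w - P w)) * of_real (Im (h / z))) + of_real (cmod z * Re (h / z)) * P w))) (at z)"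
    by (simp add: o_def)
  let ?L = "\<lambda>z. l (of_real \<rho> * sgn z) + Ln (1 + of_real (cmod z - 1) * P (of_real \<rho> * sgn z)) * inverse \<gamma>"
  let ?L' = "\<lambda>h. \<i> * (P w / \<gamma> - 1) * of_real (Im (h / z)) + (inverse ?X * (of_real s * (\<i> * (P w * (q w - P w)) * of_real (Im (h / z))) + of_real (cmod z * Re (h / z)) * P w)) * inverse \<gamma>"
  have dL: "(?L has_derivative ?L') (at z)"
    by (rule has_derivative_add[OF dl' has_derivative_mult_left[OF dLn]])
  have "(exp has_derivative (\<lambda>h. exp (?L z) * h)) (at (?L z))"
    using DERIV_exp[of "?L z"] by (simp only: has_field_derivative_def)
  from diff_chain_at[OF dL this] have "((\<lambda>z. exp (?L z)) has_derivative (\<lambda>h. exp (?L z) * ?L' h)) (at z)"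
    by (simp only: o_def)
  from has_derivative_mult[OF sg this]
  have main: "((\<lambda>z. sgn z * exp (?L z)) has_derivative
     (\<lambda>h. sgn z * (exp (?L z) * ?L' h) + \<i> * sgn z * of_real (Im (h / z)) * exp (?L z))) (at z)" .
  have eq: "\<Phi> \<rho> y = sgn y * exp (?L y)" if "cmod y > 1" for y
    using that by (simp add: \<Phi>_def retract_outside height_outside divide_inverse)
  have "(\<Phi> \<rho> has_derivative
     (\<lambda>h. sgn z * (exp (?L z) * ?L' h) + \<i> * sgn z * of_real (Im (h / z)) * exp (?L z))) (at z)"
  proof (rule has_derivative_transform_within_open[OF main])
    show "open {y. cmod y > 1}" by (intro open_Collect_less continuous_intros)
  qed (use z eq in auto)
  moreover have "sgn z * (exp (?L z) * ?L' h) + \<i> * sgn z * of_real (Im (h / z)) * exp (?L z) = d\<Phi> \<rho> (q w) z h" for h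
  proof -
    define a b where "a = Re (h / z)" and "b = Im (h / z)"
    have "\<i> * (P w / \<gamma> - 1) * of_real b + (inverse ?X * (of_real s * (\<i> * (P w * (q w - P w)) * of_real b) + of_real (cmod z * a) * P w)) * inverse \<gamma> + \<i> * of_real b
      = D * of_real (1 + s) * of_real a + \<i> * D * (1 + of_real s * q w) * of_real b"
    proof -
      have 3: "of_real (cmod z * a) = of_real (1 + s) * (of_real a :: complex)" by (simp add: s_def)
      have D2: "D = inverse ?X * inverse \<gamma> * P w" by (simp add: D_def divide_inverse)
      have "P w / \<gamma> = D * ?X" using X(1) \<gamma>_nz by (simp add: D_def)
      then show ?thesis unfolding 3 by (simp add: D2 algebra_simps)
    qed
    then have "?L' h + \<i> * of_real (Im (h / z)) = D * of_real (1 + s) * of_real a + \<i> * D * (1 + of_real s * q w) * of_real b"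
      by (simp only: a_def b_def)
    moreover have "sgn z * (exp (?L z) * ?L' h) + \<i> * sgn z * of_real (Im (h / z)) * exp (?L z) = (sgn z * exp (?L z)) * (?L' h + \<i> * of_real (Im (h / z)))"
      by (simp only: distrib_left mult_ac)
    ultimately have "sgn z * (exp (?L z) * ?L' h) + \<i> * sgn z * of_real (Im (h / z)) * exp (?L z)
       = \<Phi> \<rho> z * (D * of_real (1 + s) * of_real a + \<i> * D * (1 + of_real s * q w) * of_real b)"
      by (simp only: eq[OF z])
    then show ?thesis using z
      by (simp add: d\<Phi>_def Let_def D_def a_def b_def retract_outside height_outside w_def s_def)
  qed
  ultimately show ?thesis by (simp add: w_def)
qed

section \<open>The extension is a sense-preserving homeomorphism of the plane\<close>

lemma retract_nz: "z \<noteq> 0 \<Longrightarrow> retract z \<noteq> 0"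
  by (simp add: retract_def)

lemma \<Phi>_eq_0_iff: "\<Phi> \<rho> z = 0 \<longleftrightarrow> z = 0"
  using retract_nz[of z] by (auto simp: \<Phi>_def retract_def)

lemma l_bound: obtains \<Lambda> where "\<And>z. z \<in> cball 0 1 \<Longrightarrow> cmod (l z) \<le> \<Lambda>"
proof -
  have "bounded (l ` cball 0 1)" by (intro compact_imp_bounded compact_continuous_image l_cont compact_cball)
  then obtain \<Lambda> where "\<forall>x\<in>l ` cball 0 1. cmod x \<le> \<Lambda>" unfolding bounded_iff by blast
  then show thesis by (intro that[of \<Lambda>]) auto
qed

text \<open>
  On the circle \<open>|z| = 1 + s\<close> the modulus of \<open>1 + s P\<close> is at least \<open>1 + s c0\<close>, and
  \<open>Re (Ln X / \<gamma>)\<close> grows like \<open>ln |X|\<close> times \<open>Re \<gamma> / |\<gamma>|\<^sup>2\<close> because the argument of \<open>X\<close> is bounded.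
\<close>
lemma extension_proper: "\<exists>R. \<forall>z. cmod (\<Phi> 1 z) \<le> B \<longrightarrow> cmod z \<le> R"
proof -
  obtain \<Lambda> where \<Lambda>: "\<And>z. z \<in> cball 0 1 \<Longrightarrow> cmod (l z) \<le> \<Lambda>" using l_bound by blast
  \<comment> \<open>The maximum with \<open>1\<close> is there to allow taking the logarithm.\<close>
  define b where "b = max 1 B"
  define T where "T = (cmod \<gamma>)\<^sup>2 * (ln b + \<Lambda>) + \<bar>Im \<gamma>\<bar> * pi"
  define R where "R = 1 + exp (T / Re \<gamma>) / c0"
  have "cmod z \<le> R" if zB: "cmod (\<Phi> 1 z) \<le> B" for z
  proof (cases "cmod z \<le> 1")
    case True
    have "exp (T / Re \<gamma>) / c0 \<ge> 0" using c0_pos by simp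
    then show ?thesis using True by (simp add: R_def)
  next
    case False
    define \<zeta> s where "\<zeta> = retract z" and "s = height z"
    have \<zeta>: "\<zeta> \<in> cball 0 1" "cmod \<zeta> = 1" and s: "s \<ge> 0" "s = cmod z - 1"
      using False retract_cball height_nonneg by (auto simp: \<zeta>_def s_def retract_outside height_outside norm_sgn)
    let ?X = "1 + of_real s * P \<zeta>"
    note X = stretch_nz[OF \<zeta>(1) s(1)]
    have Y: "1 + s * c0 \<le> cmod ?X"
      using order_trans[OF stretch_Re[OF \<zeta>(1) s(1)] complex_Re_le_cmod] .
    have "exp (Re (l \<zeta> + Ln ?X / \<gamma>)) = cmod (\<Phi> 1 z)"
      using \<zeta>(2) by (simp add: \<Phi>_def \<zeta>_def s_def norm_mult)
    also have "\<dots> \<le> b" using zB by (simp add: b_def)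
    finally have "Re (l \<zeta> + Ln ?X / \<gamma>) \<le> ln b"
      by (subst ln_ge_iff) (auto simp: b_def)
    moreover have "\<bar>Re (l \<zeta>)\<bar> \<le> \<Lambda>" using order_trans[OF abs_Re_le_cmod \<Lambda>[OF \<zeta>(1)]] .
    ultimately have 1: "Re (Ln ?X / \<gamma>) \<le> ln b + \<Lambda>" by simp
    have "Re (Ln ?X / \<gamma>) * (cmod \<gamma>)\<^sup>2 = Re (Ln ?X) * Re \<gamma> + Im (Ln ?X) * Im \<gamma>"
      using \<gamma>_nz by (simp add: Re_divide cmod_power2[symmetric])
    moreover have "Re (Ln ?X / \<gamma>) * (cmod \<gamma>)\<^sup>2 \<le> (ln b + \<Lambda>) * (cmod \<gamma>)\<^sup>2"
      using 1 by (rule mult_right_mono) simp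
    moreover have "\<bar>Im (Ln ?X) * Im \<gamma>\<bar> \<le> pi * \<bar>Im \<gamma>\<bar>"
      unfolding abs_mult using mpi_less_Im_Ln[OF X(1)] Im_Ln_le_pi[OF X(1)] by (intro mult_right_mono) auto
    ultimately have "Re (Ln ?X) * Re \<gamma> \<le> T" by (simp add: T_def mult.commute)
    then have "ln (cmod ?X) \<le> T / Re \<gamma>" using \<gamma> X by (simp add: pos_le_divide_eq)
    moreover have "cmod ?X > 0" using X by simp
    ultimately have "cmod ?X \<le> exp (T / Re \<gamma>)" by (metis exp_le_cancel_iff exp_ln)
    with Y have "s * c0 \<le> exp (T / Re \<gamma>)" by simp
    then have "s \<le> exp (T / Re \<gamma>) / c0" using c0_pos by (simp add: pos_le_divide_eq)
    then show ?thesis using s(2) by (simp add: R_def)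
  qed
  then show ?thesis by blast
qed

text \<open>
  In the coordinate \<open>Z = log z\<close>, \<open>\<Psi>\<close> is \<open>f\<^sup>\<gamma>\<close>, \<open>K\<close> is its derivative and \<open>L\<close> is the logarithm of the
  extension.
\<close>
definition \<Psi> :: "complex \<Rightarrow> complex" where "\<Psi> Z = exp (\<gamma> * (Z + l (exp Z)))"
definition K :: "complex \<Rightarrow> complex" where "K Z = \<Psi> Z * P (exp Z)"
definition L :: "complex \<Rightarrow> complex" where
  "L Z = left_half Z + l (exp (left_half Z)) + Ln (1 + of_real (excess Z) * P (exp (left_half Z))) / \<gamma>"

lemma exp_left_half: "retract (exp Z) = exp (left_half Z)" and height_exp: "height (exp Z) = excess Z"
proof -
  show "height (exp Z) = excess Z" by (simp add: height_def excess_def max.commute)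
  have "left_half Z = Z - of_real (max (Re Z) 0)" by (simp add: left_half_def complex_eq_iff min_def max_def)
  then have "exp (left_half Z) = exp Z / of_real (exp (max (Re Z) 0))"
    by (simp add: exp_diff exp_of_real)
  also have "exp (max (Re Z) 0) = max 1 (exp (Re Z))" by (auto simp: max_def)
  finally show "retract (exp Z) = exp (left_half Z)" by (simp add: retract_def)
qed

lemma exp_left_half_cball: "exp (left_half Z) \<in> cball 0 1" using Re_left_half[of Z] by simp

lemma excess_nonneg: "excess Z \<ge> 0" by (simp add: excess_def)

lemma \<Phi>_exp: "\<Phi> 1 (exp Z) = exp (L Z)"
  by (simp add: \<Phi>_def L_def exp_left_half height_exp exp_add)

text \<open>
  The power \<open>F\<^sup>\<gamma>\<close> is the affine continuation of \<open>\<Psi>\<close>.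
\<close>
lemma exp_\<gamma>_L: "exp (\<gamma> * L Z) = \<Psi> (left_half Z) + of_real (excess Z) * K (left_half Z)"
proof -
  have "\<gamma> * L Z = \<gamma> * (left_half Z + l (exp (left_half Z))) + Ln (1 + of_real (excess Z) * P (exp (left_half Z)))"
    using \<gamma>_nz by (simp add: L_def algebra_simps)
  then have "exp (\<gamma> * L Z) = \<Psi> (left_half Z) * (1 + of_real (excess Z) * P (exp (left_half Z)))"
    using stretch_nz(1)[OF exp_left_half_cball excess_nonneg] by (simp add: exp_add \<Psi>_def)
  then show ?thesis by (simp add: K_def algebra_simps)
qed

lemma left_half_cont: "continuous_on S left_half"
  unfolding left_half_def by (intro continuous_intros)

lemma L_cont: "continuous_on UNIV L"
proof -
  have e: "continuous_on UNIV (\<lambda>Z. exp (left_half Z))" by (intro continuous_intros left_half_cont)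
  have im: "range (\<lambda>Z. exp (left_half Z)) \<subseteq> cball 0 1" using exp_left_half_cball by blast
  have lw: "continuous_on UNIV (\<lambda>Z. l (exp (left_half Z)))" by (rule continuous_on_compose2[OF l_cont e im])
  have Pw: "continuous_on UNIV (\<lambda>Z. P (exp (left_half Z)))" by (rule continuous_on_compose2[OF P_cont e im])
  have ex: "continuous_on UNIV excess" unfolding excess_def by (intro continuous_intros)
  have "continuous_on UNIV (\<lambda>Z. Ln (1 + of_real (excess Z) * P (exp (left_half Z))))"
    using stretch_slit[OF exp_left_half_cball excess_nonneg]
    by (intro continuous_on_Ln' continuous_on_mult continuous_on_add continuous_on_const continuous_on_of_real ex Pw)
  then show ?thesis unfolding L_def
    by (intro continuous_on_add left_half_cont lw continuous_on_divide continuous_on_const) (use \<gamma>_nz in auto)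
qed

lemma P_nz: "z \<in> cball 0 1 \<Longrightarrow> P z \<noteq> 0"
  using P_Re[of z] c0_pos by auto

lemma \<Psi>_deriv:
  assumes "Re Z < 0"
  shows "(\<Psi> has_field_derivative K Z) (at Z)"
proof -
  have w: "exp Z \<in> ball 0 1" using assms by simp
  have "((\<lambda>Z. l (exp Z)) has_field_derivative deriv l (exp Z) * exp Z) (at Z)"
    by (rule DERIV_chain2[OF l_deriv[OF w] DERIV_exp])
  then have "(\<Psi> has_field_derivative exp (\<gamma> * (Z + l (exp Z))) * (\<gamma> * (1 + deriv l (exp Z) * exp Z))) (at Z)"
    unfolding \<Psi>_def by (auto intro!: derivative_eq_intros)
  then show ?thesis using P_eq[OF w] by (simp add: K_def \<Psi>_def mult.commute)
qed

lemma K_deriv: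
  assumes "Re Z < 0"
  shows "(K has_field_derivative K Z * q (exp Z)) (at Z)"
proof -
  have w: "exp Z \<in> ball 0 1" using assms by simp
  have "((\<lambda>Z. P (exp Z)) has_field_derivative deriv P (exp Z) * exp Z) (at Z)"
    by (rule DERIV_chain2[OF P_deriv[OF w] DERIV_exp])
  from DERIV_mult[OF \<Psi>_deriv[OF assms] this]
  have "(K has_field_derivative K Z * P (exp Z) + (exp Z * deriv P (exp Z)) * \<Psi> Z) (at Z)"
    by (simp add: K_def[abs_def] mult_ac)
  moreover have "K Z * P (exp Z) + (exp Z * deriv P (exp Z)) * \<Psi> Z = K Z * q (exp Z)"
    unfolding P_ode[OF w] by (simp add: K_def algebra_simps)
  ultimately show ?thesis by simp
qed

text \<open>
  Inside the disc this is the nonvanishing of the derivative. Elsewhere the power \<open>F\<^sup>\<gamma>\<close> is locally injective in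
  the coordinate \<open>log z\<close>, and \<open>exp\<close> is injective on discs of radius \<open>\<pi>\<close>, which allows to pass between \<open>z\<close> and
  \<open>log z\<close> and between \<open>F\<close> and \<open>log F\<close>.
\<close>
lemma extension_locally_injective: "\<exists>\<delta>>0. inj_on (\<Phi> 1) (ball z0 \<delta>)"
proof (cases "cmod z0 < 1")
  case True
  have hol: "\<Phi> 1 holomorphic_on ball 0 1"
    unfolding holomorphic_on_open[OF open_ball] using \<Phi>_has_derivative_inside[of 1] by fastforce
  have "deriv (\<Phi> 1) z0 = exp (l z0) * P z0 / \<gamma>"
    using \<Phi>_has_derivative_inside[of 1 z0] True by (auto intro: DERIV_imp_deriv)
  then have "deriv (\<Phi> 1) z0 \<noteq> 0" using P_nz[of z0] \<gamma>_nz True by simp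
  then show ?thesis
    using has_complex_derivative_locally_injective[OF hol, of z0] True by (metis open_ball mem_ball_0)
next
  case False
  then have z0: "z0 \<noteq> 0" by auto
  obtain C where C: "C > 0" "\<And>w. w \<in> U_disk k \<Longrightarrow> cmod w \<le> C" using U_bound by blast
  let ?H = "{w::complex. Re w \<le> 0}"
  have e: "continuous_on ?H (\<lambda>Z::complex. exp Z)" by (intro continuous_intros)
  have im: "(\<lambda>Z. exp Z) ` ?H \<subseteq> cball 0 1" by auto
  have \<Psi>c: "continuous_on ?H \<Psi>"
    unfolding \<Psi>_def by (intro continuous_intros continuous_on_compose2[OF l_cont e im])
  have Kc: "continuous_on ?H K"
    unfolding K_def by (intro continuous_on_mult \<Psi>c continuous_on_compose2[OF P_cont e im])
  have K0: "K w \<noteq> 0" if "Re w \<le> 0" for w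
    using that P_nz[of "exp w"] by (simp add: K_def \<Psi>_def)
  have q1: "c0 \<le> Re (q (exp w))" if "Re w < 0" for w
    unfolding c0_def by (rule U_disk_Re_pos[OF k q_U]) (use that in simp)
  have q2: "cmod (q (exp w)) \<le> C" if "Re w < 0" for w
    by (rule C(2)[OF q_U]) (use that in simp)
  define Z0 where "Z0 = Ln z0"
  have Z0: "exp Z0 = z0" using z0 by (simp add: Z0_def)
  obtain \<delta>1 where \<delta>1: "\<delta>1 > 0" "inj_on (\<lambda>Z. exp (\<gamma> * L Z)) (ball Z0 \<delta>1)"
    using affine_continuation_locally_injective[OF \<Psi>c \<Psi>_deriv Kc K_deriv K0 c0_pos q1 C(1) q2, of Z0]
    unfolding exp_\<gamma>_L by blast
  obtain \<delta>2 where \<delta>2: "\<delta>2 > 0" "\<And>Z. dist Z Z0 < \<delta>2 \<Longrightarrow> dist (L Z) (L Z0) < pi"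
    using L_cont[unfolded continuous_on_iff, rule_format, of Z0 pi] pi_gt_zero by auto
  define \<delta> where "\<delta> = min pi (min \<delta>1 \<delta>2)"
  have \<delta>: "\<delta> > 0" "\<delta> \<le> pi" "\<delta> \<le> \<delta>1" "\<delta> \<le> \<delta>2" using \<delta>1 \<delta>2 by (auto simp: \<delta>_def)
  have expinj: "inj_on exp (ball Z0 \<delta>)"
    by (rule inj_on_subset[OF inj_on_exp_pi[of Z0]]) (use \<delta> in auto)
  have "open (exp ` ball Z0 \<delta>)"
    by (rule invariance_of_domain[OF _ open_ball expinj]) (intro continuous_intros)
  moreover have "z0 \<in> exp ` ball Z0 \<delta>" using Z0 \<delta>(1) by (metis centre_in_ball imageI)
  ultimately obtain r where r: "r > 0" "ball z0 r \<subseteq> exp ` ball Z0 \<delta>"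
    using open_contains_ball by metis
  have "inj_on (\<Phi> 1) (exp ` ball Z0 \<delta>)"
  proof (rule inj_onI)
    fix x y assume "x \<in> exp ` ball Z0 \<delta>" "y \<in> exp ` ball Z0 \<delta>" and eq: "\<Phi> 1 x = \<Phi> 1 y"
    then obtain Z W where ZW: "x = exp Z" "y = exp W" "Z \<in> ball Z0 \<delta>" "W \<in> ball Z0 \<delta>" by (elim imageE)
    have "exp (L Z) = exp (L W)" using eq unfolding ZW(1,2) \<Phi>_exp .
    moreover have "L Z \<in> ball (L Z0) pi" "L W \<in> ball (L Z0) pi"
      using \<delta>2(2)[of Z] \<delta>2(2)[of W] ZW(3,4) \<delta>(4) by (auto simp: dist_commute)
    ultimately have "L Z = L W" by (rule inj_onD[OF inj_on_exp_pi])
    then have "exp (\<gamma> * L Z) = exp (\<gamma> * L W)" by simp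
    then have "Z = W" by (rule inj_onD[OF \<delta>1(2)]) (use ZW(3,4) \<delta>(3) in auto)
    then show "x = y" using ZW by simp
  qed
  then have "inj_on (\<Phi> 1) (ball z0 r)" by (rule inj_on_subset[OF _ r(2)])
  with r(1) show ?thesis by blast
qed

lemma extension_bij: "bij (\<Phi> 1)"
  and extension_open_map: "open U \<Longrightarrow> open (\<Phi> 1 ` U)"
proof -
  have c: "continuous_on UNIV (\<Phi> 1)" by (rule \<Phi>_continuous) auto
  have z: "z = 0" if "\<Phi> 1 z = \<Phi> 1 0" for z
    using that \<Phi>_eq_0_iff[of 1 z] \<Phi>_eq_0_iff[of 1 0] by simp
  note * = proper_locally_injective_bij[OF c extension_locally_injective extension_proper z]
  show "bij (\<Phi> 1)" by (rule *(1))
  show "open U \<Longrightarrow> open (\<Phi> 1 ` U)" by (rule *(2))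
qed

lemma extension_homeomorphism: "\<exists>H. homeomorphism UNIV (range (\<Phi> 1)) (\<Phi> 1) H"
proof -
  have "homeomorphism UNIV (range (\<Phi> 1)) (\<Phi> 1) (inv (\<Phi> 1))"
  proof (rule homeomorphismI)
    show "continuous_on UNIV (\<Phi> 1)" by (rule \<Phi>_continuous) auto
    have r: "range (\<Phi> 1) = UNIV" using extension_bij by (simp add: bij_is_surj)
    have "open (inv (\<Phi> 1) -` U)" if "open U" for U
      using extension_open_map[OF that] bij_vimage_eq_inv_image[OF bij_imp_bij_inv[OF extension_bij]]
        inv_inv_eq[OF extension_bij] by metis
    then show "continuous_on (range (\<Phi> 1)) (inv (\<Phi> 1))"
      unfolding r by (simp add: continuous_on_open_vimage)
  qed (use extension_bij in \<open>auto simp: bij_is_inj bij_is_surj surj_f_inv_f\<close>)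
  then show ?thesis by blast
qed

lemma extension_sense_preserving: "sense_preserving_on UNIV (\<Phi> 1)"
proof (rule injective_sense_preserving)
  show "continuous_on UNIV (\<Phi> 1)" by (rule \<Phi>_continuous) auto
  show "inj (\<Phi> 1)" using extension_bij by (rule bij_is_inj)
  show "\<Phi> 1 0 = 0" by (simp add: \<Phi>_eq_0_iff)
  show "continuous_on (cball 0 (1/2)) l" by (rule continuous_on_subset[OF l_cont]) auto
  show "\<Phi> 1 z = z * exp (l z)" if "z \<in> cball 0 (1/2)" for z using that by (simp add: \<Phi>_inside)
qed

section \<open>Dilatation and bounds for the derivative\<close>

lemma U_Re_nonneg: "w \<in> U_disk k \<Longrightarrow> Re w \<ge> 0"
  using U_disk_Re_pos[OF k] c0_pos unfolding c0_def by fastforce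

text \<open>
  As \<open>Re (1 + Q) \<ge> 0\<close>, adding \<open>2\<close> to \<open>s (1 + Q)\<close> increases the modulus; the rest is the defining
  inequality of \<open>U(k)\<close>.
\<close>
lemma dilatation_bound:
  assumes Q: "Q \<in> U_disk k" and s: "s \<ge> 0"
  shows "cmod (of_real s * (1 - Q)) \<le> k * cmod (2 + of_real s * (1 + Q))"
proof -
  have "cmod (of_real s * (1 - Q)) = s * cmod (Q - 1)" using s by (simp add: norm_mult norm_minus_commute)
  also have "\<dots> \<le> s * (k * cmod (Q + 1))" using Q s by (intro mult_left_mono) (auto simp: U_disk_iff[OF k])
  also have "\<dots> = k * cmod (of_real s * (1 + Q))" using s by (simp add: norm_mult add.commute)
  also have "\<dots> \<le> k * cmod (2 + of_real s * (1 + Q))"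
  proof (rule mult_left_mono[OF _ k(1)])
    let ?x = "of_real s * (1 + Q)"
    have "Re ?x \<ge> 0" using U_Re_nonneg[OF Q] s by simp
    then have "(Re ?x)\<^sup>2 \<le> (2 + Re ?x)\<^sup>2" by (intro power_mono) auto
    then show "cmod ?x \<le> cmod (2 + ?x)" unfolding cmod_def by (intro real_sqrt_le_mono) simp
  qed
  finally show ?thesis .
qed

text \<open>
  With \<open>A\<close> and \<open>B\<close> the radial and angular derivatives of \<open>log F\<close>, the two Wirtinger derivatives are
  \<open>F (A + \<i> B)\<close> times half of the conjugate of \<open>1/z\<close>, and \<open>F (A - \<i> B)\<close> times half of \<open>1/z\<close>. This reduces the claim
  to the preceding bound.
\<close>
lemma wirtinger_inequality:
  assumes Q: "cmod z \<ge> 1 \<Longrightarrow> Q \<in> U_disk k"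
  shows "cmod ((d\<Phi> 1 Q z 1 + \<i> * d\<Phi> 1 Q z \<i>) / 2) \<le> k * cmod ((d\<Phi> 1 Q z 1 - \<i> * d\<Phi> 1 Q z \<i>) / 2)"
proof (cases "cmod z < 1")
  case True
  have "d\<Phi> 1 Q z 1 + \<i> * d\<Phi> 1 Q z \<i> = 0"
  proof -
    have "\<i> * (x * \<i>) = - x" for x by (simp add: mult.commute[of x] mult.assoc[symmetric])
    then show ?thesis using True by (simp only: d\<Phi>_def Let_def if_True) simp
  qed
  then show ?thesis using k by simp
next
  case False
  define u where "u = inverse z"
  define s where "s = height z"
  define D where "D = P (retract z) / (\<gamma> * (1 + of_real s * P (retract z)))"
  define A B where "A = D * of_real (1 + s)" and "B = \<i> * D * (1 + of_real s * Q)"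
  have s: "s \<ge> 0" by (simp add: s_def height_nonneg)
  have d: "d\<Phi> 1 Q z h = \<Phi> 1 z * (A * of_real (Re (h * u)) + B * of_real (Im (h * u)))" for h
    using False by (simp add: d\<Phi>_def Let_def u_def s_def D_def A_def B_def divide_inverse)
  have d1: "d\<Phi> 1 Q z 1 = \<Phi> 1 z * (A * of_real (Re u) + B * of_real (Im u))"
    and di: "d\<Phi> 1 Q z \<i> = \<Phi> 1 z * (B * of_real (Re u) - A * of_real (Im u))"
    unfolding d by simp_all
  have ii: "\<i> * (\<i> * x) = - x" for x by (simp add: mult.assoc[symmetric])
  have u: "u = of_real (Re u) + \<i> * of_real (Im u)" "cnj u = of_real (Re u) - \<i> * of_real (Im u)"
    using complex_eq[of u] by (auto simp: complex_eq_iff)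
  have plus: "d\<Phi> 1 Q z 1 + \<i> * d\<Phi> 1 Q z \<i> = \<Phi> 1 z * cnj u * D * (of_real s * (1 - Q))"
  proof -
    have "d\<Phi> 1 Q z 1 + \<i> * d\<Phi> 1 Q z \<i> = \<Phi> 1 z * ((A + \<i> * B) * (of_real (Re u) - \<i> * of_real (Im u)))"
      unfolding d1 di by (simp add: algebra_simps ii)
    also have "A + \<i> * B = D * (of_real s * (1 - Q))"
      by (simp add: A_def B_def algebra_simps ii)
    finally show ?thesis unfolding u(2)[symmetric] by (simp only: mult_ac)
  qed
  have minus: "d\<Phi> 1 Q z 1 - \<i> * d\<Phi> 1 Q z \<i> = \<Phi> 1 z * u * D * (2 + of_real s * (1 + Q))"
  proof -
    have "d\<Phi> 1 Q z 1 - \<i> * d\<Phi> 1 Q z \<i> = \<Phi> 1 z * ((A - \<i> * B) * (of_real (Re u) + \<i> * of_real (Im u)))"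
      unfolding d1 di by (simp add: algebra_simps ii)
    also have "A - \<i> * B = D * (2 + of_real s * (1 + Q))"
      by (simp add: A_def B_def algebra_simps ii)
    finally show ?thesis unfolding u(1)[symmetric] by (simp only: mult_ac)
  qed
  have "cmod (\<Phi> 1 z * cnj u * D) * cmod (of_real s * (1 - Q)) \<le> cmod (\<Phi> 1 z * u * D) * (k * cmod (2 + of_real s * (1 + Q)))"
    using dilatation_bound[OF Q s] False by (simp only: norm_mult complex_mod_cnj) (intro mult_left_mono; simp)
  then show ?thesis
    unfolding plus minus norm_divide norm_mult[of "\<Phi> 1 z * cnj u * D"] norm_mult[of "\<Phi> 1 z * u * D"] by (simp add: mult_ac)
qed

text \<open>
  The bound is uniform in \<open>\<rho>\<close> because \<open>P\<close> and \<open>Q\<close> range in the bounded set \<open>U(k)\<close> and \<open>|1 + s P| \<ge> 1\<close>.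
\<close>
lemma d\<Phi>_bounded:
  obtains B where "\<And>\<rho> Q z d. 0 \<le> \<rho> \<Longrightarrow> \<rho> \<le> 1 \<Longrightarrow> cmod z \<le> R \<Longrightarrow> Q \<in> U_disk k \<Longrightarrow> cmod d = 1 \<Longrightarrow> cmod (d\<Phi> \<rho> Q z d) \<le> B"
proof -
  obtain M where M: "\<And>\<rho> z. 0 \<le> \<rho> \<Longrightarrow> \<rho> \<le> 1 \<Longrightarrow> cmod z \<le> R \<Longrightarrow> cmod (\<Phi> \<rho> z) \<le> M" using \<Phi>_bounded by blast
  obtain C where C: "C > 0" "\<And>w. w \<in> U_disk k \<Longrightarrow> cmod w \<le> C" using U_bound by blast
  obtain \<Lambda> where \<Lambda>: "\<And>z. z \<in> cball 0 1 \<Longrightarrow> cmod (l z) \<le> \<Lambda>" using l_bound by blast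
  define g where "g = cmod \<gamma>"
  have g: "g > 0" using \<gamma>_nz by (simp add: g_def)
  define B where "B = max (exp \<Lambda> * C / g) (max 0 M * (C / g * (2 + R) + C / g * (1 + (1 + R) * C)))"
  have "cmod (d\<Phi> \<rho> Q z d) \<le> B"
    if \<rho>: "0 \<le> \<rho>" "\<rho> \<le> 1" and z: "cmod z \<le> R" and Q: "Q \<in> U_disk k" and d: "cmod d = 1" for \<rho> Q z d
  proof (cases "cmod z < 1")
    case True
    let ?w = "of_real \<rho> * retract z"
    note w = scaled_retract_cball[OF \<rho>, of z]
    have "cmod (d\<Phi> \<rho> Q z d) = exp (Re (l ?w)) * cmod (P ?w) / g"
      using True d by (simp add: d\<Phi>_def Let_def norm_mult norm_divide g_def)
    also have "\<dots> \<le> exp \<Lambda> * C / g"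
      using order_trans[OF complex_Re_le_cmod \<Lambda>[OF w]] C(2)[OF P_U[OF w]] g
      by (intro divide_right_mono mult_mono) auto
    finally show ?thesis by (simp add: B_def)
  next
    case False
    define w s where "w = of_real \<rho> * retract z" and "s = height z"
    note w = scaled_retract_cball[OF \<rho>, of z, folded w_def]
    have s: "0 \<le> s" "s \<le> 1 + R" using z False by (auto simp: s_def height_nonneg height_def)
    define D where "D = P w / (\<gamma> * (1 + of_real s * P w))"
    have D: "cmod D \<le> C / g"
    proof -
      have "g * 1 \<le> g * cmod (1 + of_real s * P w)" using stretch_nz(2)[OF w s(1)] g by (intro mult_left_mono) auto
      then have "cmod (P w) / (g * cmod (1 + of_real s * P w)) \<le> C / g"
        using C(1) C(2)[OF P_U[OF w]] g by (intro frac_le) auto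
      then show ?thesis by (simp add: D_def norm_divide norm_mult g_def)
    qed
    have h: "cmod (d / z) \<le> 1" using d False by (simp add: norm_divide divide_le_eq)
    have r: "cmod (complex_of_real (Re (d / z))) \<le> 1" "cmod (complex_of_real (Im (d / z))) \<le> 1"
      unfolding norm_of_real using order_trans[OF abs_Re_le_cmod h] order_trans[OF abs_Im_le_cmod h] by auto
    have "cmod (D * of_real (1 + s)) \<le> C / g * (2 + R)"
      unfolding norm_mult norm_of_real using D s C g by (intro mult_mono) auto
    then have 1: "cmod (D * of_real (1 + s) * of_real (Re (d / z))) \<le> C / g * (2 + R) * 1"
      unfolding norm_mult[of "D * of_real (1 + s)"] using r C g s by (intro mult_mono) auto
    have "cmod (of_real s * Q) \<le> (1 + R) * C"
      unfolding norm_mult using s C(2)[OF Q] by (intro mult_mono) auto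
    then have "cmod (1 + of_real s * Q) \<le> 1 + (1 + R) * C" using norm_triangle_ineq[of 1 "of_real s * Q"] by simp
    then have "cmod (\<i> * D * (1 + of_real s * Q)) \<le> C / g * (1 + (1 + R) * C)"
      unfolding norm_mult norm_ii mult_1 using D C g by (intro mult_mono) auto
    then have 2: "cmod (\<i> * D * (1 + of_real s * Q) * of_real (Im (d / z))) \<le> C / g * (1 + (1 + R) * C) * 1"
      unfolding norm_mult[of "\<i> * D * (1 + of_real s * Q)"] using r C g s by (intro mult_mono) auto
    have "cmod (D * of_real (1 + s) * of_real (Re (d / z)) + \<i> * D * (1 + of_real s * Q) * of_real (Im (d / z)))
       \<le> C / g * (2 + R) + C / g * (1 + (1 + R) * C)"
      using norm_triangle_mono[OF 1 2] by simp
    then have "cmod (d\<Phi> \<rho> Q z d) \<le> max 0 M * (C / g * (2 + R) + C / g * (1 + (1 + R) * C))"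
      using False M[OF \<rho> z] C g s
      by (simp only: d\<Phi>_def Let_def if_False norm_mult[of "\<Phi> \<rho> z"] w_def[symmetric] s_def[symmetric] D_def[symmetric])
         (intro mult_mono; simp add: le_max_iff_disj)
    then show ?thesis by (simp add: B_def)
  qed
  then show thesis by (rule that)
qed

lemma d\<Phi>_tendsto:
  assumes \<rho>: "\<And>n. 0 \<le> \<rho> n" "\<And>n. \<rho> n \<le> 1" "\<rho> \<longlonglongrightarrow> 1" and Q: "Qn \<longlonglongrightarrow> Q"
  shows "(\<lambda>n. d\<Phi> (\<rho> n) (Qn n) z d) \<longlonglongrightarrow> d\<Phi> 1 Q z d"
proof -
  let ?w = "\<lambda>n. of_real (\<rho> n) * retract z"
  have w: "?w \<longlonglongrightarrow> of_real 1 * retract z" by (intro tendsto_intros \<rho>)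
  have wc: "?w n \<in> cball 0 1" for n by (rule scaled_retract_cball[OF \<rho>(1,2)])
  have rc: "of_real 1 * retract z \<in> cball 0 1" using retract_cball by simp
  have lw: "(\<lambda>n. l (?w n)) \<longlonglongrightarrow> l (of_real 1 * retract z)"
    by (rule continuous_on_tendsto_compose[OF l_cont w rc]) (rule always_eventually, rule allI, rule wc)
  have Pw: "(\<lambda>n. P (?w n)) \<longlonglongrightarrow> P (of_real 1 * retract z)"
    by (rule continuous_on_tendsto_compose[OF P_cont w rc]) (rule always_eventually, rule allI, rule wc)
  have nz: "\<gamma> * (1 + of_real (height z) * P (of_real 1 * retract z)) \<noteq> 0"
    using \<gamma>_nz stretch_nz(1)[OF rc height_nonneg] by simp
  show ?thesis
  proof (cases "cmod z < 1")
    case True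
    show ?thesis unfolding d\<Phi>_def Let_def if_P[OF True]
      by (intro tendsto_intros lw Pw \<gamma>_nz)
  next
    case False
    show ?thesis unfolding d\<Phi>_def Let_def if_not_P[OF False]
      by (intro tendsto_intros \<Phi>_tendsto \<rho> Pw Q nz)
  qed
qed

lemma d\<Phi>_measurable:
  assumes Q: "Q \<in> borel_measurable borel"
  shows "(\<lambda>z. d\<Phi> 1 (Q z) z d) \<in> borel_measurable borel"
proof -
  have im: "retract ` UNIV \<subseteq> cball 0 1" using retract_cball by blast
  have [measurable]: "(\<lambda>z. l (retract z)) \<in> borel_measurable borel" "(\<lambda>z. P (retract z)) \<in> borel_measurable borel"
    "height \<in> borel_measurable borel" "\<Phi> 1 \<in> borel_measurable borel"
    by (intro borel_measurable_continuous_onI continuous_on_compose2[OF l_cont retract_cont im]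
        continuous_on_compose2[OF P_cont retract_cont im] height_cont \<Phi>_continuous; simp)+
  have [measurable]: "Re \<in> borel_measurable borel" "Im \<in> borel_measurable borel"
    by (intro borel_measurable_continuous_onI continuous_intros)+
  note Q [measurable]
  show ?thesis unfolding d\<Phi>_def Let_def of_real_1 mult_1 by measurable
qed

section \<open>Weak derivatives and quasiconformality\<close>

lemma q_retract_continuous:
  assumes "0 \<le> \<rho>" "\<rho> < 1"
  shows "continuous_on UNIV (\<lambda>z. q (of_real \<rho> * retract z))"
  by (rule continuous_on_compose2[OF holomorphic_on_imp_continuous_on[OF q_hol]])
    (use scaled_retract_ball[OF assms] in \<open>auto intro!: continuous_intros retract_cont\<close>)

text \<open>
  The boundary values of \<open>q\<close> on almost every ray, together with the values of \<open>q\<close> in the disc itself; they stay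
  in \<open>U(k)\<close> since this set is closed.
\<close>
lemma boundary_dilatation:
  obtains \<rho> :: "nat \<Rightarrow> real" and Q where "\<And>n. 0 \<le> \<rho> n" "\<And>n. \<rho> n < 1" "\<rho> \<longlonglongrightarrow> 1" "Q \<in> borel_measurable borel"
    "AE z in lebesgue. Q z \<in> U_disk k \<and> (\<lambda>n. q (of_real (\<rho> n) * retract z)) \<longlonglongrightarrow> Q z"
proof -
  \<comment> \<open>Monotonicity of the radii is needed for the monotone square means.\<close>
  define \<rho>0 where "\<rho>0 = (\<lambda>n. 1 - inverse (real (Suc n)))"
  have \<rho>0: "0 \<le> \<rho>0 n" "\<rho>0 n < 1" for n by (auto simp: \<rho>0_def inverse_le_1_iff)
  have "incseq \<rho>0" unfolding \<rho>0_def by (intro monoI diff_mono le_imp_inverse_le) auto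
  obtain C where C: "\<And>w. w \<in> U_disk k \<Longrightarrow> cmod w \<le> C" using U_bound by blast
  obtain r :: "nat \<Rightarrow> nat" where r: "strict_mono r" "AE z in lebesgue. convergent (\<lambda>n. q (of_real (\<rho>0 (r n)) * sgn z))"
    using bounded_holomorphic_boundary_values_AE[OF q_hol C[OF q_U] \<open>incseq \<rho>0\<close> \<rho>0] by blast
  define \<rho> where "\<rho> = \<rho>0 \<circ> r"
  have \<rho>: "0 \<le> \<rho> n" "\<rho> n < 1" for n using \<rho>0 by (auto simp: \<rho>_def)
  have "\<rho>0 \<longlonglongrightarrow> 1 - 0" unfolding \<rho>0_def by (intro tendsto_intros LIMSEQ_inverse_real_of_nat)
  then have "\<rho>0 \<longlonglongrightarrow> 1" by simp
  then have \<rho>1: "\<rho> \<longlonglongrightarrow> 1" unfolding \<rho>_def using r(1) by (rule LIMSEQ_subseq_LIMSEQ)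
  let ?q = "\<lambda>n z. q (of_real (\<rho> n) * retract z)"
  define Q where "Q = (\<lambda>z. lim (\<lambda>n. ?q n z))"
  have "Q \<in> borel_measurable borel" unfolding Q_def
    by (rule borel_measurable_lim_metric[OF borel_measurable_continuous_onI[OF q_retract_continuous[OF \<rho>]]])
  moreover have "AE z in lebesgue. Q z \<in> U_disk k \<and> (\<lambda>n. ?q n z) \<longlonglongrightarrow> Q z"
    using r(2)
  proof eventually_elim
    case (elim z)
    have "convergent (\<lambda>n. ?q n z)"
    proof (cases "cmod z < 1")
      case True
      have "(\<lambda>n. ?q n z) \<longlonglongrightarrow> q (of_real 1 * z)"
        using True \<rho>1 retract_inside[of z] scaled_retract_ball[OF \<rho>, of _ z]
        by (intro continuous_on_tendsto_compose[OF holomorphic_on_imp_continuous_on[OF q_hol]] tendsto_intros)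
          (auto intro!: always_eventually tendsto_intros)
      then show ?thesis by (rule convergentI)
    next
      case False
      then show ?thesis using elim by (simp add: retract_outside \<rho>_def)
    qed
    then have lim: "(\<lambda>n. ?q n z) \<longlonglongrightarrow> Q z" unfolding Q_def by (simp add: convergent_LIMSEQ_iff)
    have "Q z \<in> U_disk k"
      by (rule closed_sequentially[OF U_disk_closed[OF k] _ lim]) (intro q_U scaled_retract_ball \<rho>)
    with lim show ?case by simp
  qed
  ultimately show thesis using that[OF \<rho> \<rho>1] by blast
qed

lemma \<Phi>_has_derivative:
  assumes \<rho>: "0 \<le> \<rho>" "\<rho> < 1" and z: "cmod z \<noteq> 1"
  shows "(\<Phi> \<rho> has_derivative d\<Phi> \<rho> (q (of_real \<rho> * retract z)) z) (at z)"
proof (cases "cmod z < 1")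
  case True
  have "d\<Phi> \<rho> Q z = (*) (exp (l (of_real \<rho> * z)) * P (of_real \<rho> * z) / \<gamma>)" for Q
    using True by (intro ext) (simp add: d\<Phi>_def Let_def retract_inside)
  then show ?thesis
    using \<Phi>_has_derivative_inside[of \<rho> z] \<rho> True by (simp add: has_field_derivative_def)
next
  case False
  then have "cmod z > 1" using z by simp
  then show ?thesis using \<Phi>_has_derivative_outside[OF \<rho>, of z] by (simp add: retract_outside)
qed

text \<open>
  The derivative of \<open>\<Phi> 1\<close> outside the disc would involve \<open>q\<close> on the unit circle, where only boundary
  values almost everywhere are at hand. So the maps \<open>\<Phi> \<rho>\<close>, differentiable off the circle, are used, and
  \<open>\<rho>\<close> tends to \<open>1\<close> in the integration by parts formula.
\<close>
lemma extension_weak_derivatives: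
  obtains Q where "Q \<in> borel_measurable borel" "AE z in lebesgue. Q z \<in> U_disk k"
    "\<And>\<phi> d. \<phi> \<in> test_functions UNIV \<Longrightarrow> d = 1 \<or> d = \<i> \<Longrightarrow>
       integrable lebesgue (\<lambda>z. \<Phi> 1 z * frechet_derivative \<phi> (at z) d) \<and>
       integrable lebesgue (\<lambda>z. d\<Phi> 1 (Q z) z d * \<phi> z) \<and>
       (LINT z|lebesgue. \<Phi> 1 z * frechet_derivative \<phi> (at z) d) = - (LINT z|lebesgue. d\<Phi> 1 (Q z) z d * \<phi> z)"
proof -
  obtain \<rho> Q where \<rho>: "\<And>n::nat. 0 \<le> \<rho> n" "\<And>n. \<rho> n < 1" "\<rho> \<longlonglongrightarrow> 1" and Q: "Q \<in> borel_measurable borel"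
    and lim: "AE z in lebesgue. Q z \<in> U_disk k \<and> (\<lambda>n. q (of_real (\<rho> n) * retract z)) \<longlonglongrightarrow> Q z"
    using boundary_dilatation by blast
  have \<rho>': "\<rho> n \<le> 1" for n using \<rho>(2)[of n] by simp
  define \<Phi>' where "\<Phi>' = (\<lambda>n z. d\<Phi> (\<rho> n) (q (of_real (\<rho> n) * retract z)) z)"
  have main: "integrable lebesgue (\<lambda>z. \<Phi> 1 z * frechet_derivative \<phi> (at z) d) \<and>
       integrable lebesgue (\<lambda>z. d\<Phi> 1 (Q z) z d * \<phi> z) \<and>
       (LINT z|lebesgue. \<Phi> 1 z * frechet_derivative \<phi> (at z) d) = - (LINT z|lebesgue. d\<Phi> 1 (Q z) z d * \<phi> z)"
    if \<phi>: "\<phi> \<in> test_functions UNIV" and d: "d = 1 \<or> d = \<i>" for \<phi> d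
  proof -
    have c1: "continuous_on UNIV (\<Phi> (\<rho> n))" for n by (rule \<Phi>_continuous[OF \<rho>(1) \<rho>'])
    have c2: "continuous_on UNIV (\<Phi> 1)" by (rule \<Phi>_continuous) auto
    have der: "(\<Phi> (\<rho> n) has_derivative \<Phi>' n z) (at z)" if "cmod z \<noteq> 1" for n z
      unfolding \<Phi>'_def by (rule \<Phi>_has_derivative[OF \<rho>(1,2) that])
    have bd: "\<exists>B. \<forall>n z. cmod z \<le> R \<longrightarrow> cmod (\<Phi> (\<rho> n) z) \<le> B \<and> (cmod z \<noteq> 1 \<longrightarrow> cmod (\<Phi>' n z d) \<le> B)" for R
    proof -
      obtain B1 where B1: "\<And>\<rho> z. 0 \<le> \<rho> \<Longrightarrow> \<rho> \<le> 1 \<Longrightarrow> cmod z \<le> R \<Longrightarrow> cmod (\<Phi> \<rho> z) \<le> B1" using \<Phi>_bounded by blast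
      obtain B2 where B2: "\<And>\<rho> Q z d. 0 \<le> \<rho> \<Longrightarrow> \<rho> \<le> 1 \<Longrightarrow> cmod z \<le> R \<Longrightarrow> Q \<in> U_disk k \<Longrightarrow> cmod d = 1 \<Longrightarrow> cmod (d\<Phi> \<rho> Q z d) \<le> B2"
        using d\<Phi>_bounded by blast
      have d1: "cmod d = 1" using d by auto
      have "cmod (\<Phi> (\<rho> n) z) \<le> max B1 B2 \<and> cmod (\<Phi>' n z d) \<le> max B1 B2" if "cmod z \<le> R" for n z
        using B1[OF \<rho>(1) \<rho>' that, of n] B2[OF \<rho>(1) \<rho>' that q_U[OF scaled_retract_ball[OF \<rho>(1,2)]] d1, of n n z]
        unfolding \<Phi>'_def by (simp add: le_max_iff_disj)
      then show ?thesis by blast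
    qed
    have lim1: "(\<lambda>n. \<Phi> (\<rho> n) z) \<longlonglongrightarrow> \<Phi> 1 z" for z by (rule \<Phi>_tendsto[OF \<rho>(1) \<rho>' \<rho>(3)])
    have G: "(\<lambda>z. d\<Phi> 1 (Q z) z d) \<in> borel_measurable lebesgue"
      using d\<Phi>_measurable[OF Q] by (simp add: measurable_completion)
    have lim2: "AE z in lebesgue. (\<lambda>n. \<Phi>' n z d) \<longlonglongrightarrow> d\<Phi> 1 (Q z) z d"
      using lim by eventually_elim (simp add: \<Phi>'_def d\<Phi>_tendsto[OF \<rho>(1) \<rho>' \<rho>(3)])
    show ?thesis
      using weak_directional_derivative_limit[OF \<phi> d c1 c2 der bd lim1 G lim2] by simp
  qed
  show thesis by (rule that[OF Q _ main]) (use lim in auto)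
qed

lemma locally_integrable_d\<Phi>:
  assumes Q: "Q \<in> borel_measurable borel" "AE z in lebesgue. Q z \<in> U_disk k" and d: "cmod d = 1"
    and S: "compact S"
  shows "set_integrable lebesgue S (\<lambda>z. d\<Phi> 1 (Q z) z d)"
proof -
  obtain R where R: "\<And>z. z \<in> S \<Longrightarrow> cmod z \<le> R" using compact_imp_bounded[OF S] unfolding bounded_iff by blast
  obtain B where B: "\<And>\<rho> Q z d. 0 \<le> \<rho> \<Longrightarrow> \<rho> \<le> 1 \<Longrightarrow> cmod z \<le> R \<Longrightarrow> Q \<in> U_disk k \<Longrightarrow> cmod d = 1 \<Longrightarrow> cmod (d\<Phi> \<rho> Q z d) \<le> B"
    using d\<Phi>_bounded by blast
  have S': "S \<in> lmeasurable" by (rule lmeasurable_compact[OF S])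
  have [measurable]: "S \<in> sets lebesgue" using S' by (rule fmeasurableD)
  have [measurable]: "(\<lambda>z. d\<Phi> 1 (Q z) z d) \<in> borel_measurable lebesgue"
    using d\<Phi>_measurable[OF Q(1)] by (simp add: measurable_completion)
  have w: "integrable lebesgue (\<lambda>z. indicator S z * B)"
    using S' by (intro integrable_mult_left integrable_real_indicator) (auto simp: fmeasurable_def)
  show ?thesis unfolding set_integrable_def
  proof (rule Bochner_Integration.integrable_bound[OF w])
    show "(\<lambda>z. indicator S z *\<^sub>R d\<Phi> 1 (Q z) z d) \<in> borel_measurable lebesgue" by measurable
    show "AE z in lebesgue. norm (indicator S z *\<^sub>R d\<Phi> 1 (Q z) z d) \<le> norm (indicator S z * B)"
      using Q(2)
    proof eventually_elim
      case (elim z)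
      show ?case
      proof (cases "z \<in> S")
        case True
        have "cmod (d\<Phi> 1 (Q z) z d) \<le> B" by (rule B) (use R[OF True] elim d in auto)
        then show ?thesis using True by simp
      qed simp
    qed
  qed
qed

theorem extension_quasiconformal: "quasiconformal_automorphism k (\<Phi> 1)"
proof -
  obtain Q where Q: "Q \<in> borel_measurable borel" "AE z in lebesgue. Q z \<in> U_disk k"
    and W: "\<And>\<phi> d. \<phi> \<in> test_functions UNIV \<Longrightarrow> d = 1 \<or> d = \<i> \<Longrightarrow>
       integrable lebesgue (\<lambda>z. \<Phi> 1 z * frechet_derivative \<phi> (at z) d) \<and>
       integrable lebesgue (\<lambda>z. d\<Phi> 1 (Q z) z d * \<phi> z) \<and>
       (LINT z|lebesgue. \<Phi> 1 z * frechet_derivative \<phi> (at z) d) = - (LINT z|lebesgue. d\<Phi> 1 (Q z) z d * \<phi> z)"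
    using extension_weak_derivatives by blast
  let ?F = "\<Phi> 1"
  let ?G = "\<lambda>d z. d\<Phi> 1 (Q z) z d"
  define Fz Fzbar where "Fz = (\<lambda>z. (?G 1 z - \<i> * ?G \<i> z) / 2)" and "Fzbar = (\<lambda>z. (?G 1 z + \<i> * ?G \<i> z) / 2)"
  have loc: "locally_integrable_on Fz UNIV" "locally_integrable_on Fzbar UNIV"
    unfolding locally_integrable_on_def Fz_def Fzbar_def using locally_integrable_d\<Phi>[OF Q]
    by (auto intro!: set_integral_add set_integral_diff set_integrable_mult_right set_integrable_divide)
  have distr: "(LINT z|lebesgue. ?F z * ((frechet_derivative \<phi> (at z) 1 + c * frechet_derivative \<phi> (at z) \<i>) / 2))
      = - (LINT z|lebesgue. (?G 1 z + c * ?G \<i> z) / 2 * \<phi> z)"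
    if "\<phi> \<in> test_functions UNIV" for \<phi> c
  proof -
    note W1 = W[OF that, of 1, simplified] and W2 = W[OF that, of \<i>, simplified]
    have "(LINT z|lebesgue. ?F z * ((frechet_derivative \<phi> (at z) 1 + c * frechet_derivative \<phi> (at z) \<i>) / 2))
       = (LINT z|lebesgue. (?F z * frechet_derivative \<phi> (at z) 1) / 2 + (c / 2) * (?F z * frechet_derivative \<phi> (at z) \<i>))"
      by (rule Bochner_Integration.integral_cong) (auto simp: field_simps)
    also have "\<dots> = (LINT z|lebesgue. ?F z * frechet_derivative \<phi> (at z) 1) / 2 + (c / 2) * (LINT z|lebesgue. ?F z * frechet_derivative \<phi> (at z) \<i>)"
      using W1 W2 by (subst Bochner_Integration.integral_add) auto
    also have "\<dots> = - ((LINT z|lebesgue. ?G 1 z * \<phi> z) / 2 + (c / 2) * (LINT z|lebesgue. ?G \<i> z * \<phi> z))"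
      using W1 W2 by simp
    also have "(LINT z|lebesgue. ?G 1 z * \<phi> z) / 2 + (c / 2) * (LINT z|lebesgue. ?G \<i> z * \<phi> z)
       = (LINT z|lebesgue. (?G 1 z * \<phi> z) / 2 + (c / 2) * (?G \<i> z * \<phi> z))"
      using W1 W2 by (subst Bochner_Integration.integral_add) auto
    also have "\<dots> = (LINT z|lebesgue. (?G 1 z + c * ?G \<i> z) / 2 * \<phi> z)"
      by (rule Bochner_Integration.integral_cong) (auto simp: field_simps)
    finally show ?thesis .
  qed
  have "distributional_z UNIV ?F Fz" "distributional_zbar UNIV ?F Fzbar"
    unfolding distributional_z_def distributional_zbar_def set_lebesgue_integral_def wirtinger_z_def wirtinger_zbar_def
      partial_x_def partial_y_def Fz_def Fzbar_def
    using distr[of _ "-\<i>"] distr[of _ \<i>] by simp_all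
  moreover have "AE z in lebesgue. z \<in> UNIV \<longrightarrow> cmod (Fzbar z) \<le> k * cmod (Fz z)"
    using Q(2) by eventually_elim (simp only: Fz_def Fzbar_def wirtinger_inequality simp_thms)
  moreover have "range ?F = UNIV" using extension_bij by (rule bij_is_surj)
  ultimately show ?thesis
    unfolding quasiconformal_automorphism_def quasiconformal_on_def
    using k loc extension_homeomorphism extension_sense_preserving by blast
qed

end

text \<open>
  The logarithmic derivative of \<open>z f' f\<^bsup>\<gamma> - 1\<^esup>\<close> with respect to \<open>log z\<close> is the expression in the
  hypothesis, which identifies it with \<open>q = P + z P'/P\<close> for \<open>P = \<gamma> z f'/f\<close>. It remains to provide
  the boundary values required by the locale.
\<close>
theorem theorem4:
  fixes \<alpha> \<beta> k :: real and f :: "complex \<Rightarrow> complex"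
  assumes "\<alpha> > 0" and "0 \<le> k" and "k < 1"
    and "f \<in> class_A"
    and "\<And>z. z \<in> ball 0 1 \<Longrightarrow> deriv f z \<noteq> 0"
    and "\<And>z. z \<in> ball 0 1 \<Longrightarrow> z \<noteq> 0 \<Longrightarrow> f z \<noteq> 0"
    and "\<And>z. z \<in> ball 0 1 \<Longrightarrow>
      1 + z * deriv (deriv f) z / deriv f z
        + (of_real \<alpha> + \<i> * of_real \<beta> - 1) * log_deriv_quotient f z \<in> U_disk k"
  shows "\<exists>F. quasiconformal_automorphism k F \<and> (\<forall>z\<in>ball 0 1. F z = f z)"
proof -
  note k = assms(2,3)
  define \<gamma> where "\<gamma> = of_real \<alpha> + \<i> * of_real \<beta>"
  have \<gamma>: "Re \<gamma> > 0" "\<gamma> \<noteq> 0" using assms(1) by (auto simp: \<gamma>_def complex_eq_iff)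
  have f: "f holomorphic_on ball 0 1" "f 0 = 0" "deriv f 0 = 1" using assms(4) by (auto simp: class_A_def)
  \<comment> \<open>\<open>f(z)/z\<close> with its removable singularity filled in has no zeros, hence a holomorphic logarithm.\<close>
  define g where "g = (\<lambda>z. if z = 0 then deriv f 0 else f z / z)"
  have g: "g holomorphic_on ball 0 1"
    by (rule pole_theorem_open_0[OF f(1) open_ball, of 0]) (auto simp: g_def f(2))
  have g0: "g z \<noteq> 0" if "z \<in> ball 0 1" for z using assms(6)[OF that] f(3) by (simp add: g_def)
  obtain l where l: "l holomorphic_on ball 0 1" "\<And>z. z \<in> ball 0 1 \<Longrightarrow> g z = exp (l z)"
    using contractible_imp_holomorphic_log[OF g convex_imp_contractible[OF convex_ball] g0] by blast
  have fl: "f z = z * exp (l z)" if "z \<in> ball 0 1" for z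
    using l(2)[OF that, symmetric] f(2) by (simp add: g_def)
  \<comment> \<open>This is \<open>z f'/f\<close>; its zeros in the disc would be zeros of \<open>f'\<close>.\<close>
  define p where "p = (\<lambda>z. 1 + z * deriv l z)"
  have dl: "deriv l holomorphic_on ball 0 1" by (rule holomorphic_deriv[OF l(1) open_ball])
  have p: "p holomorphic_on ball 0 1" unfolding p_def by (intro holomorphic_intros dl)
  have ld: "(l has_field_derivative deriv l z) (at z)" if "z \<in> ball 0 1" for z
    by (rule holomorphic_derivI[OF l(1) open_ball that])
  have pd: "(p has_field_derivative deriv p z) (at z)" if "z \<in> ball 0 1" for z
    by (rule holomorphic_derivI[OF p open_ball that])
  have f': "deriv f z = exp (l z) * p z" if z: "z \<in> ball 0 1" for z
  proof -
    have "((\<lambda>z. z * exp (l z)) has_field_derivative exp (l z) * p z) (at z)"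
      using ld[OF z] by (auto intro!: derivative_eq_intros simp: p_def algebra_simps)
    then have "(f has_field_derivative exp (l z) * p z) (at z)"
      by (rule has_field_derivative_transform_within_open[OF _ open_ball z]) (simp add: fl)
    then show ?thesis by (rule DERIV_imp_deriv)
  qed
  have p0: "p z \<noteq> 0" if "z \<in> ball 0 1" for z using assms(5)[OF that] f'[OF that] by auto
  have f'': "deriv (deriv f) z = exp (l z) * (deriv l z * p z + deriv p z)" if z: "z \<in> ball 0 1" for z
  proof -
    have "((\<lambda>z. exp (l z) * p z) has_field_derivative exp (l z) * (deriv l z * p z + deriv p z)) (at z)"
      using ld[OF z] pd[OF z] by (auto intro!: derivative_eq_intros simp: algebra_simps)
    then have "(deriv f has_field_derivative exp (l z) * (deriv l z * p z + deriv p z)) (at z)"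
      by (rule has_field_derivative_transform_within_open[OF _ open_ball z]) (simp add: f')
    then show ?thesis by (rule DERIV_imp_deriv)
  qed
  define P where "P = (\<lambda>z. \<gamma> * p z)"
  define q where "q = (\<lambda>z. P z + z * deriv P z / P z)"
  have P: "P holomorphic_on ball 0 1" unfolding P_def by (intro holomorphic_intros p)
  have P0: "P z \<noteq> 0" if "z \<in> ball 0 1" for z using p0[OF that] \<gamma> by (simp add: P_def)
  have P': "deriv P z = \<gamma> * deriv p z" if "z \<in> ball 0 1" for z
    unfolding P_def using DERIV_cmult[OF pd[OF that], of \<gamma>] by (rule DERIV_imp_deriv)
  have qU: "q z \<in> U_disk k" if z: "z \<in> ball 0 1" for z
  proof -
    have "log_deriv_quotient f z = p z"
      using fl[OF z] f'[OF z] by (cases "z = 0") (auto simp: log_deriv_quotient_def p_def)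
    moreover have "z * deriv (deriv f) z / deriv f z = p z - 1 + z * deriv p z / p z"
    proof -
      have "z * deriv (deriv f) z / deriv f z = (z * deriv l z * p z + z * deriv p z) / p z"
      proof -
        have "z * deriv (deriv f) z / deriv f z
            = (exp (l z) * (z * deriv l z * p z + z * deriv p z)) / (exp (l z) * p z)"
          by (simp add: f'[OF z] f''[OF z] algebra_simps)
        then show ?thesis by (simp only: mult_divide_mult_cancel_left[OF exp_not_eq_zero])
      qed
      also have "z * deriv l z = p z - 1" by (simp add: p_def)
      finally show ?thesis using p0[OF z] by (simp add: add_divide_distrib)
    qed
    ultimately have "1 + z * deriv (deriv f) z / deriv f z + (\<gamma> - 1) * log_deriv_quotient f z = q z"
      using \<gamma>(2) p0[OF z] by (simp add: q_def P_def P'[OF z, unfolded P_def] algebra_simps)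
    then show ?thesis using assms(7)[OF z] unfolding \<gamma>_def by simp
  qed
  have q: "q holomorphic_on ball 0 1" unfolding q_def by (intro holomorphic_intros P P0 holomorphic_deriv[OF P]) auto
  have PU: "P z \<in> U_disk k" if "z \<in> ball 0 1" for z
    by (rule U_disk_subordination[OF k P P0 _ that]) (use qU q_def in auto)
  obtain C where C: "C > 0" "\<And>w. w \<in> U_disk k \<Longrightarrow> cmod w \<le> C"
    using U_disk_bounded[OF k] unfolding bounded_pos by blast
  have ode: "z * deriv P z = P z * (q z - P z)" if "z \<in> ball 0 1" for z
    using P0[OF that] by (simp add: q_def)
  \<comment> \<open>From here on the boundedness of \<open>U(k)\<close> provides the continuous extensions to the closed disc.\<close>
  have "cmod (z * deriv P z) \<le> C * (C + C)" if "z \<in> ball 0 1" for z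
    unfolding ode[OF that] norm_mult
    using C(2)[OF PU[OF that]] C(2)[OF qU[OF that]] norm_triangle_ineq4[of "q z" "P z"] C(1) by (intro mult_mono) auto
  then obtain P1 where P1: "continuous_on (cball 0 1) P1" "\<And>z. z \<in> ball 0 1 \<Longrightarrow> P1 z = P z"
    using bounded_radial_derivative_extension[OF P] by metis
  have "cmod (z * deriv l z) \<le> C / cmod \<gamma> + 1" if "z \<in> ball 0 1" for z
  proof -
    have "z * deriv l z = P z / \<gamma> - 1" using \<gamma> by (simp add: P_def p_def)
    then have "cmod (z * deriv l z) \<le> cmod (P z / \<gamma>) + 1" using norm_triangle_ineq4[of "P z / \<gamma>" 1] by simp
    then show ?thesis using C(2)[OF PU[OF that]] divide_right_mono[of "cmod (P z)" C "cmod \<gamma>"] by (simp add: norm_divide)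
  qed
  then obtain l1 where l1: "continuous_on (cball 0 1) l1" "\<And>z. z \<in> ball 0 1 \<Longrightarrow> l1 z = l z"
    using bounded_radial_derivative_extension[OF l(1)] by metis
  have dP1: "deriv P1 z = deriv P z" and dl1: "deriv l1 z = deriv l z" if z: "z \<in> ball 0 1" for z
  proof -
    show "deriv P1 z = deriv P z"
      by (rule DERIV_imp_deriv, rule has_field_derivative_transform_within_open[OF holomorphic_derivI[OF P open_ball z] open_ball z])
        (simp add: P1)
    show "deriv l1 z = deriv l z"
      by (rule DERIV_imp_deriv, rule has_field_derivative_transform_within_open[OF ld[OF z] open_ball z]) (simp add: l1)
  qed
  have P1U: "P1 z \<in> U_disk k" if "z \<in> cball 0 1" for z
  proof -
    have "P1 ` closure (ball 0 1) \<subseteq> U_disk k"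
      by (rule image_closure_subset) (use P1 PU U_disk_closed[OF k] in auto)
    then show ?thesis using that by auto
  qed
  have hol: "P1 holomorphic_on ball 0 1" "l1 holomorphic_on ball 0 1"
    using holomorphic_transform[OF P] holomorphic_transform[OF l(1)] P1(2) l1(2) by metis+
  interpret bazilevic_data \<gamma> k l1 P1 q
  proof
    show "P1 z = \<gamma> * (1 + z * deriv l1 z)" if "z \<in> ball 0 1" for z
      using P1(2)[OF that] dl1[OF that] by (simp add: P_def p_def)
    show "z * deriv P1 z = P1 z * (q z - P1 z)" if "z \<in> ball 0 1" for z
      unfolding P1(2)[OF that] dP1[OF that] by (rule ode[OF that])
  qed (fact \<gamma>(1) k P1(1) l1(1) hol q P1U qU)+
  have "\<Phi> 1 z = f z" if "z \<in> ball 0 1" for z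
    using \<Phi>_inside[of z 1] fl[OF that] l1(2)[OF that] that by simp
  then show ?thesis using extension_quasiconformal by blast
qed

end
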